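(* Let $m\neq p$ and $n>p$, and let $\mathbf{Z}\sim\mathbb{C}N_{m\times p}(\mathbf{\Xi},\mathbf{I}_m\otimes\mathbf{\Sigma})$ and $\mathbf{S}\sim\mathbb{C}W_p(\mathbf{\Sigma},n)$ be independent, with $\mathbf{\Xi}\in\mathbb{C}^{m\times p}$ and the $p\times p$ positive definite Hermitian matrix $\mathbf{\Sigma}$ both unknown. Then the Efron-Morris estimator $$\widehat{\mathbf{\Xi}}^{(EM)}=\begin{cases}\mathbf{Z}\Big\{\mathbf{I}_p-\dfrac{m-p}{n+p}(\mathbf{Z}^*\mathbf{Z})^{-1}\mathbf{S}\Big\} & \text{if } m>p,\\[2mm] \Big\{\mathbf{I}_m-\dfrac{p-m}{n+2m-p}(\mathbf{Z}\mathbf{S}^{-1}\mathbf{Z}^* )^{-1}\Big\}\mathbf{Z} & \text{if } p>m\end{cases}$$ of $\mathbf{\Xi}$ is minimax.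
   Context: $^*$ denotes conjugate transpose. Distributions. $\mathbf{Z}\sim\mathbb{C}N_{m\times p}(\mathbf{\Xi},\mathbf{I}_m\otimes\mathbf{\Sigma})$ means that $\mathbf{Z}$ has density $\pi^{-mp}\mathrm{Det}(\mathbf{\Sigma})^{-m}\exp\{-\mathrm{Tr}((\mathbf{z}-\mathbf{\Xi})\mathbf{\Sigma}^{-1}(\mathbf{z}-\mathbf{\Xi})^* )\}$ with respect to Lebesgue measure on $\mathbb{C}^{m\times p}$. $\mathbf{S}\sim\mathbb{C}W_p(\mathbf{\Sigma},n)$ (complex Wishart) means that $\mathbf{S}$ has density $\mathrm{Det}(\mathbf{s})^{n-p}\exp(-\mathrm{Tr}(\mathbf{s}\mathbf{\Sigma}^{-1}))/\{\mathrm{Det}(\mathbf{\Sigma})^n\pi^{p(p-1)/2}\prod_{k=1}^p\Gamma(n+1-k)\}$ with respect to Lebesgue measure on the set of $p\times p$ positive definite Hermitian matrices. Risk and minimaxity. $\mathcal{R}(\widehat{\mathbf{\Xi}},(\mathbf{\Xi},\mathbf{\Sigma}))=\mathbb{E}[\mathrm{Tr}\{\mathbf{\Sigma}^{-1}(\widehat{\mathbf{\Xi}}-\mathbf{\Xi})^*(\widehat{\mathbf{\Xi}}-\mathbf{\Xi})\}]$, the expectation being over the joint distribution of $(\mathbf{Z},\mathbf{S})$. An estimator (a function of $(\mathbf{Z},\mathbf{S})$) is minimax if its supremum risk over all $(\mathbf{\Xi},\mathbf{\Sigma})$ equals the infimum over all estimators of the supremum risk. *)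

theory Defs
  imports "HOL-Analysis.Analysis"
begin

definition ctranspose :: "complex^'n^'m \<Rightarrow> complex^'m^'n" where
  "ctranspose A = (\<chi> i j. cnj (A $ j $ i))"

definition hermitian :: "complex^'n^'n \<Rightarrow> bool" where
  "hermitian A \<longleftrightarrow> ctranspose A = A"

(* For Hermitian A the quadratic form below is real, so taking Re loses nothing. *)
definition pos_def :: "complex^'n^'n \<Rightarrow> bool" where
  "pos_def A \<longleftrightarrow> hermitian A \<and>
     (\<forall>x. x \<noteq> 0 \<longrightarrow> 0 < Re (\<Sum>i\<in>UNIV. \<Sum>j\<in>UNIV. cnj (x $ i) * A $ i $ j * x $ j))"

(* The traces and determinants under Re in this theory are real whenever Sigma and s are
   Hermitian, as they are wherever these densities and the loss are used.  On complex^'p^'m,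
   lborel is Lebesgue measure in the real and imaginary parts of all entries. *)
definition cnormal :: "complex^'p^'m \<Rightarrow> complex^'p^'p \<Rightarrow> (complex^'p^'m) measure" where
  "cnormal \<Xi> \<Sigma> = density lborel (\<lambda>z. ennreal
     (exp (- Re (trace ((z - \<Xi>) ** matrix_inv \<Sigma> ** ctranspose (z - \<Xi>))))
      / (pi ^ (CARD('m) * CARD('p)) * Re (det \<Sigma>) ^ CARD('m))))"

(* Lebesgue measure on the real vector space of Hermitian matrices, in the coordinates
   s_ii, Re s_ij, Im s_ij (i < j).  These p^2 real coordinates are stored in a real square
   matrix: s_ii on the diagonal, Re s_ij above it at (i,j) and Im s_ij below it at (j,i).
   to_nat only serves to enumerate the index type; the measure does not depend on it, since
   exchanging i and j amounts to Im s_ji = - Im s_ij. *)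
definition hermitian_of_coords :: "real^'p^'p \<Rightarrow> complex^'p^'p" where
  "hermitian_of_coords x = (\<chi> i j.
     if i = j then complex_of_real (x $ i $ i)
     else if to_nat i < to_nat j then Complex (x $ i $ j) (x $ j $ i)
     else Complex (x $ j $ i) (- (x $ i $ j)))"

lemma hermitian_hermitian_of_coords: "hermitian (hermitian_of_coords x)"
proof -
  have "ctranspose (hermitian_of_coords x) $ i $ j = hermitian_of_coords x $ i $ j" for i j
    using linorder_less_linear[of "to_nat i" "to_nat j"]
    by (elim disjE) (auto simp: ctranspose_def hermitian_of_coords_def complex_eq_iff)
  then show ?thesis by (simp add: hermitian_def vec_eq_iff)
qed

lemma bij_betw_hermitian_of_coords:
  "bij_betw hermitian_of_coords UNIV {A :: complex^'p^'p. hermitian A}"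
proof -
  define g :: "complex^'p^'p \<Rightarrow> real^'p^'p" where
    "g A = (\<chi> i j. if to_nat j < to_nat i then Im (A $ j $ i) else Re (A $ i $ j))" for A
  have gf: "g (hermitian_of_coords x) = x" for x
  proof -
    have "g (hermitian_of_coords x) $ i $ j = x $ i $ j" for i j
      using linorder_less_linear[of "to_nat i" "to_nat j"]
      by (elim disjE) (auto simp: g_def hermitian_of_coords_def)
    then show ?thesis by (simp add: vec_eq_iff)
  qed
  have fg: "hermitian_of_coords (g A) = A" if "hermitian A" for A
  proof -
    have h: "A $ i $ j = cnj (A $ j $ i)" for i j
      using that unfolding hermitian_def ctranspose_def by (metis vec_lambda_beta)
    have "hermitian_of_coords (g A) $ i $ j = A $ i $ j" for i j
    proof -
      consider "to_nat i < to_nat j" | "i = j" | "to_nat j < to_nat i"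
        by (metis linorder_less_linear inj_to_nat injD)
      then show ?thesis
      proof cases
        case 1
        then show ?thesis by (auto simp: g_def hermitian_of_coords_def)
      next
        case 2
        have "Im (A $ i $ i) = 0"
          using arg_cong[OF h[of i i], where f = Im] by simp
        with 2 show ?thesis by (simp add: g_def hermitian_of_coords_def complex_eq_iff)
      next
        case 3
        have "A $ i $ j = Complex (Re (A $ j $ i)) (- Im (A $ j $ i))"
          by (subst h) (simp add: complex_eq_iff)
        with 3 show ?thesis by (auto simp: g_def hermitian_of_coords_def)
      qed
    qed
    then show ?thesis by (simp add: vec_eq_iff)
  qed
  show ?thesis
    by (rule bij_betwI[where g = g]) (auto simp: gf fg hermitian_hermitian_of_coords)
qed

definition hermitian_lebesgue :: "(complex^'p^'p) measure" where
  "hermitian_lebesgue = distr lborel borel hermitian_of_coords"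

definition cwishart :: "complex^'p^'p \<Rightarrow> real \<Rightarrow> (complex^'p^'p) measure" where
  "cwishart \<Sigma> n = density hermitian_lebesgue (\<lambda>s. if pos_def s then ennreal
     (Re (det s) powr (n - real CARD('p)) * exp (- Re (trace (s ** matrix_inv \<Sigma>)))
      / (Re (det \<Sigma>) powr n * pi ^ (CARD('p) * (CARD('p) - 1) div 2)
         * (\<Prod>k = 1..CARD('p). Gamma (n + 1 - real k)))) else 0)"

definition loss :: "complex^'p^'m \<Rightarrow> complex^'p^'p \<Rightarrow> complex^'p^'m \<Rightarrow> real" where
  "loss \<Xi> \<Sigma> d = Re (trace (matrix_inv \<Sigma> ** ctranspose (d - \<Xi>) ** (d - \<Xi>)))"

(* The product measure expresses the independence of Z and S.  For positive definite Sigma the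
   loss is nonnegative; its expectation is taken in [0, infinity]. *)
definition risk ::
  "real \<Rightarrow> ((complex^'p^'m) \<times> (complex^'p^'p) \<Rightarrow> complex^'p^'m) \<Rightarrow>
   complex^'p^'m \<Rightarrow> complex^'p^'p \<Rightarrow> ennreal" where
  "risk n \<delta> \<Xi> \<Sigma> =
     (\<integral>\<^sup>+ zs. ennreal (loss \<Xi> \<Sigma> (\<delta> zs)) \<partial>(cnormal \<Xi> \<Sigma> \<Otimes>\<^sub>M cwishart \<Sigma> n))"

definition sup_risk ::
  "real \<Rightarrow> ((complex^'p^'m) \<times> (complex^'p^'p) \<Rightarrow> complex^'p^'m) \<Rightarrow> ennreal" where
  "sup_risk n \<delta> = (SUP (\<Xi>, \<Sigma>) \<in> UNIV \<times> {\<Sigma>. pos_def \<Sigma>}. risk n \<delta> \<Xi> \<Sigma>)"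

definition estimators :: "((complex^'p^'m) \<times> (complex^'p^'p) \<Rightarrow> complex^'p^'m) set" where
  "estimators = borel_measurable borel"

definition minimax ::
  "real \<Rightarrow> ((complex^'p^'m) \<times> (complex^'p^'p) \<Rightarrow> complex^'p^'m) \<Rightarrow> bool" where
  "minimax n \<delta> \<longleftrightarrow> \<delta> \<in> estimators \<and>
     sup_risk n \<delta> =
       (INF \<delta>' \<in> (estimators :: ((complex^'p^'m) \<times> (complex^'p^'p) \<Rightarrow> complex^'p^'m) set).
          sup_risk n \<delta>')"

(* matrix_inv of a singular matrix is a fixed unspecified matrix; the inverses below exist
   almost surely.  Only CARD('m) \<noteq> CARD('p) is of interest. *)
definition efron_morris ::
  "real \<Rightarrow> complex^'p^'m \<Rightarrow> complex^'p^'p \<Rightarrow> complex^'p^'m" where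
  "efron_morris n Z S =
     (let m = real CARD('m); p = real CARD('p) in
      if m > p then
        Z ** (mat 1 - ((m - p) / (n + p)) *\<^sub>R (matrix_inv (ctranspose Z ** Z) ** S))
      else
        (mat 1 - ((p - m) / (n + 2 * m - p)) *\<^sub>R matrix_inv (Z ** matrix_inv S ** ctranspose Z)) ** Z)"

end

theory Submission
  imports Defs "HOL-Probability.Probability"
begin

text \<open>Write \<open>m\<close> and \<open>p\<close> for the numbers of rows and columns of \<open>Z\<close>. The estimator \<open>Z\<close> itself has constant risk
  \<open>m * p\<close>, and no estimator has a smaller supremum risk (\<open>sup_risk_lower_bound\<close>): for \<open>\<Sigma> = mat 1\<close> and a centred Gaussian
  prior on \<open>\<Xi>\<close> with precision \<open>\<kappa>\<close>, the posterior variance gives the Bayes risk \<open>m * p / (1 + \<kappa>)\<close>, and \<open>\<kappa>\<close> may be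
  arbitrarily small. So the theorem says that the risk of the Efron-Morris estimator is nowhere larger than \<open>m * p\<close>
  (\<open>sup_risk_efron_morris\<close>).

  Multiplying \<open>Z\<close> and \<open>\<Xi>\<close> by \<open>ctranspose A\<close> and turning \<open>S\<close> and \<open>\<Sigma>\<close> into \<open>A ** S ** ctranspose A\<close> and
  \<open>A ** \<Sigma> ** ctranspose A\<close> changes neither the family of distributions nor the loss, and the estimator is equivariant. As \<open>A\<close>
  can be chosen with \<open>A ** \<Sigma> ** ctranspose A = mat 1\<close> (\<open>pos_def_reduce\<close>), only \<open>\<Sigma> = mat 1\<close> remains, where the loss is
  the squared Euclidean distance.

  Let \<open>m > p\<close>. Put \<open>W = ctranspose Z ** Z\<close> and \<open>G = Z ** matrix_inv W ** S\<close>. For fixed \<open>S\<close>, Stein's identity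
  turns the mean of \<open>(Z - \<Xi>) \<bullet> G\<close> into half the mean divergence of \<open>G\<close>, and the risk of \<open>Z - c *\<^sub>R G\<close> becomes
  the mean of \<open>m * p - 2 * c * (m - p) * trace (matrix_inv W ** S) + c\<^sup>2 * trace (matrix_inv W ** S ** S)\<close>. A
  Wishart matrix satisfies \<open>E S = n\<close> and \<open>E (S ** S) = n * (n + p)\<close>, both times the identity. Hence the risk is
  \<open>m * p - n * (2 * c * (m - p) - c\<^sup>2 * (n + p)) * E (trace (matrix_inv W))\<close>, and \<open>c = (m - p) / (n + p)\<close> makes
  the correction nonpositive (\<open>efron_morris_risk_tall\<close>).

  Let \<open>p > m\<close>. With \<open>Y = ctranspose Z\<close> the correction is \<open>Y ** V\<close> for the inverse \<open>V\<close> of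
  \<open>ctranspose Y ** matrix_inv S ** Y\<close>. By unitary invariance \<open>V\<close> behaves like a Schur complement of \<open>S\<close>, whose
  moments are those of a smaller Wishart matrix with \<open>n - p + m\<close> degrees of freedom; so the same computation applies with \<open>n\<close>
  and \<open>p\<close> replaced by \<open>n - p + m\<close> and \<open>m\<close>, which yields the denominator \<open>n + 2 * m - p\<close>
  (\<open>nn_integral_cwishart_compression\<close>, \<open>efron_morris_risk_wide\<close>).

  Two points need care. The correction is singular where \<open>Z\<close> does not have full rank, so Stein's identity is applied with
  \<open>\<epsilon> *\<^sub>R mat 1\<close> added to the Gram matrix (\<open>stein_ridge\<close>), and \<open>\<epsilon>\<close> tends to zero by Fatou's lemma; this works because
  the added term only shrinks the correction, and the finiteness of \<open>E (trace (matrix_inv W))\<close> comes out of the same inequality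
  (\<open>shrinkage_risk_bound\<close>, \<open>nn_integral_trace_gram_inv_finite\<close>). The moments of Schur complements come from
  Bartlett's decomposition: eliminating one index after the other from the Wishart density leaves independent Gamma and
  Gaussian coordinates (\<open>nn_integral_wish_eliminate\<close>).\<close>

section \<open>Complex matrices\<close>

lemma ctranspose_nth [simp]: "ctranspose A $ i $ j = cnj (A $ j $ i)"
  by (simp add: ctranspose_def)

lemma ctranspose_ctranspose [simp]: "ctranspose (ctranspose A) = A"
  by (simp add: vec_eq_iff)

lemma ctranspose_mult: "ctranspose (A ** B) = ctranspose B ** ctranspose A"
  by (simp add: vec_eq_iff matrix_matrix_mult_def mult.commute)

lemma ctranspose_mat_1 [simp]: "ctranspose (mat 1) = mat 1"
  by (simp add: vec_eq_iff mat_def)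

lemma ctranspose_add: "ctranspose (A + B) = ctranspose A + ctranspose B"
  by (simp add: vec_eq_iff)

lemma ctranspose_diff: "ctranspose (A - B) = ctranspose A - ctranspose B"
  by (simp add: vec_eq_iff)

lemma ctranspose_scaleR: "ctranspose (c *\<^sub>R A) = c *\<^sub>R ctranspose A"
  by (simp add: vec_eq_iff)

lemma linear_ctranspose: "linear ctranspose"
  by (intro linearI ctranspose_add ctranspose_scaleR)

lemma scaleR_matrix_mult_left: "(c *\<^sub>R A) ** B = c *\<^sub>R (A ** B)" for A :: "complex^'n^'m"
  by (simp add: vec_eq_iff matrix_matrix_mult_def scaleR_right.sum)

lemma scaleR_matrix_mult_right: "A ** (c *\<^sub>R B) = c *\<^sub>R (A ** B)" for A :: "complex^'n^'m"
  by (simp add: vec_eq_iff matrix_matrix_mult_def scaleR_right.sum)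

lemma matrix_minus_rdistrib: "(A - B) ** C = A ** C - B ** C" for A :: "complex^'n^'m"
  by (simp add: vec_eq_iff matrix_matrix_mult_def sum_subtractf algebra_simps)

lemma matrix_minus_ldistrib: "A ** (B - C) = A ** B - A ** C" for A :: "complex^'n^'m"
  by (simp add: vec_eq_iff matrix_matrix_mult_def sum_subtractf algebra_simps)

lemma matrix_plus_rdistrib: "(A + B) ** C = A ** C + B ** C" for A :: "complex^'n^'m"
  by (simp add: vec_eq_iff matrix_matrix_mult_def sum.distrib algebra_simps)

lemma matrix_plus_ldistrib: "A ** (B + C) = A ** B + A ** C" for A :: "complex^'n^'m"
  by (simp add: vec_eq_iff matrix_matrix_mult_def sum.distrib algebra_simps)

lemmas matrix_distribs = scaleR_matrix_mult_left scaleR_matrix_mult_right matrix_minus_rdistrib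
  matrix_minus_ldistrib matrix_plus_rdistrib matrix_plus_ldistrib

lemma inner_matrix_trace: "A \<bullet> B = Re (trace (ctranspose A ** B))" for A B :: "complex^'n^'m"
proof -
  have "Re (trace (ctranspose A ** B)) = (\<Sum>i\<in>UNIV. \<Sum>k\<in>UNIV. A $ k $ i \<bullet> B $ k $ i)"
    by (simp add: trace_def matrix_matrix_mult_def inner_complex_def)
  also have "\<dots> = A \<bullet> B"
    unfolding inner_vec_def by (rule sum.swap)
  finally show ?thesis by simp
qed

lemma norm_ctranspose: "norm (ctranspose A) = norm A"
  unfolding norm_eq_sqrt_inner inner_matrix_trace by (subst trace_mul_sym) simp

lemma trace_ctranspose: "trace (ctranspose A) = cnj (trace A)"
  by (simp add: trace_def)

lemma trace_scaleR: "trace (c *\<^sub>R A) = c *\<^sub>R trace A" for A :: "complex^'n^'n"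
  by (simp add: trace_def scaleR_right.sum)

lemma inner_matrix_vector_ctranspose:
  "(A *v x) \<bullet> y = x \<bullet> (ctranspose A *v y)" for A :: "complex^'n^'m"
proof -
  have "(A *v x) \<bullet> y = (\<Sum>i\<in>UNIV. \<Sum>j\<in>UNIV. (A $ i $ j * x $ j) \<bullet> y $ i)"
    by (simp add: inner_vec_def matrix_vector_mult_def inner_sum_left)
  also have "\<dots> = (\<Sum>j\<in>UNIV. \<Sum>i\<in>UNIV. (A $ i $ j * x $ j) \<bullet> y $ i)"
    by (rule sum.swap)
  also have "\<dots> = (\<Sum>j\<in>UNIV. \<Sum>i\<in>UNIV. x $ j \<bullet> (cnj (A $ i $ j) * y $ i))"
    by (intro sum.cong refl) (simp add: inner_complex_def algebra_simps)
  also have "\<dots> = x \<bullet> (ctranspose A *v y)"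
    by (simp add: inner_vec_def matrix_vector_mult_def inner_sum_right)
  finally show ?thesis .
qed

lemma det_ctranspose: "det (ctranspose A) = cnj (det A)" for A :: "complex^'n^'n"
proof -
  have "det (ctranspose A) = det (transpose (map_matrix cnj A))"
    by (rule arg_cong[where f=det]) (simp add: vec_eq_iff transpose_def map_matrix_def)
  also have "\<dots> = det (map_matrix cnj A)" by (rule det_transpose)
  also have "\<dots> = cnj (det A)" by (simp add: det_def map_matrix_def)
  finally show ?thesis .
qed

section \<open>Inverses and positive definite matrices\<close>

lemma matrix_inv:
  assumes "invertible A"
  shows "A ** matrix_inv A = mat 1" "matrix_inv A ** A = mat 1"
  using someI_ex[OF assms[unfolded invertible_def]] unfolding matrix_inv_def by auto

lemma matrix_inv_unique:
  fixes A :: "complex^'n^'n"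
  assumes "A ** B = mat 1"
  shows "invertible A" "matrix_inv A = B"
proof -
  show i: "invertible A" using assms invertible_right_inverse by blast
  have "matrix_inv A = matrix_inv A ** (A ** B)" by (simp add: assms)
  also have "\<dots> = B" by (simp add: matrix_mul_assoc matrix_inv[OF i])
  finally show "matrix_inv A = B" .
qed

lemma invertible_matrix_inv: "invertible A \<Longrightarrow> invertible (matrix_inv A)" for A :: "complex^'n^'n"
  by (metis matrix_inv(2) matrix_inv_unique(1))

lemma matrix_inv_matrix_inv: "invertible A \<Longrightarrow> matrix_inv (matrix_inv A) = A" for A :: "complex^'n^'n"
  by (metis matrix_inv(2) matrix_inv_unique(2))

lemma matrix_inv_mult:
  fixes A B :: "complex^'n^'n"
  assumes "invertible A" "invertible B"
  shows "matrix_inv (A ** B) = matrix_inv B ** matrix_inv A"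
proof (rule matrix_inv_unique)
  have "A ** B ** (matrix_inv B ** matrix_inv A) = A ** (B ** matrix_inv B) ** matrix_inv A"
    by (simp add: matrix_mul_assoc)
  then show "A ** B ** (matrix_inv B ** matrix_inv A) = mat 1"
    by (simp add: matrix_inv assms)
qed

lemma invertible_ctranspose: "invertible A \<Longrightarrow> invertible (ctranspose A)" for A :: "complex^'n^'n"
  by (metis ctranspose_mult ctranspose_mat_1 matrix_inv(2) matrix_inv_unique(1))

lemma matrix_inv_ctranspose:
  fixes A :: "complex^'n^'n"
  assumes "invertible A"
  shows "matrix_inv (ctranspose A) = ctranspose (matrix_inv A)"
  by (rule matrix_inv_unique) (simp flip: ctranspose_mult add: matrix_inv[OF assms])

lemma invertible_mat_1: "invertible (mat 1 :: complex^'n^'n)"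
  by (rule matrix_inv_unique[of _ "mat 1"]) simp

lemma matrix_inv_mat_1 [simp]: "matrix_inv (mat 1 :: complex^'n^'n) = mat 1"
  by (rule matrix_inv_unique) simp

lemma invertible_iff_ker:
  "invertible A \<longleftrightarrow> (\<forall>x. A *v x = 0 \<longrightarrow> x = 0)" for A :: "complex^'n^'n"
  by (simp add: invertible_left_inverse matrix_left_invertible_ker)

lemma quadratic_form_inner:
  "Re (\<Sum>i\<in>UNIV. \<Sum>j\<in>UNIV. cnj (x $ i) * A $ i $ j * x $ j) = x \<bullet> (A *v x)" for A :: "complex^'n^'n"
proof -
  have "(\<Sum>j\<in>UNIV. Re (cnj (x $ i) * A $ i $ j * x $ j)) = x $ i \<bullet> (\<Sum>j\<in>UNIV. A $ i $ j * x $ j)" for i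
    unfolding inner_sum_right by (rule sum.cong) (simp_all add: inner_complex_def algebra_simps)
  then show ?thesis
    by (simp add: inner_vec_def matrix_vector_mult_def)
qed

lemma pos_def_iff: "pos_def A \<longleftrightarrow> ctranspose A = A \<and> (\<forall>x. x \<noteq> 0 \<longrightarrow> 0 < x \<bullet> (A *v x))"
  unfolding pos_def_def hermitian_def quadratic_form_inner ..

lemma pos_def_hermitian: "pos_def A \<Longrightarrow> ctranspose A = A"
  by (simp add: pos_def_iff)

lemma pos_def_invertible: "pos_def A \<Longrightarrow> invertible A"
  unfolding invertible_iff_ker pos_def_iff by (metis inner_zero_right less_irrefl)

lemma pos_def_mat_1 [simp]: "pos_def (mat 1)"
  by (simp add: pos_def_iff)

lemma scaleR_matrix_vector_mult: "(c *\<^sub>R A) *v x = c *\<^sub>R (A *v x)" for A :: "complex^'n^'m"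
  by (simp add: vec_eq_iff matrix_vector_mult_def scaleR_right.sum)

lemma matrix_vector_eq_0_iff: "invertible A \<Longrightarrow> A *v x = 0 \<longleftrightarrow> x = 0" for A :: "complex^'n^'n"
  by (metis invertible_iff_ker matrix_vector_mult_0_right)

lemma inner_gram: "x \<bullet> ((ctranspose Y ** R ** Y) *v x) = (Y *v x) \<bullet> (R *v (Y *v x))"
  for Y :: "complex^'l^'k"
  by (simp add: inner_matrix_vector_ctranspose matrix_vector_mul_assoc matrix_mul_assoc)

lemma pos_def_congruence:
  fixes Y :: "complex^'l^'k"
  assumes "pos_def R" "\<And>x. Y *v x = 0 \<Longrightarrow> x = 0"
  shows "pos_def (ctranspose Y ** R ** Y)"
  using assms unfolding pos_def_iff inner_gram
  by (auto simp: ctranspose_mult matrix_mul_assoc)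

lemma pos_def_congruence_iff:
  fixes A :: "complex^'n^'n"
  assumes "invertible A"
  shows "pos_def (A ** R ** ctranspose A) \<longleftrightarrow> pos_def R"
proof
  let ?B = "matrix_inv A"
  assume "pos_def (A ** R ** ctranspose A)"
  then have "pos_def (ctranspose (ctranspose ?B) ** (A ** R ** ctranspose A) ** ctranspose ?B)"
    by (rule pos_def_congruence)
       (simp add: matrix_vector_eq_0_iff invertible_ctranspose invertible_matrix_inv assms)
  also have "ctranspose (ctranspose ?B) ** (A ** R ** ctranspose A) ** ctranspose ?B
      = (?B ** A) ** R ** ctranspose (?B ** A)"
    by (simp add: matrix_mul_assoc ctranspose_mult)
  finally show "pos_def R" by (simp add: matrix_inv assms)
next
  assume "pos_def R"
  then have "pos_def (ctranspose (ctranspose A) ** R ** ctranspose A)"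
    by (rule pos_def_congruence) (simp add: matrix_vector_eq_0_iff invertible_ctranspose assms)
  then show "pos_def (A ** R ** ctranspose A)" by simp
qed

lemma pos_def_matrix_inv:
  assumes "pos_def A"
  shows "pos_def (matrix_inv A)"
proof -
  note i = pos_def_invertible[OF assms]
  have h: "ctranspose (matrix_inv A) = matrix_inv A"
    using matrix_inv_ctranspose[OF i] pos_def_hermitian[OF assms] by simp
  have "pos_def (matrix_inv A ** A ** ctranspose (matrix_inv A))"
    using assms pos_def_congruence_iff invertible_matrix_inv[OF i] by blast
  then show ?thesis by (simp add: h matrix_inv[OF i])
qed

lemma pos_def_diag: "pos_def A \<Longrightarrow> 0 < Re (A $ k $ k)"
proof -
  assume A: "pos_def A"
  have "(A *v axis k 1) $ k = A $ k $ k"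
    by (simp add: matrix_vector_mult_def axis_def if_distrib cong: if_cong)
  then have "axis k 1 \<bullet> (A *v axis k 1) = Re (A $ k $ k)"
    by (simp add: inner_axis' inner_complex_def)
  moreover have "axis k (1::complex) \<noteq> 0" by (simp add: axis_eq_0_iff)
  ultimately show ?thesis using A unfolding pos_def_iff by metis
qed

section \<open>Linear changes of variables\<close>

lemma nn_integral_translate:
  fixes h :: "'a::euclidean_space \<Rightarrow> ennreal"
  assumes [measurable]: "h \<in> borel_measurable borel"
  shows "(\<integral>\<^sup>+y. h (y + a) \<partial>lborel) = (\<integral>\<^sup>+y. h y \<partial>lborel)"
  by (subst (2) lborel_affine[of 1 a]) (simp_all add: nn_integral_density nn_integral_distr add.commute)

text \<open>A translation invariant measure is a multiple of Lebesgue measure: exchanging the order of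
  integration in the double integral of \<open>f (L x) * g (y - L x)\<close> separates the two factors.\<close>

lemma nn_integral_linear_exists:
  fixes L :: "'a::euclidean_space \<Rightarrow> 'b::euclidean_space"
  assumes L: "linear L" and bij: "bij L"
  shows "\<exists>J>0. \<forall>f\<in>borel_measurable borel.
    (\<integral>\<^sup>+x. f (L x) \<partial>lborel) = ennreal J * (\<integral>\<^sup>+y. f y \<partial>lborel)"
proof -
  define g :: "'b \<Rightarrow> ennreal" where "g = indicator (box 0 One)"
  have [measurable]: "g \<in> borel_measurable borel" by (simp add: g_def)
  have [measurable]: "L \<in> borel_measurable borel"
    by (intro borel_measurable_continuous_onI linear_continuous_on linear_linear[THEN iffD2] L)
  have g1: "(\<integral>\<^sup>+y. g y \<partial>lborel) = 1"
    by (simp add: g_def emeasure_lborel_box_eq)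
  define C where "C = (\<integral>\<^sup>+x. g (- L x) \<partial>lborel)"
  have eq: "(\<integral>\<^sup>+x. f (L x) \<partial>lborel) = C * (\<integral>\<^sup>+y. f y \<partial>lborel)"
    if [measurable]: "f \<in> borel_measurable borel" for f
  proof -
    obtain K where K: "\<And>y. L (K y) = y" using bij surj_f_inv_f[of L] by (metis bij_is_surj)
    have "(\<integral>\<^sup>+x. f (L x) \<partial>lborel) = (\<integral>\<^sup>+y. (\<integral>\<^sup>+x. f (L x) * g y \<partial>lborel) \<partial>lborel)"
      by (simp add: nn_integral_multc nn_integral_cmult g1)
    also have "\<dots> = (\<integral>\<^sup>+y. (\<integral>\<^sup>+x. f (L x + y) * g y \<partial>lborel) \<partial>lborel)"
    proof (rule nn_integral_cong)
      fix y
      have "(\<integral>\<^sup>+x. f (L (x + K y)) * g y \<partial>lborel) = (\<integral>\<^sup>+x. f (L x) * g y \<partial>lborel)"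
        by (rule nn_integral_translate) measurable
      then show "(\<integral>\<^sup>+x. f (L x) * g y \<partial>lborel) = (\<integral>\<^sup>+x. f (L x + y) * g y \<partial>lborel)"
        by (simp add: linear_add[OF L] K)
    qed
    also have "\<dots> = (\<integral>\<^sup>+x. (\<integral>\<^sup>+y. f (L x + y) * g y \<partial>lborel) \<partial>lborel)"
      by (rule lborel_pair.Fubini') measurable
    also have "\<dots> = (\<integral>\<^sup>+x. (\<integral>\<^sup>+y. f y * g (y - L x) \<partial>lborel) \<partial>lborel)"
    proof (rule nn_integral_cong)
      fix x
      have "(\<integral>\<^sup>+y. f (y + L x) * g ((y + L x) - L x) \<partial>lborel) = (\<integral>\<^sup>+y. f y * g (y - L x) \<partial>lborel)"
        by (rule nn_integral_translate[where h="\<lambda>y. f y * g (y - L x)"]) measurable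
      then show "(\<integral>\<^sup>+y. f (L x + y) * g y \<partial>lborel) = (\<integral>\<^sup>+y. f y * g (y - L x) \<partial>lborel)"
        by (simp add: add.commute)
    qed
    also have "\<dots> = (\<integral>\<^sup>+y. (\<integral>\<^sup>+x. f y * g (y - L x) \<partial>lborel) \<partial>lborel)"
      by (rule lborel_pair.Fubini') measurable
    also have "\<dots> = (\<integral>\<^sup>+y. f y * (\<integral>\<^sup>+x. g (y - L x) \<partial>lborel) \<partial>lborel)"
      by (intro nn_integral_cong nn_integral_cmult) measurable
    also have "\<dots> = (\<integral>\<^sup>+y. f y * C \<partial>lborel)"
    proof (intro nn_integral_cong arg_cong2[where f="(*)"] refl)
      fix y
      have "(\<integral>\<^sup>+x. g (y - L (x + K y)) \<partial>lborel) = (\<integral>\<^sup>+x. g (y - L x) \<partial>lborel)"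
        by (rule nn_integral_translate[where h="\<lambda>x. g (y - L x)"]) measurable
      then show "(\<integral>\<^sup>+x. g (y - L x) \<partial>lborel) = C"
        by (simp add: linear_add[OF L] K C_def)
    qed
    finally show ?thesis by (simp add: mult.commute[of _ C] nn_integral_cmult)
  qed
  have C: "C = emeasure lborel ((\<lambda>x. - L x) -` box 0 One)"
  proof -
    have "C = (\<integral>\<^sup>+x. indicator ((\<lambda>x. - L x) -` box 0 One) x \<partial>lborel)"
      by (simp add: C_def g_def indicator_def)
    also have "\<dots> = emeasure lborel ((\<lambda>x. - L x) -` box 0 One)"
    proof (rule nn_integral_indicator)
      have "(\<lambda>x. - L x) -` box 0 One \<inter> space borel \<in> sets borel"
        by (rule measurable_sets) (auto intro: borel_measurable_uminus)
      then show "(\<lambda>x. - L x) -` box 0 One \<in> sets lborel" by simp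
    qed
    finally show ?thesis .
  qed
  have lin: "linear (\<lambda>x. - L x)" by (rule linear_compose_neg[OF L])
  have "bij (\<lambda>x. - L x)"
    using bij_comp[OF bij bij_uminus] by (simp add: o_def)
  note b = this
  define K where "K = inv (\<lambda>x. - L x)"
  have K: "- L (K x) = x" "K (- L y) = y" for x y
    unfolding K_def using surj_f_inv_f[OF bij_is_surj[OF b]] inv_f_f[OF bij_is_inj[OF b]] by simp_all
  have vim: "(\<lambda>x. - L x) -` S = K ` S" for S
    by (rule set_eqI) (metis K image_iff vimage_eq)
  have K_eq: "K y = x" if "- L x = y" for x y using K(2)[of x] that by simp
  have "linear K"
  proof (rule linearI)
    show "K (x + y) = K x + K y" for x y
      by (rule K_eq) (simp only: linear_add[OF lin] K)
    show "K (c *\<^sub>R x) = c *\<^sub>R K x" for c x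
      by (rule K_eq) (simp only: linear_cmul[OF lin] K)
  qed
  then have "bounded ((\<lambda>x. - L x) -` box 0 One)"
    unfolding vim using bounded_linear_image[OF bounded_box] linear_conv_bounded_linear by blast
  then have "C < \<infinity>" unfolding C by (rule emeasure_bounded_finite)
  moreover have "C \<noteq> 0"
  proof
    assume C0: "C = 0"
    have "(\<integral>\<^sup>+x. 1 \<partial>lborel) = C * (\<integral>\<^sup>+y. 1 \<partial>(lborel::'b measure))"
      using eq[of "\<lambda>_. 1"] by simp
    then show False by (simp add: C0)
  qed
  ultimately have "C = ennreal (enn2real C)" "enn2real C > 0"
    by (simp_all add: enn2real_positive_iff zero_less_iff_neq_zero)
  then show ?thesis using eq by metis
qed

text \<open>The factor \<open>1 / \<bar>det L\<bar>\<close> of the substitution \<open>L\<close>. Being characterised by integration, it is multiplicative and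
  defined between different spaces, and the Jacobians of matrix actions follow from their values on diagonal matrices.\<close>

definition jac :: "('a::euclidean_space \<Rightarrow> 'b::euclidean_space) \<Rightarrow> real" where
  "jac L = (SOME J. J > 0 \<and> (\<forall>f\<in>borel_measurable borel.
    (\<integral>\<^sup>+x. f (L x) \<partial>lborel) = ennreal J * (\<integral>\<^sup>+y. f y \<partial>lborel)))"

lemma
  assumes "linear L" "bij L"
  shows jac_pos: "jac L > 0"
    and nn_integral_linear: "f \<in> borel_measurable borel \<Longrightarrow>
      (\<integral>\<^sup>+x. f (L x) \<partial>lborel) = ennreal (jac L) * (\<integral>\<^sup>+y. f y \<partial>lborel)"
  using someI_ex[OF nn_integral_linear_exists[OF assms]] unfolding jac_def by auto

text \<open>A single test function with finite nonzero integral determines the Jacobian.\<close>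

lemma jac_unique:
  fixes L :: "'a::euclidean_space \<Rightarrow> 'b::euclidean_space"
  assumes L: "linear L" "bij L" and f: "f \<in> borel_measurable borel"
    and eq: "(\<integral>\<^sup>+x. f (L x) \<partial>lborel) = ennreal J * (\<integral>\<^sup>+y. f y \<partial>lborel)"
    and nz: "(\<integral>\<^sup>+y. f y \<partial>lborel) \<noteq> 0" "(\<integral>\<^sup>+y. f y \<partial>lborel) \<noteq> \<infinity>" and "0 \<le> J"
  shows "jac L = J"
proof -
  have "ennreal (jac L) * (\<integral>\<^sup>+y. f y \<partial>lborel) = ennreal J * (\<integral>\<^sup>+y. f y \<partial>lborel)"
    using nn_integral_linear[OF L f] eq by simp
  then have "ennreal (jac L) = ennreal J"
    using nz by (metis ennreal_mult_cancel_left infinity_ennreal_def mult.commute top.not_eq_extremum)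
  then show ?thesis using jac_pos[OF L] \<open>0 \<le> J\<close> by simp
qed

lemma nn_integral_unit_box:
  "(\<integral>\<^sup>+y. indicator (box 0 One) (y::'a::euclidean_space) \<partial>lborel) = (1::ennreal)"
  by (simp add: emeasure_lborel_box_eq)

lemma jac_compose:
  fixes L :: "'b::euclidean_space \<Rightarrow> 'c::euclidean_space" and M :: "'a::euclidean_space \<Rightarrow> 'b"
  assumes L: "linear L" "bij L" and M: "linear M" "bij M"
  shows "jac (\<lambda>x. L (M x)) = jac L * jac M"
proof (rule jac_unique[where f="indicator (box 0 One)"])
  show "linear (\<lambda>x. L (M x))" using linear_compose[OF M(1) L(1)] by (simp add: o_def)
  show "bij (\<lambda>x. L (M x))" using bij_comp[OF M(2) L(2)] by (simp add: o_def)
  have [measurable]: "L \<in> borel_measurable borel"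
    by (intro borel_measurable_continuous_onI linear_continuous_on linear_linear[THEN iffD2] L)
  have "(\<integral>\<^sup>+x. indicator (box 0 One) (L (M x)) \<partial>lborel) = ennreal (jac M) * (\<integral>\<^sup>+x. indicator (box 0 One) (L x) \<partial>lborel)"
    by (rule nn_integral_linear[OF M, where f="\<lambda>x. indicator (box 0 One) (L x)"]) measurable
  also have "(\<integral>\<^sup>+x. indicator (box 0 One) (L x) \<partial>lborel) = ennreal (jac L) * (\<integral>\<^sup>+y. indicator (box 0 One) (y::'c) \<partial>lborel)"
    by (rule nn_integral_linear[OF L, where f="indicator (box 0 One)"]) measurable
  finally show "(\<integral>\<^sup>+x. indicator (box 0 One) (L (M x)) \<partial>lborel)
      = ennreal (jac L * jac M) * (\<integral>\<^sup>+y. indicator (box 0 One) (y::'c) \<partial>lborel)"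
    using jac_pos[OF L] jac_pos[OF M] by (simp add: ennreal_mult' mult_ac)
qed (use jac_pos[OF L] jac_pos[OF M] in \<open>simp_all add: nn_integral_unit_box del: nn_integral_indicator\<close>)

lemma jac_eq_1I:
  fixes L :: "'a::euclidean_space \<Rightarrow> 'a"
  assumes L: "linear L" "bij L" and f: "f \<in> borel_measurable borel"
    and inv: "\<And>x. f (L x) = f x"
    and nz: "(\<integral>\<^sup>+y. f y \<partial>lborel) \<noteq> 0" "(\<integral>\<^sup>+y. f y \<partial>lborel) \<noteq> \<infinity>"
  shows "jac L = 1"
  by (rule jac_unique[OF L f _ nz]) (simp_all add: inv)

lemma nn_integral_diagonal:
  fixes c :: "'a::euclidean_space \<Rightarrow> real"
  assumes c: "\<And>j. j \<in> Basis \<Longrightarrow> c j \<noteq> 0" and [measurable]: "f \<in> borel_measurable borel"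
  shows "(\<integral>\<^sup>+x. f x \<partial>lborel) = (\<Prod>j\<in>Basis. \<bar>c j\<bar>) * (\<integral>\<^sup>+x. f (t + (\<Sum>j\<in>Basis. (c j * (x \<bullet> j)) *\<^sub>R j)) \<partial>lborel)"
  by (subst lborel_affine_euclidean[where c=c and t=t, OF c])
     (simp_all add: nn_integral_density nn_integral_distr nn_integral_cmult)

lemma bij_diagonal:
  fixes c :: "'a::euclidean_space \<Rightarrow> real"
  assumes c: "\<And>j. j \<in> Basis \<Longrightarrow> c j \<noteq> 0"
  shows "bij (\<lambda>x. \<Sum>j\<in>Basis. (c j * (x \<bullet> j)) *\<^sub>R j)"
proof (rule bij_betw_byWitness[where f'="\<lambda>x. \<Sum>j\<in>Basis. ((x \<bullet> j) / c j) *\<^sub>R j"])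
qed (auto simp: c inner_sum_left inner_Basis if_distrib cong: if_cong intro!: euclidean_eqI[where 'a='a])

lemma jac_diagonal:
  fixes c :: "'a::euclidean_space \<Rightarrow> real"
  assumes c: "\<And>j. j \<in> Basis \<Longrightarrow> c j \<noteq> 0"
  shows "jac (\<lambda>x. \<Sum>j\<in>Basis. (c j * (x \<bullet> j)) *\<^sub>R j) = 1 / (\<Prod>j\<in>Basis. \<bar>c j\<bar>)"
proof (rule jac_unique[where f="indicator (box 0 One)"])
  have p: "0 < (\<Prod>j\<in>Basis. \<bar>c j\<bar>)" using c by (intro prod_pos) auto
  let ?I = "\<integral>\<^sup>+x. indicator (box 0 One) (\<Sum>j\<in>Basis. (c j * (x \<bullet> j)) *\<^sub>R j :: 'a) \<partial>lborel"
  have "1 = (\<Prod>j\<in>Basis. \<bar>c j\<bar>) * ?I"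
    using nn_integral_diagonal[where c=c and f="indicator (box 0 One)" and t=0, OF c]
    by (simp add: nn_integral_unit_box del: nn_integral_indicator)
  then have "ennreal (1 / (\<Prod>j\<in>Basis. \<bar>c j\<bar>)) * 1
      = ennreal (1 / (\<Prod>j\<in>Basis. \<bar>c j\<bar>)) * (ennreal (\<Prod>j\<in>Basis. \<bar>c j\<bar>) * ?I)"
    by (simp add: prod_ennreal)
  also have "\<dots> = ?I"
    using p c by (simp add: mult.assoc[symmetric] ennreal_mult[symmetric])
  finally show "?I = ennreal (1 / (\<Prod>j\<in>Basis. \<bar>c j\<bar>)) * (\<integral>\<^sup>+y. indicator (box 0 One) (y::'a) \<partial>lborel)"
    by (simp add: nn_integral_unit_box del: nn_integral_indicator)
  show "0 \<le> 1 / (\<Prod>j\<in>Basis. \<bar>c j\<bar>)" using p by simp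
qed (auto intro!: bij_diagonal linear_compose_sum linearI simp: c nn_integral_unit_box algebra_simps sum.distrib scaleR_right.sum inner_add_left simp del: nn_integral_indicator)

lemma bij_involution: "(\<And>x. f (f x) = x) \<Longrightarrow> bij f"
  by (rule bij_betw_byWitness[where f'=f]) auto

lemma jac_id: "jac (\<lambda>x. x) = 1"
  by (rule jac_eq_1I[where f="indicator (box 0 One)"])
     (simp_all add: nn_integral_unit_box linear_ident bij_betw_def del: nn_integral_indicator)

lemma jac_involution:
  fixes L :: "'a::euclidean_space \<Rightarrow> 'a"
  assumes L: "linear L" and inv: "\<And>x. L (L x) = x"
  shows "jac L = 1"
proof -
  note b = bij_involution[of L, OF inv]
  have "jac L * jac L = 1"
    using jac_compose[OF L b L b] by (simp add: inv jac_id)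
  then have "jac L ^ 2 = 1" by (simp add: power2_eq_square)
  then show ?thesis using jac_pos[OF L b] by (auto simp: power2_eq_1_iff)
qed

section \<open>Reducing a positive definite matrix to the identity\<close>

definition col_scale :: "'n \<Rightarrow> real \<Rightarrow> complex^'n^'n" where
  "col_scale k r = (\<chi> i j. if i = j then (if i = k then of_real r else 1) else 0)"

definition col_shear :: "'n \<Rightarrow> complex^'n \<Rightarrow> complex^'n^'n" where
  "col_shear k w = (\<chi> i j. if i = j then 1 else if j = k then w $ i else 0)"

lemma col_scale_mult: "(col_scale k r ** M) $ i $ j = (if i = k then of_real r else 1) * M $ i $ j"
  for M :: "complex^'m^'n"
proof -
  have "(col_scale k r ** M) $ i $ j
      = (\<Sum>l\<in>UNIV. if l = i then (if i = k then of_real r else 1) * M $ i $ j else 0)"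
    unfolding matrix_matrix_mult_def vec_lambda_beta by (rule sum.cong) (auto simp: col_scale_def)
  then show ?thesis by simp
qed

lemma col_shear_mult: "(col_shear k w ** M) $ i $ j = M $ i $ j + (if i = k then 0 else w $ i * M $ k $ j)"
  for M :: "complex^'m^'n"
proof -
  have "(col_shear k w ** M) $ i $ j
      = (\<Sum>l\<in>UNIV. (if l = i then M $ i $ j else 0) + (if l = k then (if i = k then 0 else w $ i * M $ k $ j) else 0))"
    unfolding matrix_matrix_mult_def vec_lambda_beta by (rule sum.cong) (auto simp: col_shear_def)
  then show ?thesis by (simp add: sum.distrib)
qed

lemma mult_ctranspose_col_scale:
  "(M ** ctranspose (col_scale k r)) $ i $ j = (if j = k then of_real r else 1) * M $ i $ j"
  for M :: "complex^'n^'m"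
proof -
  have "M ** ctranspose (col_scale k r) = ctranspose (col_scale k r ** ctranspose M)"
    by (simp add: ctranspose_mult)
  then show ?thesis by (simp add: col_scale_mult)
qed

lemma mult_ctranspose_col_shear:
  "(M ** ctranspose (col_shear k w)) $ i $ j = M $ i $ j + (if j = k then 0 else cnj (w $ j) * M $ i $ k)"
  for M :: "complex^'n^'m"
proof -
  have "M ** ctranspose (col_shear k w) = ctranspose (col_shear k w ** ctranspose M)"
    by (simp add: ctranspose_mult)
  then show ?thesis by (simp add: col_shear_mult)
qed

lemma col_scale_inverse: "r \<noteq> 0 \<Longrightarrow> col_scale k r ** col_scale k (1 / r) = mat 1"
  by (simp add: vec_eq_iff col_scale_mult) (simp add: col_scale_def mat_def)

lemma invertible_col_scale: "r \<noteq> 0 \<Longrightarrow> invertible (col_scale k r)"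
  by (rule matrix_inv_unique(1)[OF col_scale_inverse])

lemma col_shear_inverse: "col_shear k w ** col_shear k (- w) = mat 1"
  by (simp add: vec_eq_iff col_shear_mult) (simp add: col_shear_def mat_def)

lemma invertible_col_shear: "invertible (col_shear k w)"
  by (rule matrix_inv_unique(1)[OF col_shear_inverse])

lemma col_shear_conj:
  "col_scale k (1/2) ** col_shear k w ** col_scale k 2 = col_shear k w ** col_shear k w"
  unfolding matrix_mul_assoc[symmetric]
  by (auto simp: vec_eq_iff col_scale_mult col_shear_mult) (auto simp: col_scale_def col_shear_def)

text \<open>The products of elementary matrices that occur in the elimination of a positive definite matrix. They are a class on which a
  multiplicative function is known from its values on positive diagonal matrices, which makes Jacobians computable.\<close>

inductive_set pivot_matrices :: "(complex^'n^'n) set" where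
  one: "mat 1 \<in> pivot_matrices"
| scale: "A \<in> pivot_matrices \<Longrightarrow> 0 < r \<Longrightarrow> col_scale k r ** A \<in> pivot_matrices"
| shear: "A \<in> pivot_matrices \<Longrightarrow> col_shear k w ** A \<in> pivot_matrices"

lemma pivot_matrices_invertible: "A \<in> pivot_matrices \<Longrightarrow> invertible A"
  by (induction rule: pivot_matrices.induct)
     (simp_all add: invertible_mat_1 invertible_mult invertible_col_scale invertible_col_shear)

text \<open>A multiplicative function is trivial on shears, because a shear is conjugate to its own
  square; so it is determined by its values on the diagonal matrices.\<close>

lemma character_col_shear:
  fixes \<phi> :: "complex^'n^'n \<Rightarrow> 'a::field"
  assumes mult: "\<And>A B. invertible A \<Longrightarrow> invertible B \<Longrightarrow> \<phi> (A ** B) = \<phi> A * \<phi> B"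
    and nz: "\<And>A. invertible A \<Longrightarrow> \<phi> A \<noteq> 0"
  shows "\<phi> (col_shear k w) = 1"
proof -
  note inv = invertible_col_scale[of _ k] invertible_col_shear[of k w]
  have one: "\<phi> (mat 1) = 1"
    using mult[OF invertible_mat_1 invertible_mat_1] nz[OF invertible_mat_1] by simp
  have "\<phi> (col_scale k (1/2)) * \<phi> (col_scale k 2) = \<phi> (mat 1)"
    using mult[OF inv(1)[of "1/2"] inv(1)[of 2]] col_scale_inverse[of "1/2" k] by simp
  moreover have "\<phi> (col_scale k (1/2)) * \<phi> (col_shear k w) * \<phi> (col_scale k 2) = \<phi> (col_shear k w) * \<phi> (col_shear k w)"
    using arg_cong[OF col_shear_conj[of k w], of \<phi>] by (simp add: mult inv invertible_mult)
  ultimately have "\<phi> (col_shear k w) * \<phi> (col_shear k w) = \<phi> (col_shear k w)"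
    using one by (simp add: mult_ac)
  then show ?thesis using nz[OF inv(2)] by simp
qed

lemma det_col_shear: "det (col_shear k w) = 1"
  by (rule character_col_shear[where \<phi>=det]) (simp_all add: det_mul invertible_det_nz)

lemma det_col_scale: "det (col_scale k r) = of_real r"
proof -
  have "det (col_scale k r) = (\<Prod>i\<in>UNIV. col_scale k r $ i $ i)"
    by (rule det_diagonal) (simp add: col_scale_def)
  also have "\<dots> = (\<Prod>i\<in>UNIV. if i = k then of_real r else 1)"
    by (simp add: col_scale_def)
  finally show ?thesis by simp
qed

text \<open>Applied to the Jacobians of the actions \<open>Z \<mapsto> Z ** ctranspose A\<close> and \<open>S \<mapsto> A ** S ** ctranspose A\<close>.\<close>

lemma character_pivot_matrices:
  fixes \<phi> :: "complex^'n^'n \<Rightarrow> real"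
  assumes mult: "\<And>A B. invertible A \<Longrightarrow> invertible B \<Longrightarrow> \<phi> (A ** B) = \<phi> A * \<phi> B"
    and nz: "\<And>A. invertible A \<Longrightarrow> \<phi> A \<noteq> 0"
    and scale: "\<And>k r. 0 < r \<Longrightarrow> \<phi> (col_scale k r) = 1 / r ^ q"
    and A: "A \<in> pivot_matrices"
  shows "\<phi> A = 1 / cmod (det A) ^ q"
  using A
proof (induction rule: pivot_matrices.induct)
  case one
  show ?case using mult[OF invertible_mat_1 invertible_mat_1] nz[OF invertible_mat_1] by simp
next
  case (scale A r k)
  then show ?case
    by (simp add: mult invertible_col_scale pivot_matrices_invertible assms(3) det_mul det_col_scale
        norm_mult power_mult_distrib)
next
  case (shear A k w)
  then show ?case
    by (simp add: mult invertible_col_shear pivot_matrices_invertible character_col_shear[OF mult nz]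
        det_mul det_col_shear)
qed

text \<open>Gaussian elimination, one pivot \<open>k\<close> at a time: rows and columns in \<open>J\<close> are already reduced.\<close>

lemma pos_def_reduce:
  assumes "pos_def \<Theta>"
  obtains A where "A \<in> pivot_matrices" "A ** \<Theta> ** ctranspose A = mat 1"
proof -
  have "\<exists>A\<in>pivot_matrices. \<forall>i\<in>J. \<forall>j. (A ** \<Theta> ** ctranspose A) $ i $ j = mat 1 $ i $ j"
    if "finite J" for J
    using that
  proof (induction J)
    case empty
    then show ?case using pivot_matrices.one by auto
  next
    case (insert k J)
    then obtain A where A: "A \<in> pivot_matrices"
      and J: "\<And>i j. i \<in> J \<Longrightarrow> (A ** \<Theta> ** ctranspose A) $ i $ j = mat 1 $ i $ j" by blast
    define M where "M = A ** \<Theta> ** ctranspose A"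
    have M: "pos_def M"
      unfolding M_def using assms pos_def_congruence_iff pivot_matrices_invertible[OF A] by blast
    have sym: "M $ i $ j = cnj (M $ j $ i)" for i j
      using pos_def_hermitian[OF M] by (metis ctranspose_nth)
    define a where "a = Re (M $ k $ k)"
    have Mkk: "M $ k $ k = of_real a"
      using sym[of k k] by (simp add: a_def complex_eq_iff)
    have a: "a > 0" unfolding a_def by (rule pos_def_diag[OF M])
    \<comment> \<open>The shear clears row and column \<open>k\<close> off the diagonal. It leaves the rows in \<open>J\<close> alone, because
      they have a zero in column \<open>k\<close>.\<close>
    define w where "w = (\<chi> i. - M $ i $ k / of_real a)"
    define A' where "A' = col_scale k (1 / sqrt a) ** (col_shear k w ** A)"
    have "A' ** \<Theta> ** ctranspose A' = col_scale k (1 / sqrt a) ** (col_shear k w ** (M ** ctranspose (col_shear k w)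
        ** ctranspose (col_scale k (1 / sqrt a))))"
      by (simp add: A'_def M_def ctranspose_mult matrix_mul_assoc)
    then have N: "(A' ** \<Theta> ** ctranspose A') $ i $ j = (if i = k then of_real (1 / sqrt a) else 1) *
        ((if j = k then of_real (1 / sqrt a) else 1) * (M $ i $ j + (if j = k then 0 else cnj (w $ j) * M $ i $ k))
         + (if i = k then 0 else w $ i * ((if j = k then of_real (1 / sqrt a) else 1) *
           (M $ k $ j + (if j = k then 0 else cnj (w $ j) * M $ k $ k)))))" for i j
      by (simp only: col_scale_mult col_shear_mult mult_ctranspose_col_scale mult_ctranspose_col_shear)
    have z: "M $ k $ j + cnj (w $ j) * M $ k $ k = 0" for j
      using a sym[of j k] by (simp add: w_def Mkk)
    have ss: "of_real (1 / sqrt a) * (of_real (1 / sqrt a) * complex_of_real a) = 1"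
      using a by (simp flip: of_real_mult)
    have "(A' ** \<Theta> ** ctranspose A') $ i $ j = mat 1 $ i $ j" if "i \<in> insert k J" for i j
    proof (cases "i = k")
      case True
      then show ?thesis
        by (cases "j = k") (simp_all only: N z Mkk ss if_True if_False refl add_0_right mult_zero_right, simp_all add: mat_def ss z[unfolded Mkk])
    next
      case False
      with that have i: "i \<in> J" by simp
      have Mi: "M $ i $ j = mat 1 $ i $ j" for j using J[OF i] by (simp add: M_def)
      have "M $ i $ k = 0" using Mi[of k] False by (simp add: mat_def)
      moreover from this have "w $ i = 0" by (simp add: w_def)
      ultimately show ?thesis using False by (auto simp: N Mi mat_def)
    qed
    moreover have "A' \<in> pivot_matrices"
      unfolding A'_def using A a by (intro pivot_matrices.intros) auto
    ultimately show ?case by blast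
  qed
  from this[of UNIV] show thesis by (auto simp: vec_eq_iff intro: that)
qed

lemma pos_def_factor:
  fixes P :: "complex^'n^'n"
  assumes "pos_def P"
  obtains B :: "complex^'n^'n" where "invertible B" "P = B ** ctranspose B"
proof -
  obtain A where A: "A \<in> pivot_matrices" "A ** P ** ctranspose A = mat 1"
    using pos_def_reduce[OF assms] .
  note i = pivot_matrices_invertible[OF A(1)]
  have "P = (matrix_inv A ** A) ** P ** (ctranspose A ** ctranspose (matrix_inv A))"
    by (simp add: matrix_inv[OF i] flip: ctranspose_mult)
  also have "\<dots> = matrix_inv A ** (A ** P ** ctranspose A) ** ctranspose (matrix_inv A)"
    by (simp add: matrix_mul_assoc)
  finally have "P = matrix_inv A ** ctranspose (matrix_inv A)" by (simp add: A)
  with invertible_matrix_inv[OF i] show thesis by (rule that)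
qed

section \<open>Coordinates of matrices\<close>

lemma
  fixes G :: "'a::euclidean_space^'n \<Rightarrow> 'b::comm_monoid_mult" and H :: "'a^'n \<Rightarrow> 'c::comm_monoid_add"
  shows prod_Basis_vec: "(\<Prod>b\<in>Basis. G b) = (\<Prod>i\<in>UNIV. \<Prod>u\<in>Basis. G (axis i u))"
    and sum_Basis_vec: "(\<Sum>b\<in>Basis. H b) = (\<Sum>i\<in>UNIV. \<Sum>u\<in>Basis. H (axis i u))"
proof -
  have inj: "inj_on (\<lambda>(i, u). axis i u) (UNIV \<times> (Basis :: 'a set))"
    by (auto simp: inj_on_def axis_eq_axis)
  have B: "Basis = (\<lambda>(i, u). axis i u) ` (UNIV \<times> (Basis :: 'a set))"
    by (auto simp: Basis_vec_def)
  show "(\<Prod>b\<in>Basis. G b) = (\<Prod>i\<in>UNIV. \<Prod>u\<in>Basis. G (axis i u))"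
    unfolding B prod.reindex[OF inj] by (simp add: prod.cartesian_product case_prod_unfold)
  show "(\<Sum>b\<in>Basis. H b) = (\<Sum>i\<in>UNIV. \<Sum>u\<in>Basis. H (axis i u))"
    unfolding B sum.reindex[OF inj] by (simp add: sum.cartesian_product case_prod_unfold)
qed

lemma borel_measurable_vec_iff:
  fixes f :: "'b \<Rightarrow> 'a::euclidean_space^'n"
  shows "f \<in> borel_measurable M \<longleftrightarrow> (\<forall>i. (\<lambda>x. f x $ i) \<in> borel_measurable M)"
proof
  assume f: "f \<in> borel_measurable M"
  have "(\<lambda>x. x $ i) \<in> borel_measurable (borel :: ('a^'n) measure)" for i
    by (intro borel_measurable_continuous_onI continuous_intros)
  from measurable_compose[OF f this] show "\<forall>i. (\<lambda>x. f x $ i) \<in> borel_measurable M" ..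
next
  assume [rule_format, measurable]: "\<forall>i. (\<lambda>x. f x $ i) \<in> borel_measurable M"
  have "(\<lambda>x. f x \<bullet> b) \<in> borel_measurable M" if b: "b \<in> Basis" for b
  proof -
    obtain i u where "b = axis i u" using b by (auto simp: Basis_vec_def)
    then show ?thesis by (simp add: inner_axis)
  qed
  then show "f \<in> borel_measurable M" using borel_measurable_euclidean_space by blast
qed

lemma measurable_vec_nth [measurable (raw)]:
  fixes f :: "'b \<Rightarrow> 'a::euclidean_space^'n"
  shows "f \<in> borel_measurable M \<Longrightarrow> (\<lambda>x. f x $ i) \<in> borel_measurable M"
  by (simp add: borel_measurable_vec_iff)

lemma measurable_vec_lambda [measurable (raw)]:
  fixes f :: "'b \<Rightarrow> 'n::finite \<Rightarrow> 'a::euclidean_space"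
  shows "(\<And>i. (\<lambda>x. f x i) \<in> borel_measurable M) \<Longrightarrow> (\<lambda>x. \<chi> i. f x i) \<in> borel_measurable M"
  by (simp add: borel_measurable_vec_iff)

section \<open>Gaussian integrals\<close>

lemma normal_density_scaled:
  "0 < a \<Longrightarrow> exp (- a * x\<^sup>2) = sqrt (pi / a) * normal_density 0 (1 / sqrt (2 * a)) x"
  by (simp add: normal_density_def power_divide real_sqrt_divide field_simps)

lemma nn_integral_gauss_1:
  assumes a: "0 < a"
  shows "(\<integral>\<^sup>+x. ennreal (exp (- a * x\<^sup>2)) \<partial>lborel) = ennreal (sqrt (pi / a))"
proof -
  have "(\<integral>\<^sup>+x. ennreal (exp (- a * x\<^sup>2)) \<partial>lborel)
      = (\<integral>\<^sup>+x. ennreal (sqrt (pi / a)) * ennreal (normal_density 0 (1 / sqrt (2 * a)) x) \<partial>lborel)"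
    unfolding normal_density_scaled[OF a] using a by (simp add: ennreal_mult)
  also have "\<dots> = ennreal (sqrt (pi / a)) * 1"
    using a by (subst nn_integral_cmult) (simp_all add: nn_integral_eq_integral integrable_normal_density integral_normal_density)
  finally show ?thesis by simp
qed

lemma nn_integral_gauss_2:
  assumes a: "0 < a"
  shows "(\<integral>\<^sup>+x. ennreal (x\<^sup>2 * exp (- a * x\<^sup>2)) \<partial>lborel) = ennreal (sqrt (pi / a) / (2 * a))"
proof -
  let ?s = "1 / sqrt (2 * a)"
  have s: "0 < ?s" using a by simp
  have "has_bochner_integral lborel (\<lambda>x. normal_density 0 ?s x * (x - 0) ^ (2 * 1)) (fact (2 * 1) / ((2 / ?s\<^sup>2) ^ 1 * fact 1))"
    by (rule normal_moment_even[OF s])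
  then have "has_bochner_integral lborel (\<lambda>x. normal_density 0 ?s x * x\<^sup>2) (1 / (2 * a))"
    using a by (simp add: power_divide fact_numeral)
  then have *: "(\<integral>\<^sup>+x. ennreal (normal_density 0 ?s x * x\<^sup>2) \<partial>lborel) = ennreal (1 / (2 * a))"
    by (subst nn_integral_eq_integral) (auto simp: has_bochner_integral_iff)
  have "(\<integral>\<^sup>+x. ennreal (x\<^sup>2 * exp (- a * x\<^sup>2)) \<partial>lborel)
      = (\<integral>\<^sup>+x. ennreal (sqrt (pi / a)) * ennreal (normal_density 0 ?s x * x\<^sup>2) \<partial>lborel)"
    unfolding normal_density_scaled[OF a] using a by (simp add: ennreal_mult[symmetric] mult_ac)
  also have "\<dots> = ennreal (sqrt (pi / a)) * ennreal (1 / (2 * a))"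
    by (subst nn_integral_cmult) (simp_all add: *)
  finally show ?thesis using a by (simp add: ennreal_mult[symmetric])
qed

lemma norm_sq_Basis: "(norm x)\<^sup>2 = (\<Sum>b\<in>Basis. (x \<bullet> b)\<^sup>2)" for x :: "'a::euclidean_space"
  unfolding power2_norm_eq_inner by (subst euclidean_inner) (simp add: power2_eq_square)

lemma nn_integral_gauss:
  assumes a: "0 < a"
  shows "(\<integral>\<^sup>+x. ennreal (exp (- a * (norm x)\<^sup>2)) \<partial>(lborel :: 'a::euclidean_space measure))
    = ennreal (sqrt (pi / a) ^ DIM('a))"
proof -
  have "(\<integral>\<^sup>+x. ennreal (exp (- a * (norm x)\<^sup>2)) \<partial>(lborel :: 'a measure))
      = (\<integral>\<^sup>+x. (\<Prod>b\<in>Basis. ennreal (exp (- a * (x \<bullet> b)\<^sup>2))) \<partial>(lborel :: 'a measure))"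
    by (simp add: norm_sq_Basis sum_distrib_left exp_sum prod_ennreal flip: sum_negf)
  also have "\<dots> = (\<Prod>b\<in>(Basis::'a set). ennreal (sqrt (pi / a)))"
    by (subst nn_integral_lborel_prod) (simp_all add: nn_integral_gauss_1[OF a, simplified])
  finally show ?thesis using a by (simp add: ennreal_power)
qed

lemma nn_integral_gauss_norm_sq:
  assumes a: "0 < a"
  shows "(\<integral>\<^sup>+x. ennreal ((norm x)\<^sup>2 * exp (- a * (norm x)\<^sup>2)) \<partial>(lborel :: 'a::euclidean_space measure))
    = ennreal (real DIM('a) / (2 * a) * sqrt (pi / a) ^ DIM('a))"
proof -
  have one: "(\<integral>\<^sup>+x. ennreal ((x \<bullet> c)\<^sup>2 * exp (- a * (norm x)\<^sup>2)) \<partial>lborel)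
      = ennreal (1 / (2 * a) * sqrt (pi / a) ^ DIM('a))" if c: "c \<in> Basis" for c :: 'a
  proof -
    let ?f = "\<lambda>b t. ennreal ((if b = c then t\<^sup>2 else 1) * exp (- a * t\<^sup>2))"
    have "(\<Prod>b\<in>Basis. (if b = c then (x \<bullet> b)\<^sup>2 else 1)) = (x \<bullet> c)\<^sup>2" for x :: 'a
      using prod.delta[of Basis c "\<lambda>b. (x \<bullet> b)\<^sup>2"] c by simp
    then have "(\<integral>\<^sup>+x. ennreal ((x \<bullet> c)\<^sup>2 * exp (- a * (norm x)\<^sup>2)) \<partial>lborel)
        = (\<integral>\<^sup>+x. (\<Prod>b\<in>Basis. ?f b (x \<bullet> b)) \<partial>(lborel :: 'a measure))"
      by (simp add: norm_sq_Basis sum_distrib_left exp_sum prod_ennreal prod.distrib flip: sum_negf)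
    also have "\<dots> = (\<Prod>b\<in>(Basis::'a set). (if b = c then ennreal (1 / (2 * a)) else 1) * ennreal (sqrt (pi / a)))"
      using a by (subst nn_integral_lborel_prod)
         (auto intro!: prod.cong simp: nn_integral_gauss_1[OF a, simplified] nn_integral_gauss_2[OF a, simplified] ennreal_mult[symmetric])
    also have "\<dots> = ennreal (1 / (2 * a)) * ennreal (sqrt (pi / a)) ^ DIM('a)"
      using c by (simp add: prod.distrib)
    finally show ?thesis using a by (simp add: ennreal_power ennreal_mult[symmetric])
  qed
  have "(\<integral>\<^sup>+x. ennreal ((norm x)\<^sup>2 * exp (- a * (norm x)\<^sup>2)) \<partial>(lborel :: 'a measure))
      = (\<integral>\<^sup>+x. (\<Sum>c\<in>Basis. ennreal ((x \<bullet> c)\<^sup>2 * exp (- a * (norm x)\<^sup>2))) \<partial>(lborel :: 'a measure))"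
    unfolding norm_sq_Basis sum_distrib_right by (subst sum_ennreal) auto
  also have "\<dots> = (\<Sum>c\<in>(Basis::'a set). ennreal (1 / (2 * a) * sqrt (pi / a) ^ DIM('a)))"
    by (subst nn_integral_sum) (simp, intro sum.cong refl one)
  also have "\<dots> = ennreal (real DIM('a) / (2 * a) * sqrt (pi / a) ^ DIM('a))"
    using a by (simp add: ennreal_of_nat_eq_real_of_nat ennreal_mult[symmetric])
  finally show ?thesis .
qed

section \<open>Integration in real matrix coordinates\<close>

lemma nn_integral_matrix_prod:
  fixes f :: "'m::finite \<Rightarrow> 'n::finite \<Rightarrow> real \<Rightarrow> ennreal"
  assumes [measurable]: "\<And>i j. f i j \<in> borel_measurable borel"
  shows "(\<integral>\<^sup>+x. (\<Prod>i\<in>UNIV. \<Prod>j\<in>UNIV. f i j (x $ i $ j)) \<partial>(lborel :: (real^'n^'m) measure))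
    = (\<Prod>i\<in>UNIV. \<Prod>j\<in>UNIV. (\<integral>\<^sup>+t. f i j t \<partial>lborel))"
proof -
  define h where "h b = (SOME ij. b = axis (fst ij) (axis (snd ij) (1::real)))" for b :: "real^'n^'m"
  have h: "h (axis i (axis j 1)) = (i, j)" for i j
    unfolding h_def by (rule some_equality) (auto simp: axis_eq_axis)
  let ?F = "\<lambda>b. f (fst (h b)) (snd (h b))"
  have "(\<integral>\<^sup>+x. (\<Prod>i\<in>UNIV. \<Prod>j\<in>UNIV. f i j (x $ i $ j)) \<partial>(lborel :: (real^'n^'m) measure))
      = (\<integral>\<^sup>+x. (\<Prod>b\<in>Basis. ?F b (x \<bullet> b)) \<partial>lborel)"
    by (simp add: prod_Basis_vec h inner_axis)
  also have "\<dots> = (\<Prod>b\<in>Basis. (\<integral>\<^sup>+t. ?F b t \<partial>lborel))"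
    by (rule nn_integral_lborel_prod) simp_all
  finally show ?thesis by (simp add: prod_Basis_vec h)
qed

lemma diagonal_matrix_nth:
  fixes x :: "real^'n^'m"
  shows "(\<Sum>b\<in>Basis. (c b * (x \<bullet> b)) *\<^sub>R b) $ i $ j = c (axis i (axis j 1)) * x $ i $ j"
proof -
  let ?b = "axis i (axis j 1) :: real^'n^'m"
  have "?b \<in> Basis" by (auto simp: Basis_vec_def)
  then have "(\<Sum>b\<in>Basis. (c b * (x \<bullet> b)) *\<^sub>R b) \<bullet> ?b = c ?b * (x \<bullet> ?b)"
    by (simp add: inner_sum_left inner_Basis if_distrib cong: if_cong)
  then show ?thesis by (simp add: inner_axis)
qed

lemma nn_integral_matrix_affine:
  fixes f :: "real^'n^'m \<Rightarrow> ennreal"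
  assumes c: "\<And>i j. c i j \<noteq> 0" and [measurable]: "f \<in> borel_measurable borel"
  shows "(\<integral>\<^sup>+x. f x \<partial>lborel)
    = ennreal (\<Prod>i\<in>UNIV. \<Prod>j\<in>UNIV. \<bar>c i j\<bar>) * (\<integral>\<^sup>+x. f (\<chi> i j. t $ i $ j + c i j * x $ i $ j) \<partial>lborel)"
proof -
  define h where "h b = (SOME ij. b = axis (fst ij) (axis (snd ij) (1::real)))" for b :: "real^'n^'m"
  have h: "h (axis i (axis j 1)) = (i, j)" for i j
    unfolding h_def by (rule some_equality) (auto simp: axis_eq_axis)
  let ?C = "\<lambda>b. c (fst (h b)) (snd (h b))"
  have eq: "t + (\<Sum>b\<in>Basis. (?C b * (x \<bullet> b)) *\<^sub>R b) = (\<chi> i j. t $ i $ j + c i j * x $ i $ j)" for x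
    by (simp only: vec_eq_iff vector_add_component diagonal_matrix_nth h vec_lambda_beta fst_conv snd_conv) simp
  have "(\<integral>\<^sup>+x. f x \<partial>lborel) = (\<Prod>b\<in>Basis. \<bar>?C b\<bar>) * (\<integral>\<^sup>+x. f (t + (\<Sum>b\<in>Basis. (?C b * (x \<bullet> b)) *\<^sub>R b)) \<partial>lborel)"
    by (rule nn_integral_diagonal) (simp_all add: c)
  then show ?thesis unfolding eq by (simp add: prod_Basis_vec h)
qed

text \<open>Coordinates in \<open>R\<close> are taken from \<open>w\<close>, the others from \<open>x\<close>. A function that satisfies \<open>f (mix R x w) = f x\<close>
  is one that does not depend on the coordinates in \<open>R\<close>.\<close>

definition mix :: "('m \<times> 'n) set \<Rightarrow> real^'n^'m \<Rightarrow> real^'n^'m \<Rightarrow> real^'n^'m" where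
  "mix R x w = (\<chi> i j. if (i, j) \<in> R then w $ i $ j else x $ i $ j)"

lemma mix_nth: "mix R x w $ i $ j = (if (i, j) \<in> R then w $ i $ j else x $ i $ j)"
  by (simp add: mix_def)

lemma measurable_mix [measurable]:
  "(\<lambda>(x, w). mix R x w) \<in> borel_measurable (borel \<Otimes>\<^sub>M borel)"
  unfolding mix_def split_beta' by measurable

text \<open>Exchanging the coordinates in \<open>R\<close> between two points is a linear involution, hence preserves Lebesgue measure.\<close>

lemma nn_integral_swap_coords:
  fixes f :: "(real^'n^'m) \<times> (real^'n^'m) \<Rightarrow> ennreal"
  assumes [measurable]: "f \<in> borel_measurable borel"
  shows "(\<integral>\<^sup>+x. \<integral>\<^sup>+w. f (mix R x w, mix R w x) \<partial>lborel \<partial>lborel) = (\<integral>\<^sup>+x. \<integral>\<^sup>+w. f (x, w) \<partial>lborel \<partial>lborel)"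
proof -
  let ?L = "\<lambda>(x, w). (mix R x w, mix R w x)"
  have lin: "linear ?L"
    by (rule linearI) (auto simp: vec_eq_iff mix_nth)
  have inv: "?L (?L x) = x" for x
    by (auto simp: vec_eq_iff mix_nth split: prod.split)
  have [measurable]: "f \<in> borel_measurable (lborel \<Otimes>\<^sub>M lborel)"
    by (simp add: lborel_prod)
  have [measurable]: "?L \<in> borel_measurable borel"
    by (intro borel_measurable_continuous_onI linear_continuous_on linear_conv_bounded_linear[THEN iffD1] lin)
  have "(\<lambda>z. f (?L z)) \<in> borel_measurable borel" by measurable
  then have m: "(\<lambda>z. f (?L z)) \<in> borel_measurable (lborel \<Otimes>\<^sub>M lborel)" by (simp add: lborel_prod)
  have "(\<integral>\<^sup>+x. \<integral>\<^sup>+w. f (?L (x, w)) \<partial>lborel \<partial>lborel) = (\<integral>\<^sup>+z. f (?L z) \<partial>lborel)"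
    unfolding lborel.nn_integral_fst[OF m] by (simp add: lborel_prod)
  also have "\<dots> = (\<integral>\<^sup>+z. f z \<partial>lborel)"
    using nn_integral_linear[OF lin bij_involution[of ?L, OF inv], of f] by (simp add: jac_involution[of ?L, OF lin inv])
  also have "\<dots> = (\<integral>\<^sup>+x. \<integral>\<^sup>+w. f (x, w) \<partial>lborel \<partial>lborel)"
    by (subst lborel.nn_integral_fst) (simp_all add: lborel_prod)
  finally show ?thesis by simp
qed

text \<open>Substitution in some of the coordinates only, affine with coefficients that depend on the others.
  A product density \<open>\<rho>\<close> on a second copy of the space decouples the two groups of coordinates.\<close>

lemma nn_integral_fibre_affine:
  fixes f :: "real^'n^'m \<Rightarrow> ennreal" and c :: "real^'n^'m \<Rightarrow> real" and g :: "real^'n^'m \<Rightarrow> real^'n^'m"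
  assumes [measurable]: "f \<in> borel_measurable borel" "c \<in> borel_measurable borel" "g \<in> borel_measurable borel"
    and c: "\<And>x. c x > 0" "\<And>x w. c (mix R x w) = c x" and g: "\<And>x w. g (mix R x w) = g x"
  defines "T \<equiv> \<lambda>x. \<chi> i j. if (i, j) \<in> R then g x $ i $ j + c x * x $ i $ j else x $ i $ j"
  shows "(\<integral>\<^sup>+x. f x \<partial>lborel) = (\<integral>\<^sup>+x. ennreal (c x ^ card R) * f (T x) \<partial>lborel)"
proof -
  define \<rho> :: "real^'n^'m \<Rightarrow> ennreal" where "\<rho> = indicator (box 0 One)"
  have [measurable]: "\<rho> \<in> borel_measurable borel" by (simp add: \<rho>_def)
  have [measurable]: "T \<in> borel_measurable borel" unfolding T_def by measurable
  have \<rho>1: "(\<integral>\<^sup>+x. \<rho> x \<partial>lborel) = 1" by (simp add: \<rho>_def nn_integral_unit_box del: nn_integral_indicator)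
  have swap: "(\<integral>\<^sup>+x. \<integral>\<^sup>+w. \<rho> (mix R w x) * h (mix R x w) \<partial>lborel \<partial>lborel) = (\<integral>\<^sup>+x. h x \<partial>lborel)"
    if [measurable]: "h \<in> borel_measurable borel" for h
  proof -
    have "(\<integral>\<^sup>+x. \<integral>\<^sup>+w. \<rho> (mix R w x) * h (mix R x w) \<partial>lborel \<partial>lborel) = (\<integral>\<^sup>+x. \<integral>\<^sup>+w. \<rho> w * h x \<partial>lborel \<partial>lborel)"
      using nn_integral_swap_coords[of "\<lambda>(x, w). \<rho> w * h x" R] by (simp add: borel_prod[symmetric])
    then show ?thesis by (simp add: nn_integral_multc \<rho>1)
  qed
  have "(\<integral>\<^sup>+w. \<rho> (mix R w x) * f (mix R x w) \<partial>lborel)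
      = (\<integral>\<^sup>+w. \<rho> (mix R w x) * (ennreal (c (mix R x w) ^ card R) * f (T (mix R x w))) \<partial>lborel)" for x
  proof -
    define C where "C i j = (if (i, j) \<in> R then c x else 1)" for i j
    define t where "t = (\<chi> i j. if (i, j) \<in> R then g x $ i $ j else 0)"
    have "(\<Prod>i\<in>UNIV. \<Prod>j\<in>UNIV. \<bar>C i j\<bar>) = (\<Prod>ij\<in>UNIV. if ij \<in> R then c x else 1)"
      using c(1)[of x] by (simp add: prod.cartesian_product C_def case_prod_unfold if_distrib cong: if_cong)
    also have "\<dots> = c x ^ card R" by (simp add: prod.If_cases)
    finally have P: "(\<Prod>i\<in>UNIV. \<Prod>j\<in>UNIV. \<bar>C i j\<bar>) = c x ^ card R" .
    have Cnz: "C i j \<noteq> 0" for i j using c(1)[of x] by (simp add: C_def)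
    have e: "mix R (\<chi> i j. t $ i $ j + C i j * w $ i $ j) x = mix R w x"
      "mix R x (\<chi> i j. t $ i $ j + C i j * w $ i $ j) = T (mix R x w)" for w
      by (simp_all add: vec_eq_iff mix_nth T_def t_def C_def c g)
    have "(\<integral>\<^sup>+w. \<rho> (mix R w x) * f (mix R x w) \<partial>lborel) = ennreal (c x ^ card R) *
       (\<integral>\<^sup>+w. \<rho> (mix R (\<chi> i j. t $ i $ j + C i j * w $ i $ j) x)
          * f (mix R x (\<chi> i j. t $ i $ j + C i j * w $ i $ j)) \<partial>lborel)"
      by (subst nn_integral_matrix_affine[where c=C and t=t, OF Cnz]) (simp_all add: P)
    then show ?thesis
      unfolding e c by (subst (asm) nn_integral_cmult[symmetric]) (simp_all add: mult_ac)
  qed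
  then have "(\<integral>\<^sup>+x. \<integral>\<^sup>+w. \<rho> (mix R w x) * f (mix R x w) \<partial>lborel \<partial>lborel)
      = (\<integral>\<^sup>+x. \<integral>\<^sup>+w. \<rho> (mix R w x) * (ennreal (c (mix R x w) ^ card R) * f (T (mix R x w))) \<partial>lborel \<partial>lborel)"
    by simp
  then show ?thesis by (subst (asm) (1 2) swap) simp_all
qed

section \<open>Measurability of determinants and inverses\<close>

lemma measurable_det [measurable (raw)]:
  fixes f :: "'b \<Rightarrow> complex^'n^'n"
  assumes [measurable]: "f \<in> borel_measurable M"
  shows "(\<lambda>x. det (f x)) \<in> borel_measurable M"
  unfolding det_def by measurable

lemma measurable_matrix_mult [measurable (raw)]:
  fixes f :: "'b \<Rightarrow> complex^'n^'m" and g :: "'b \<Rightarrow> complex^'l^'n"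
  assumes [measurable]: "f \<in> borel_measurable M" "g \<in> borel_measurable M"
  shows "(\<lambda>x. f x ** g x) \<in> borel_measurable M"
  unfolding matrix_matrix_mult_def by measurable

lemma measurable_ctranspose [measurable (raw)]:
  fixes f :: "'b \<Rightarrow> complex^'n^'m"
  assumes [measurable]: "f \<in> borel_measurable M"
  shows "(\<lambda>x. ctranspose (f x)) \<in> borel_measurable M"
proof -
  have [measurable]: "cnj \<in> borel_measurable borel"
    by (intro borel_measurable_continuous_onI continuous_intros)
  show ?thesis unfolding ctranspose_def by measurable
qed

lemma measurable_trace [measurable (raw)]:
  fixes f :: "'b \<Rightarrow> complex^'n^'n"
  assumes [measurable]: "f \<in> borel_measurable M"
  shows "(\<lambda>x. trace (f x)) \<in> borel_measurable M"
  unfolding trace_def by measurable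

text \<open>Cramer's rule; all singular matrices share the default value of \<open>matrix_inv\<close>.\<close>

lemma matrix_inv_cramer:
  fixes A :: "complex^'n^'n"
  shows "matrix_inv A = (if det A = 0 then matrix_inv 0
    else (\<chi> i j. det (\<chi> a b. if b = i then mat 1 $ a $ j else A $ a $ b) / det A))"
proof (cases "det A = 0")
  case True
  have "\<not> invertible A" using True invertible_det_nz by blast
  moreover have "\<not> invertible (0::complex^'n^'n)" by (auto simp: invertible_iff_ker axis_eq_0_iff intro!: exI[of _ "axis undefined 1"])
  ultimately have "(\<lambda>B. A ** B = mat 1 \<and> B ** A = mat 1) = (\<lambda>B. 0 ** B = mat 1 \<and> B ** 0 = mat 1)"
    unfolding invertible_def by blast
  then show ?thesis using True unfolding matrix_inv_def by simp
next
  case False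
  have i: "invertible A" using False invertible_det_nz by blast
  have "matrix_inv A $ i $ j = det (\<chi> a b. if b = i then mat 1 $ a $ j else A $ a $ b) / det A" for i j
  proof -
    have "A *v column j (matrix_inv A) = column j (mat 1)"
      using matrix_inv(1)[OF i] by (simp add: vec_eq_iff column_def matrix_vector_mult_def matrix_matrix_mult_def)
    then have "column j (matrix_inv A) = (\<chi> k. det (\<chi> a b. if b = k then column j (mat 1) $ a else A $ a $ b) / det A)"
      using cramer[OF False] by blast
    then have "column j (matrix_inv A) $ i = det (\<chi> a b. if b = i then column j (mat 1) $ a else A $ a $ b) / det A"
      by simp
    then show ?thesis unfolding column_def vec_lambda_beta .
  qed
  then show ?thesis using False by (simp add: vec_eq_iff)
qed

lemma measurable_matrix_inv [measurable (raw)]: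
  fixes f :: "'b \<Rightarrow> complex^'n^'n"
  assumes [measurable]: "f \<in> borel_measurable M"
  shows "(\<lambda>x. matrix_inv (f x)) \<in> borel_measurable M"
  unfolding matrix_inv_cramer[of "f _"] by measurable

text \<open>The quadratic form attains a positive minimum on the unit sphere.\<close>

lemma pos_def_lower_bound:
  fixes A :: "complex^'n^'n"
  assumes "pos_def A"
  obtains e where "e > 0" "\<And>x. e * (norm x)\<^sup>2 \<le> x \<bullet> (A *v x)"
proof -
  have cont: "continuous_on (sphere 0 1) (\<lambda>x. x \<bullet> (A *v x))"
    by (intro continuous_intros linear_continuous_on linear_conv_bounded_linear[THEN iffD1] linearI)
       (simp_all add: matrix_vector_right_distrib vec_eq_iff matrix_vector_mult_def scaleR_right.sum)
  have "axis (undefined::'n) (1::complex) \<in> sphere 0 1" by simp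
  then obtain u where u: "u \<in> sphere 0 1" and min: "\<And>x. x \<in> sphere 0 1 \<Longrightarrow> u \<bullet> (A *v u) \<le> x \<bullet> (A *v x)"
    using continuous_attains_inf[OF compact_sphere _ cont] by blast
  have scaleR_mv: "A *v (c *\<^sub>R x) = c *\<^sub>R (A *v x)" for c x
    by (simp add: vec_eq_iff matrix_vector_mult_def scaleR_right.sum)
  have "u \<noteq> 0" using u by auto
  then have pos: "0 < u \<bullet> (A *v u)" using assms by (simp add: pos_def_iff)
  moreover have "(u \<bullet> (A *v u)) * (norm x)\<^sup>2 \<le> x \<bullet> (A *v x)" for x
  proof (cases "x = 0")
    case False
    then have "u \<bullet> (A *v u) \<le> ((1 / norm x) *\<^sub>R x) \<bullet> (A *v ((1 / norm x) *\<^sub>R x))"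
      by (intro min) simp
    also have "\<dots> = (x \<bullet> (A *v x)) / (norm x)\<^sup>2"
      by (simp add: scaleR_mv power2_eq_square)
    finally show ?thesis using False by (simp add: field_simps)
  qed simp
  ultimately show thesis by (rule that)
qed

text \<open>By the uniform lower bound, the positive definite matrices are a countable union of closed sets.\<close>

lemma sets_pos_def [measurable]: "{A. pos_def A} \<in> sets (borel :: (complex^'n^'n) measure)"
proof -
  let ?S = "\<lambda>n. {A :: complex^'n^'n. \<forall>x. (norm x)\<^sup>2 / real (Suc n) \<le> x \<bullet> (A *v x)}"
  have eq: "{A :: complex^'n^'n. pos_def A} = {A. ctranspose A = A} \<inter> (\<Union>n. ?S n)"
  proof (intro set_eqI iffI)
    fix A :: "complex^'n^'n" assume "A \<in> {A. pos_def A}"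
    then have A: "pos_def A" by simp
    obtain e where e: "e > 0" "\<And>x. e * (norm x)\<^sup>2 \<le> x \<bullet> (A *v x)" using pos_def_lower_bound[OF A] by blast
    obtain n where "inverse (real (Suc n)) < e" using reals_Archimedean[OF e(1)] by blast
    then have "(norm x)\<^sup>2 / real (Suc n) \<le> e * (norm x)\<^sup>2" for x :: "complex^'n"
      using mult_right_mono[of "inverse (real (Suc n))" e "(norm x)\<^sup>2"] by (simp add: divide_inverse mult.commute)
    then have "A \<in> ?S n" using e(2) by (auto intro: order_trans)
    then show "A \<in> {A. ctranspose A = A} \<inter> (\<Union>n. ?S n)" using A by (auto simp: pos_def_iff)
  next
    fix A :: "complex^'n^'n" assume "A \<in> {A. ctranspose A = A} \<inter> (\<Union>n. ?S n)"
    then obtain n where "ctranspose A = A" and n: "\<And>x. (norm x)\<^sup>2 / real (Suc n) \<le> x \<bullet> (A *v x)" by auto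
    moreover have "0 < x \<bullet> (A *v x)" if "x \<noteq> 0" for x
      using that n[of x] less_le_trans[of 0 "(norm x)\<^sup>2 / real (Suc n)"] by simp
    ultimately show "A \<in> {A. pos_def A}" by (simp add: pos_def_iff)
  qed
  have c: "continuous_on UNIV (\<lambda>A :: complex^'n^'n. x \<bullet> (A *v x))" for x
    by (intro continuous_intros linear_continuous_on linear_conv_bounded_linear[THEN iffD1] linearI)
       (simp_all add: matrix_vector_mult_add_rdistrib scaleR_matrix_vector_mult)
  have "closed (?S n)" for n
    unfolding Collect_all_eq
    by (intro closed_INT ballI closed_Collect_le continuous_on_const c)
  moreover have "closed {A :: complex^'n^'n. ctranspose A = A}"
    by (intro closed_Collect_eq linear_continuous_on linear_conv_bounded_linear[THEN iffD1] linear_ctranspose continuous_on_id)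
  ultimately show ?thesis unfolding eq by (intro sets.Int sets.countable_UN borel_closed) auto
qed

lemma pos_def_det: "pos_def A \<Longrightarrow> \<exists>d>0. det A = complex_of_real d"
  for A :: "complex^'n^'n"
proof -
  assume "pos_def A"
  then obtain B :: "complex^'n^'n" where B: "invertible B" "A = B ** ctranspose B" by (rule pos_def_factor)
  have "det A = det B * cnj (det B)" by (simp add: B(2) det_mul det_ctranspose)
  also have "\<dots> = complex_of_real ((cmod (det B))\<^sup>2)" by (simp only: complex_norm_square)
  finally show ?thesis using B(1) by (auto simp: invertible_det_nz intro!: exI[of _ "(cmod (det B))\<^sup>2"])
qed

section \<open>Bartlett decomposition of the Wishart density\<close>

abbreviation H :: "real^'p^'p \<Rightarrow> complex^'p^'p" where "H \<equiv> hermitian_of_coords"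

lemma H_nth: "H x $ i $ j = (if i = j then complex_of_real (x $ i $ i)
     else if to_nat i < to_nat j then Complex (x $ i $ j) (x $ j $ i)
     else Complex (x $ j $ i) (- (x $ i $ j)))"
  by (simp add: hermitian_of_coords_def)

lemma H_cnj: "cnj (H x $ i $ j) = H x $ j $ i"
  using hermitian_hermitian_of_coords[of x] unfolding hermitian_def by (metis ctranspose_nth)

lemma H_cmod: "i \<noteq> j \<Longrightarrow> (cmod (H x $ i $ j))\<^sup>2 = (x $ i $ j)\<^sup>2 + (x $ j $ i)\<^sup>2"
  by (auto simp: H_nth cmod_power2)

lemma measurable_Complex [measurable (raw)]:
  "f \<in> borel_measurable M \<Longrightarrow> g \<in> borel_measurable M \<Longrightarrow> (\<lambda>x. Complex (f x) (g x)) \<in> borel_measurable M"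
  by (subst borel_measurable_complex_iff) simp

lemma measurable_H [measurable]: "H \<in> borel_measurable borel"
  unfolding hermitian_of_coords_def by measurable

text \<open>The block of \<open>s\<close> with index set \<open>J\<close>, padded with the identity, so that blocks of all sizes share one type and have the
  determinant and inverse of the block.\<close>

definition emb :: "'p set \<Rightarrow> complex^'p^'p \<Rightarrow> complex^'p^'p" where
  "emb J s = (\<chi> i j. if i \<in> J \<and> j \<in> J then s $ i $ j else mat 1 $ i $ j)"

lemma emb_nth: "emb J s $ i $ j = (if i \<in> J \<and> j \<in> J then s $ i $ j else mat 1 $ i $ j)"
  by (simp add: emb_def)

lemma emb_UNIV [simp]: "emb UNIV s = s" by (simp add: vec_eq_iff emb_nth)

lemma emb_empty [simp]: "emb {} s = mat 1" by (simp add: vec_eq_iff emb_nth)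

lemma measurable_emb [measurable (raw)]:
  assumes [measurable]: "f \<in> borel_measurable M"
  shows "(\<lambda>x. emb J (f x)) \<in> borel_measurable M"
  unfolding emb_def
proof (intro measurable_vec_lambda)
  show "(\<lambda>x. if i \<in> J \<and> j \<in> J then f x $ i $ j else mat 1 $ i $ j) \<in> borel_measurable M" for i j
    by (cases "i \<in> J \<and> j \<in> J") simp_all
qed

text \<open>The unnormalised Wishart density with identity scale for the block \<open>J\<close>, in real coordinates.\<close>

definition wish :: "real \<Rightarrow> 'p set \<Rightarrow> real^'p^'p \<Rightarrow> ennreal" where
  "wish \<alpha> J x = (if pos_def (emb J (H x))
    then ennreal (Re (det (emb J (H x))) powr \<alpha> * exp (- (\<Sum>i\<in>J. x $ i $ i))) else 0)"

lemma measurable_wish [measurable]: "wish \<alpha> J \<in> borel_measurable borel"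
proof -
  have [measurable]: "Measurable.pred borel (\<lambda>x. pos_def (emb J (H x)))"
    by (rule measurable_compose[where f="\<lambda>x. emb J (H x)" and g=pos_def and N=borel])
       (measurable, simp add: pred_def)
  show ?thesis unfolding wish_def by measurable
qed

text \<open>The coordinate change that enlarges the block \<open>J\<close> by the index \<open>k\<close>; its meaning for matrices is given in \<open>emb_piv\<close>. The
  value \<open>r = 1\<close> for \<open>x $ k $ k \<le> 0\<close> keeps the map bijective there, where the density vanishes.\<close>

definition piv :: "'p set \<Rightarrow> 'p \<Rightarrow> real^'p^'p \<Rightarrow> real^'p^'p" where
  "piv J k x = (let r = (if 0 < x $ k $ k then sqrt (x $ k $ k) else 1);
      M = (\<chi> i j. H x $ i $ k * H x $ k $ j) in
    (\<chi> i j. if i \<in> J \<and> j \<in> J then (if to_nat j < to_nat i then Im (M $ j $ i) else Re (M $ i $ j)) + x $ i $ j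
      else if i = k \<and> j \<in> J \<or> i \<in> J \<and> j = k then r * x $ i $ j else x $ i $ j))"

text \<open>The joint density, up to a constant, of the entries of row and column \<open>k\<close> after the coordinate change: a Gamma variable on the
  diagonal, and centred Gaussian real and imaginary parts.\<close>

definition piv_weight :: "real \<Rightarrow> 'p set \<Rightarrow> 'p \<Rightarrow> real^'p^'p \<Rightarrow> ennreal" where
  "piv_weight \<alpha> J k x = (if 0 < x $ k $ k
    then ennreal (x $ k $ k powr (\<alpha> + real (card J)) * exp (- (x $ k $ k))) else 0)
    * (\<Prod>j\<in>J. ennreal (exp (- (x $ k $ j)\<^sup>2)) * ennreal (exp (- (x $ j $ k)\<^sup>2)))"

lemma measurable_piv_weight [measurable]: "piv_weight \<alpha> J k \<in> borel_measurable borel"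
  unfolding piv_weight_def by measurable

lemma piv_kk: "k \<notin> J \<Longrightarrow> piv J k x $ k $ k = x $ k $ k"
  by (simp add: piv_def Let_def)

lemma piv_outside: "i \<notin> insert k J \<or> j \<notin> insert k J \<Longrightarrow> piv J k x $ i $ j = x $ i $ j"
  by (auto simp: piv_def Let_def)

lemma piv_block:
  "i \<in> J \<Longrightarrow> j \<in> J \<Longrightarrow> piv J k x $ i $ j = (if to_nat j < to_nat i then Im (H x $ j $ k * H x $ k $ i)
    else Re (H x $ i $ k * H x $ k $ j)) + x $ i $ j"
  by (simp add: piv_def Let_def)

lemma H_piv_block:
  assumes k: "k \<notin> J" and i: "i \<in> J" and j: "j \<in> J"
  shows "H (piv J k x) $ i $ j = H x $ i $ j + H x $ i $ k * cnj (H x $ j $ k)"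
proof -
  have s: "H x $ j $ k * H x $ k $ i = cnj (H x $ i $ k * H x $ k $ j)" for i j
    by (simp add: H_cnj mult.commute)
  consider "to_nat i < to_nat j" | "i = j" | "to_nat j < to_nat i"
    by (metis linorder_less_linear inj_to_nat injD)
  then show ?thesis
  proof cases
    case 1
    with i j show ?thesis
      by (auto simp: H_cnj H_nth[of "piv J k x" i j] H_nth[of x i j] piv_block complex_eq_iff)
  next
    case 2
    have "Im (H x $ i $ k * H x $ k $ i) = 0"
      unfolding H_cnj[of x i k, symmetric] by simp
    with 2 i j show ?thesis
      by (simp add: H_cnj H_nth[of "piv J k x" j j] H_nth[of x j j] piv_block complex_eq_iff)
  next
    case 3
    with i j show ?thesis
      by (auto simp: H_cnj H_nth[of "piv J k x" i j] H_nth[of x i j] piv_block complex_eq_iff s[of j i] simp del: times_complex.sel complex_cnj_mult)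
  qed
qed

lemma H_piv_col:
  assumes k: "k \<notin> J" and i: "i \<in> J" and p: "0 < x $ k $ k"
  shows "H (piv J k x) $ i $ k = of_real (sqrt (x $ k $ k)) * H x $ i $ k"
    "H (piv J k x) $ k $ i = of_real (sqrt (x $ k $ k)) * H x $ k $ i"
  using assms by (auto simp: H_nth piv_def Let_def complex_eq_iff)

text \<open>The pivot map is a step of the Cholesky factorisation, run backwards: a scaling and a shear
  turn the block matrix with an isolated unit at \<open>k\<close> into the general matrix on \<open>insert k J\<close>.\<close>

lemma emb_piv:
  assumes k: "k \<notin> J" and p: "0 < x $ k $ k"
  defines "B \<equiv> col_scale k (sqrt (x $ k $ k)) ** col_shear k (\<chi> i. if i \<in> J then H x $ i $ k else 0)"
  shows "emb (insert k J) (H (piv J k x)) = B ** emb J (H x) ** ctranspose B"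
proof -
  let ?a = "x $ k $ k" and ?w = "\<chi> i. if i \<in> J then H x $ i $ k else 0"
  have "(B ** emb J (H x) ** ctranspose B) $ i $ j = emb (insert k J) (H (piv J k x)) $ i $ j" for i j
  proof -
    have "B ** emb J (H x) ** ctranspose B = col_scale k (sqrt ?a) ** (col_shear k ?w **
        (emb J (H x) ** ctranspose (col_shear k ?w) ** ctranspose (col_scale k (sqrt ?a))))"
      by (simp add: B_def ctranspose_mult matrix_mul_assoc)
    moreover have "of_real (sqrt ?a) * (of_real (sqrt ?a) * z) = of_real ?a * z" for z :: complex
      using p by (simp add: mult.assoc[symmetric] flip: of_real_mult)
    moreover have "H (piv J k x) $ k $ k = of_real ?a"
      by (simp add: H_nth piv_kk[OF k])
    ultimately show ?thesis
      using k H_piv_col[OF k _ p] H_piv_block[OF k]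
      by (simp add: col_scale_mult col_shear_mult mult_ctranspose_col_scale mult_ctranspose_col_shear emb_nth)
         (auto simp: mat_def H_cnj)
  qed
  then show ?thesis by (simp add: vec_eq_iff)
qed

lemma pos_def_powr_det_mult:
  fixes N :: "complex^'n^'n"
  assumes "pos_def N" "0 < a"
  shows "Re (of_real a * det N) powr \<alpha> = a powr \<alpha> * Re (det N) powr \<alpha>"
  using pos_def_det[OF assms(1)] assms(2) by (auto simp: powr_mult)

text \<open>The determinant gains the factor \<open>x $ k $ k\<close> and the trace gains the squared norm of column \<open>k\<close>, so the density splits. The power
  on the left is the Jacobian of the coordinate change.\<close>

lemma wish_piv:
  assumes k: "k \<notin> J"
  shows "ennreal ((if 0 < x $ k $ k then sqrt (x $ k $ k) else 1) ^ (2 * card J)) * wish \<alpha> (insert k J) (piv J k x)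
    = piv_weight \<alpha> J k x * wish \<alpha> J x"
proof (cases "0 < x $ k $ k")
  case False
  have "\<not> pos_def (emb (insert k J) (H (piv J k x)))"
    using pos_def_diag[of "emb (insert k J) (H (piv J k x))" k] False
    by (auto simp: emb_nth H_nth piv_kk[OF k])
  then show ?thesis using False by (simp add: wish_def piv_weight_def)
next
  case True
  let ?a = "x $ k $ k" and ?N = "emb J (H x)"
  define w where "w = (\<chi> i. if i \<in> J then H x $ i $ k else 0)"
  let ?B = "col_scale k (sqrt ?a) ** col_shear k w"
  note eq = emb_piv[OF k True, folded w_def]
  have inv: "invertible ?B" using True by (simp add: invertible_mult invertible_col_scale invertible_col_shear)
  have pd: "pos_def (emb (insert k J) (H (piv J k x))) \<longleftrightarrow> pos_def ?N"
    unfolding eq by (rule pos_def_congruence_iff[OF inv])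
  have det: "det (emb (insert k J) (H (piv J k x))) = of_real ?a * det ?N"
    using True unfolding eq by (simp add: det_mul det_ctranspose det_col_scale det_col_shear flip: of_real_mult)
  have tr: "(\<Sum>i\<in>insert k J. piv J k x $ i $ i)
      = ?a + (\<Sum>i\<in>J. x $ i $ i) + (\<Sum>j\<in>J. (x $ k $ j)\<^sup>2 + (x $ j $ k)\<^sup>2)"
  proof -
    have "piv J k x $ i $ i = x $ i $ i + ((x $ k $ i)\<^sup>2 + (x $ i $ k)\<^sup>2)" if i: "i \<in> J" for i
    proof -
      have "H x $ i $ k * H x $ k $ i = of_real ((cmod (H x $ i $ k))\<^sup>2)"
        unfolding complex_norm_square H_cnj ..
      moreover have "i \<noteq> k" using i k by auto
      ultimately show ?thesis using i by (simp add: piv_block H_cmod del: of_real_power)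
    qed
    then show ?thesis using k by (simp add: piv_kk sum.distrib)
  qed
  show ?thesis
  proof (cases "pos_def ?N")
    case False
    then show ?thesis by (simp add: wish_def pd)
  next
    case N: True
    have "sqrt ?a ^ (2 * card J) = ?a powr real (card J)"
      using True by (simp add: power_mult powr_realpow)
    then have pw: "sqrt ?a ^ (2 * card J) * (?a powr \<alpha> * d) = ?a powr (\<alpha> + real (card J)) * d" for d
      by (simp add: powr_add)
    have "(\<Prod>j\<in>J. ennreal (exp (- (x $ k $ j)\<^sup>2)) * ennreal (exp (- (x $ j $ k)\<^sup>2)))
        = ennreal (exp (- (\<Sum>j\<in>J. (x $ k $ j)\<^sup>2 + (x $ j $ k)\<^sup>2)))"
      by (simp add: ennreal_mult'[symmetric] prod_ennreal exp_sum exp_minus_inverse exp_add[symmetric] flip: sum_negf)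
    then have w: "piv_weight \<alpha> J k x = ennreal (?a powr (\<alpha> + real (card J)) * exp (- ?a)
        * exp (- (\<Sum>j\<in>J. (x $ k $ j)\<^sup>2 + (x $ j $ k)\<^sup>2)))"
      using True by (simp add: piv_weight_def ennreal_mult)
    have "sqrt ?a ^ (2 * card J) * (Re (of_real ?a * det ?N) powr \<alpha> * exp (- (?a + (\<Sum>i\<in>J. x $ i $ i) + (\<Sum>j\<in>J. (x $ k $ j)\<^sup>2 + (x $ j $ k)\<^sup>2))))
       = ?a powr (\<alpha> + real (card J)) * exp (- ?a) * exp (- (\<Sum>j\<in>J. (x $ k $ j)\<^sup>2 + (x $ j $ k)\<^sup>2))
         * (Re (det ?N) powr \<alpha> * exp (- (\<Sum>i\<in>J. x $ i $ i)))"
    proof -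
      have e: "exp (- (a + t + q)) = exp (- a) * (exp (- q) * exp (- t))" for a t q :: real
        by (simp flip: exp_add)
      show ?thesis unfolding pos_def_powr_det_mult[OF N True] e mult.assoc pw by (simp add: mult_ac)
    qed
    then show ?thesis using N True by (simp add: wish_def pd w det tr flip: ennreal_mult)
  qed
qed

lemma nn_integral_wish_piv:
  assumes k: "k \<notin> J" and [measurable]: "f \<in> borel_measurable borel"
  shows "(\<integral>\<^sup>+x. f x * wish \<alpha> (insert k J) x \<partial>lborel)
    = (\<integral>\<^sup>+x. f (piv J k x) * (piv_weight \<alpha> J k x * wish \<alpha> J x) \<partial>lborel)"
proof -
  let ?r = "\<lambda>x. if 0 < x $ k $ k then sqrt (x $ k $ k) else 1 :: real"
  let ?R = "{k} \<times> J \<union> J \<times> {k}"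
  \<comment> \<open>The pivot map is the scaling \<open>S\<close> of row and column \<open>k\<close>, followed by the translation \<open>?T\<close> of the block. The
    translation is expressed in the scaled entries, hence the division by the square of \<open>?r\<close>.\<close>
  define S where "S x = (\<chi> i j. if (i, j) \<in> ?R then (0::real^'a^'a) $ i $ j + ?r x * x $ i $ j else x $ i $ j)" for x
  define g where "g x = (\<chi> i j. if to_nat j < to_nat i then Im (H x $ j $ k * H x $ k $ i / (?r x)\<^sup>2)
     else Re (H x $ i $ k * H x $ k $ j / (?r x)\<^sup>2))" for x :: "real^'a^'a"
  let ?T = "\<lambda>x. \<chi> i j. if (i, j) \<in> J \<times> J then g x $ i $ j + 1 * x $ i $ j else x $ i $ j"
  let ?f = "\<lambda>x. f x * wish \<alpha> (insert k J) x"
  have [measurable]: "g \<in> borel_measurable borel" unfolding g_def by measurable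
  have [measurable]: "?T \<in> borel_measurable borel" by measurable
  have card: "card ?R = 2 * card J"
    using k by (subst card_Un_disjoint) (auto simp: card_cartesian_product)
  have Hmix: "H (mix (J \<times> J) x w) $ i $ j = H x $ i $ j" if "i = k \<or> j = k" for i j x w
    using that k by (auto simp: H_nth mix_nth)
  have T: "?T (S x) = piv J k x" for x
  proof -
    have S: "H (S x) $ i $ k = of_real (?r x) * H x $ i $ k" "H (S x) $ k $ i = of_real (?r x) * H x $ k $ i"
      if "i \<in> J" for i using that k by (auto simp: S_def H_nth complex_eq_iff)
    have r: "?r (S x) = ?r x" using k by (simp add: S_def)
    have "g (S x) $ i $ j = (if to_nat j < to_nat i then Im (H x $ j $ k * H x $ k $ i) else Re (H x $ i $ k * H x $ k $ j))"
      if "i \<in> J" "j \<in> J" for i j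
    proof -
      have *: "(of_real (?r x) * z) * (of_real (?r x) * z') / (of_real (?r x))\<^sup>2 = z * z'" for z z' :: complex
        by (simp add: power2_eq_square field_simps)
      show ?thesis unfolding g_def vec_lambda_beta r S[OF that(1)] S[OF that(2)] of_real_power * ..
    qed
    then show ?thesis using k by (auto simp: vec_eq_iff piv_def Let_def) (auto simp: S_def)
  qed
  have "(\<integral>\<^sup>+x. ?f x \<partial>lborel) = (\<integral>\<^sup>+x. ennreal (1 ^ card (J \<times> J)) * ?f (?T x) \<partial>lborel)"
    using k by (intro nn_integral_fibre_affine) (auto simp: g_def Hmix mix_nth vec_eq_iff)
  also have "\<dots> = (\<integral>\<^sup>+x. ?f (?T x) \<partial>lborel)" by simp
  also have "\<dots> = (\<integral>\<^sup>+x. ennreal (?r x ^ card ?R) * ?f (?T (S x)) \<partial>lborel)"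
    unfolding S_def using k by (intro nn_integral_fibre_affine) (auto simp: mix_nth)
  also have "\<dots> = (\<integral>\<^sup>+x. f (piv J k x) * (piv_weight \<alpha> J k x * wish \<alpha> J x) \<partial>lborel)"
    unfolding T card wish_piv[OF k, symmetric] by (simp add: mult_ac)
  finally show ?thesis .
qed

text \<open>By \<open>emb_piv\<close> the two inverses are congruent by a matrix that differs from the identity only in column \<open>k\<close>.\<close>

lemma matrix_inv_emb_piv:
  assumes k: "k \<notin> J" and p: "0 < x $ k $ k" and N: "pos_def (emb J (H x))" and i: "i \<in> J" and j: "j \<in> J"
  shows "matrix_inv (emb (insert k J) (H (piv J k x))) $ i $ j = matrix_inv (emb J (H x)) $ i $ j"
proof -
  define w where "w = (\<chi> i. if i \<in> J then H x $ i $ k else 0)"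
  let ?D = "col_scale k (sqrt (x $ k $ k))" and ?D' = "col_scale k (1 / sqrt (x $ k $ k))" and ?N = "emb J (H x)"
  let ?B = "?D ** col_shear k w"
  let ?C = "col_shear k (- w) ** ?D'"
  have "?B ** ?C = ?D ** (col_shear k w ** col_shear k (- w)) ** ?D'" by (simp add: matrix_mul_assoc)
  then have BC: "?B ** ?C = mat 1" using p by (simp add: col_shear_inverse col_scale_inverse)
  note C = matrix_inv_unique[OF BC]
  have X: "matrix_inv (emb (insert k J) (H (piv J k x))) = ctranspose ?C ** matrix_inv ?N ** ?C"
    unfolding emb_piv[OF k p, folded w_def]
    using C pos_def_invertible[OF N]
    by (simp add: matrix_inv_mult invertible_mult invertible_ctranspose matrix_inv_ctranspose matrix_mul_assoc)
  have right: "(M ** ?C) $ a $ b = M $ a $ b" if "b \<noteq> k" for M :: "complex^'a^'a" and a b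
  proof -
    have "(M ** ?C) $ a $ b = (\<Sum>l\<in>UNIV. M $ a $ l * mat 1 $ l $ b)"
      unfolding matrix_matrix_mult_def[of M] vec_lambda_beta col_shear_mult using that
      by (intro sum.cong refl) (auto simp: col_scale_def mat_def)
    also have "\<dots> = (M ** mat 1) $ a $ b" by (simp add: matrix_matrix_mult_def)
    finally show ?thesis by simp
  qed
  have left: "(ctranspose ?C ** M) $ a $ b = M $ a $ b" if "a \<noteq> k" for M :: "complex^'a^'a" and a b
    using right[OF that, of "ctranspose M" b]
    by (metis ctranspose_ctranspose ctranspose_mult ctranspose_nth)
  from i j k have ij: "i \<noteq> k" "j \<noteq> k" by auto
  show ?thesis unfolding X matrix_mul_assoc[symmetric] left[OF ij(1)] right[OF ij(2)] ..
qed

text \<open>The density of the entries split off when the indices in the list are eliminated from front to back and the block \<open>K\<close> is left.\<close>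

fun bart :: "real \<Rightarrow> 'p::finite set \<Rightarrow> 'p list \<Rightarrow> real^'p^'p \<Rightarrow> ennreal" where
  "bart \<alpha> K [] x = 1"
| "bart \<alpha> K (k # ks) x = piv_weight \<alpha> (set ks \<union> K) k x * bart \<alpha> K ks x"

lemma measurable_bart [measurable]: "bart \<alpha> K ks \<in> borel_measurable borel"
  by (induction ks) simp_all

lemma bart_append: "bart \<alpha> {} (ks @ ls) x = bart \<alpha> (set ls) ks x * bart \<alpha> {} ls x"
  by (induction ks) (simp_all add: mult_ac)

text \<open>Eliminating the indices \<open>ks\<close> one after the other leaves a Wishart density on \<open>K\<close>.
  The block of the inverse matrix on \<open>K\<close> is not changed by the elimination.\<close>

lemma nn_integral_wish_eliminate:
  fixes \<psi> :: "complex^'p^'p \<Rightarrow> ennreal" and \<phi> :: "real^'p^'p \<Rightarrow> ennreal"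
  assumes "distinct ks" "set ks \<inter> K = {}"
    and [measurable]: "\<psi> \<in> borel_measurable borel" "\<phi> \<in> borel_measurable borel"
    and \<phi>: "\<And>x w. \<phi> (mix ((set ks \<union> K) \<times> (set ks \<union> K)) x w) = \<phi> x"
    and \<psi>: "\<And>M N. (\<forall>i\<in>K. \<forall>j\<in>K. M $ i $ j = N $ i $ j) \<Longrightarrow> \<psi> M = \<psi> N"
  shows "(\<integral>\<^sup>+x. \<phi> x * \<psi> (matrix_inv (emb (set ks \<union> K) (H x))) * wish \<alpha> (set ks \<union> K) x \<partial>lborel)
    = (\<integral>\<^sup>+x. \<phi> x * bart \<alpha> K ks x * \<psi> (matrix_inv (emb K (H x))) * wish \<alpha> K x \<partial>lborel)"
  using assms(1,2) \<phi> \<open>\<phi> \<in> _\<close>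
proof (induction ks arbitrary: \<phi>)
  case Nil
  then show ?case by simp
next
  case (Cons k ks)
  note [measurable] = Cons.prems(4)
  let ?J = "set ks \<union> K"
  have k: "k \<notin> ?J" and S: "set (k # ks) \<union> K = insert k ?J" using Cons.prems(1,2) by auto
  have \<phi>': "\<phi> y = \<phi> x" if "\<And>i j. i \<notin> insert k ?J \<or> j \<notin> insert k ?J \<Longrightarrow> y $ i $ j = x $ i $ j" for x y
  proof -
    have "y = mix (insert k ?J \<times> insert k ?J) x y" using that by (auto simp: vec_eq_iff mix_nth)
    then show ?thesis using Cons.prems(3)[unfolded S] by metis
  qed
  have "(\<integral>\<^sup>+x. \<phi> x * \<psi> (matrix_inv (emb (insert k ?J) (H x))) * wish \<alpha> (insert k ?J) x \<partial>lborel)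
      = (\<integral>\<^sup>+x. \<phi> (piv ?J k x) * \<psi> (matrix_inv (emb (insert k ?J) (H (piv ?J k x)))) * (piv_weight \<alpha> ?J k x * wish \<alpha> ?J x) \<partial>lborel)"
    by (rule nn_integral_wish_piv[OF k]) measurable
  also have "\<dots> = (\<integral>\<^sup>+x. (\<phi> x * piv_weight \<alpha> ?J k x) * \<psi> (matrix_inv (emb ?J (H x))) * wish \<alpha> ?J x \<partial>lborel)"
  proof (rule nn_integral_cong)
    fix x
    have 1: "\<phi> (piv ?J k x) = \<phi> x" by (rule \<phi>') (rule piv_outside)
    have 2: "\<psi> (matrix_inv (emb (insert k ?J) (H (piv ?J k x)))) = \<psi> (matrix_inv (emb ?J (H x)))"
      if "0 < x $ k $ k" "pos_def (emb ?J (H x))"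
      by (intro \<psi> ballI matrix_inv_emb_piv k that) auto
    show "\<phi> (piv ?J k x) * \<psi> (matrix_inv (emb (insert k ?J) (H (piv ?J k x)))) * (piv_weight \<alpha> ?J k x * wish \<alpha> ?J x)
        = (\<phi> x * piv_weight \<alpha> ?J k x) * \<psi> (matrix_inv (emb ?J (H x))) * wish \<alpha> ?J x"
    proof (cases "0 < x $ k $ k \<and> pos_def (emb ?J (H x))")
      case True
      then show ?thesis using 1 2 by (simp add: mult_ac)
    next
      case False
      then have "piv_weight \<alpha> ?J k x * wish \<alpha> ?J x = 0" by (auto simp: piv_weight_def wish_def)
      then show ?thesis by (auto simp: mult_ac)
    qed
  qed
  also have "\<dots> = (\<integral>\<^sup>+x. (\<phi> x * piv_weight \<alpha> ?J k x) * bart \<alpha> K ks x * \<psi> (matrix_inv (emb K (H x))) * wish \<alpha> K x \<partial>lborel)"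
  proof (rule Cons.IH)
    show "distinct ks" "set ks \<inter> K = {}" using Cons.prems(1,2) by auto
    fix x w
    have "\<phi> (mix (?J \<times> ?J) x w) = \<phi> x" by (rule \<phi>') (auto simp: mix_nth)
    moreover have "piv_weight \<alpha> ?J k (mix (?J \<times> ?J) x w) = piv_weight \<alpha> ?J k x"
      using k by (simp add: piv_weight_def mix_nth)
    ultimately show "\<phi> (mix (?J \<times> ?J) x w) * piv_weight \<alpha> ?J k (mix (?J \<times> ?J) x w) = \<phi> x * piv_weight \<alpha> ?J k x"
      by simp
  qed measurable
  finally show ?case unfolding S by (simp add: mult_ac)
qed

lemma wish_empty [simp]: "wish \<alpha> {} x = 1"
  by (simp add: wish_def)

text \<open>The number of indices that are eliminated after \<open>i\<close>. It raises the shape of the Gamma variable at the pivot \<open>i\<close>.\<close>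

fun rank_from_end :: "'a list \<Rightarrow> 'a \<Rightarrow> nat" where
  "rank_from_end [] i = 0"
| "rank_from_end (k # ks) i = (if i = k then length ks else rank_from_end ks i)"

lemma prod_rank_from_end:
  "distinct ks \<Longrightarrow> (\<Prod>i\<in>set ks. h (rank_from_end ks i)) = (\<Prod>r<length ks. h r)" for h :: "nat \<Rightarrow> 'b::comm_monoid_mult"
proof (induction ks)
  case (Cons k ks)
  have "(\<Prod>i\<in>set ks. h (rank_from_end (k # ks) i)) = (\<Prod>i\<in>set ks. h (rank_from_end ks i))"
    using Cons.prems by (intro prod.cong) auto
  then show ?case using Cons by (simp add: mult.commute)
qed simp

text \<open>The density of the single entry at \<open>(i, j)\<close> when all indices are eliminated.\<close>

definition bart_factor :: "real \<Rightarrow> 'p list \<Rightarrow> 'p \<Rightarrow> 'p \<Rightarrow> real \<Rightarrow> ennreal" where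
  "bart_factor \<alpha> ks i j t = (if i = j then (if 0 < t then ennreal (t powr (\<alpha> + real (rank_from_end ks i)) * exp (- t)) else 0)
     else ennreal (exp (- t\<^sup>2)))"

lemma measurable_bart_factor [measurable]: "bart_factor \<alpha> ks i j \<in> borel_measurable borel"
  unfolding bart_factor_def by measurable

lemma bart_eq_prod:
  "distinct ks \<Longrightarrow> bart \<alpha> {} ks x = (\<Prod>i\<in>set ks. \<Prod>j\<in>set ks. bart_factor \<alpha> ks i j (x $ i $ j))"
proof (induction ks)
  case (Cons k ks)
  then have k: "k \<notin> set ks" and c: "card (set ks) = length ks" by (auto simp: distinct_card)
  have e: "bart_factor \<alpha> (k # ks) i j t = bart_factor \<alpha> ks i j t" if "i \<in> set ks" for i j t
    using that k by (auto simp: bart_factor_def)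
  have "(\<Prod>i\<in>set (k # ks). \<Prod>j\<in>set (k # ks). bart_factor \<alpha> (k # ks) i j (x $ i $ j))
      = bart_factor \<alpha> (k # ks) k k (x $ k $ k) * (\<Prod>j\<in>set ks. bart_factor \<alpha> (k # ks) k j (x $ k $ j))
        * ((\<Prod>i\<in>set ks. bart_factor \<alpha> ks i k (x $ i $ k)) * (\<Prod>i\<in>set ks. \<Prod>j\<in>set ks. bart_factor \<alpha> ks i j (x $ i $ j)))"
    using k by (simp add: prod.distrib e mult_ac cong: prod.cong)
  also have "(\<Prod>j\<in>set ks. bart_factor \<alpha> (k # ks) k j (x $ k $ j)) = (\<Prod>j\<in>set ks. ennreal (exp (- (x $ k $ j)\<^sup>2)))"
    using k by (intro prod.cong) (auto simp: bart_factor_def)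
  also have "(\<Prod>i\<in>set ks. bart_factor \<alpha> ks i k (x $ i $ k)) = (\<Prod>j\<in>set ks. ennreal (exp (- (x $ j $ k)\<^sup>2)))"
    using k by (intro prod.cong) (auto simp: bart_factor_def)
  finally show ?case using Cons c by (simp add: piv_weight_def bart_factor_def prod.distrib mult_ac)
qed simp

text \<open>The quadratic form is the sum of that of \<open>s\<close> on the coordinates in \<open>J\<close> and the squared norm of the others.\<close>

lemma pos_def_emb:
  assumes s: "pos_def s"
  shows "pos_def (emb J s)"
  unfolding pos_def_iff
proof (intro conjI allI impI)
  have "cnj (s $ i $ j) = s $ j $ i" for i j
    using pos_def_hermitian[OF s] by (metis ctranspose_nth)
  then show "ctranspose (emb J s) = emb J s"
    by (auto simp: vec_eq_iff emb_nth mat_def)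
next
  fix x :: "complex^'a" assume x: "x \<noteq> 0"
  define y where "y = (\<chi> i. if i \<in> J then x $ i else 0)"
  have "x $ i \<bullet> (emb J s *v x) $ i = (x - y) $ i \<bullet> (x - y) $ i + y $ i \<bullet> (s *v y) $ i" for i
  proof (cases "i \<in> J")
    case True
    then have "(emb J s *v x) $ i = (s *v y) $ i"
      unfolding matrix_vector_mult_def vec_lambda_beta by (intro sum.cong refl) (auto simp: emb_nth y_def mat_def)
    then show ?thesis using True by (simp add: y_def)
  next
    case False
    then have "(emb J s *v x) $ i = (mat 1 *v x) $ i"
      unfolding matrix_vector_mult_def vec_lambda_beta by (intro sum.cong refl) (auto simp: emb_nth)
    then show ?thesis using False by (simp add: y_def)
  qed
  then have e: "x \<bullet> (emb J s *v x) = (x - y) \<bullet> (x - y) + y \<bullet> (s *v y)"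
    by (simp add: inner_vec_def sum.distrib)
  show "0 < x \<bullet> (emb J s *v x)"
  proof (cases "y = 0")
    case True then show ?thesis using x e by simp
  next
    case False
    then have "0 < y \<bullet> (s *v y)" using s by (simp add: pos_def_iff)
    then show ?thesis unfolding e by (simp add: add_nonneg_pos)
  qed
qed

lemma emb_mult_outside:
  fixes M X :: "complex^'n^'n"
  assumes "i \<notin> K \<or> j \<notin> K"
  shows "emb K M $ i $ l * emb K X $ l $ j = mat 1 $ i $ l * mat 1 $ l $ j"
  using assms by (cases "i = l"; cases "l = j"; cases "i \<in> K"; cases "j \<in> K"; simp add: emb_nth mat_def)

lemma emb_matrix_inv_emb:
  fixes M :: "complex^'n^'n"
  assumes "invertible (emb K M)"
  shows "emb K (matrix_inv (emb K M)) = matrix_inv (emb K M)"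
proof -
  let ?M = "emb K M" and ?X = "matrix_inv (emb K M)"
  have "(?M ** emb K ?X) $ i $ j = mat 1 $ i $ j" for i j
  proof (cases "i \<in> K \<and> j \<in> K")
    case True
    then have "(?M ** emb K ?X) $ i $ j = (?M ** ?X) $ i $ j"
      unfolding matrix_matrix_mult_def vec_lambda_beta
      by (intro sum.cong refl) (auto simp: emb_nth mat_def)
    then show ?thesis by (simp add: matrix_inv[OF assms])
  next
    case False
    then have ij: "i \<notin> K \<or> j \<notin> K" by simp
    have "(?M ** emb K ?X) $ i $ j = (mat 1 ** (mat 1 :: complex^'n^'n)) $ i $ j"
      unfolding matrix_matrix_mult_def vec_lambda_beta emb_mult_outside[OF ij] ..
    then show ?thesis by simp
  qed
  then have "?M ** emb K ?X = mat 1" by (simp add: vec_eq_iff)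
  from matrix_inv_unique(2)[OF this] show ?thesis by simp
qed

text \<open>The Schur complement of the complement of \<open>K\<close>, extended by the identity.\<close>

definition schur :: "'p set \<Rightarrow> complex^'p^'p \<Rightarrow> complex^'p^'p" where
  "schur K s = matrix_inv (emb K (matrix_inv s))"

lemma schur_emb:
  assumes "pos_def (emb K s)"
  shows "schur K (emb K s) = emb K s"
  using pos_def_invertible[OF assms]
  by (simp add: schur_def emb_matrix_inv_emb matrix_inv_matrix_inv)

lemma bart_outside:
  "set ks \<inter> K = {} \<Longrightarrow> (\<And>i j. i \<notin> K \<or> j \<notin> K \<Longrightarrow> y $ i $ j = x $ i $ j) \<Longrightarrow> bart \<alpha> K ks y = bart \<alpha> K ks x"
  by (induction ks) (auto simp: piv_weight_def)

text \<open>A function of row and column \<open>k\<close> of the Schur complement, with respect to the product density: the indices outside the block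
  are eliminated first and do not change its Schur complement, and \<open>k\<close> comes next, so that its row and column can be read
  off from the coordinates.\<close>

lemma nn_integral_schur_row:
  fixes \<Psi> :: "complex^'p^'p \<Rightarrow> ennreal" and \<Phi> :: "real^'p^'p \<Rightarrow> ennreal"
  assumes d: "distinct (ks @ k # ks')" "set (ks @ k # ks') = UNIV"
    and [measurable]: "\<Psi> \<in> borel_measurable borel" "\<Phi> \<in> borel_measurable borel"
    and \<Phi>: "\<And>x w. \<Phi> (mix (set ks' \<times> set ks') x w) = \<Phi> x"
    and \<Psi>: "\<And>x. 0 < x $ k $ k \<Longrightarrow> \<Psi> (emb (insert k (set ks')) (H (piv (set ks') k x))) = \<Phi> x"
  shows "(\<integral>\<^sup>+x. \<Psi> (schur (insert k (set ks')) (H x)) * wish \<alpha> UNIV x \<partial>lborel)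
    = (\<integral>\<^sup>+x. \<Phi> x * bart \<alpha> {} (ks @ k # ks') x \<partial>lborel)"
proof -
  let ?J = "set ks'"
  let ?K = "insert k ?J"
  have k: "k \<notin> ?J" "?K \<union> set ks = UNIV" "set ks \<inter> ?K = {}" using d by auto
  have U: "set ks \<union> ?K = UNIV" using k by auto
  have "(\<integral>\<^sup>+x. \<Psi> (schur ?K (H x)) * wish \<alpha> UNIV x \<partial>lborel)
      = (\<integral>\<^sup>+x. 1 * \<Psi> (matrix_inv (emb ?K (matrix_inv (emb (set ks \<union> ?K) (H x))))) * wish \<alpha> (set ks \<union> ?K) x \<partial>lborel)"
    by (simp only: U schur_def emb_UNIV mult_1)
  also have "\<dots> = (\<integral>\<^sup>+x. 1 * bart \<alpha> ?K ks x * \<Psi> (matrix_inv (emb ?K (matrix_inv (emb ?K (H x))))) * wish \<alpha> ?K x \<partial>lborel)"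
  proof (rule nn_integral_wish_eliminate[where \<phi>="\<lambda>_. 1" and \<psi>="\<lambda>M. \<Psi> (matrix_inv (emb ?K M))"])
    show "distinct ks" "set ks \<inter> ?K = {}" using d by auto
    fix M N :: "complex^'p^'p" assume "\<forall>i\<in>?K. \<forall>j\<in>?K. M $ i $ j = N $ i $ j"
    then have "emb ?K M = emb ?K N" by (auto simp: vec_eq_iff emb_nth)
    then show "\<Psi> (matrix_inv (emb ?K M)) = \<Psi> (matrix_inv (emb ?K N))" by simp
  qed simp_all
  also have "\<dots> = (\<integral>\<^sup>+x. (bart \<alpha> ?K ks x * \<Psi> (emb ?K (H x))) * wish \<alpha> ?K x \<partial>lborel)"
  proof (rule nn_integral_cong)
    fix x
    show "1 * bart \<alpha> ?K ks x * \<Psi> (matrix_inv (emb ?K (matrix_inv (emb ?K (H x))))) * wish \<alpha> ?K x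
        = (bart \<alpha> ?K ks x * \<Psi> (emb ?K (H x))) * wish \<alpha> ?K x"
      using schur_emb[of ?K "H x"] by (cases "pos_def (emb ?K (H x))") (simp_all add: schur_def wish_def)
  qed
  also have "\<dots> = (\<integral>\<^sup>+x. (bart \<alpha> ?K ks (piv ?J k x) * \<Psi> (emb ?K (H (piv ?J k x)))) * (piv_weight \<alpha> ?J k x * wish \<alpha> ?J x) \<partial>lborel)"
    by (rule nn_integral_wish_piv[OF k(1)]) measurable
  also have "\<dots> = (\<integral>\<^sup>+x. (bart \<alpha> ?K ks x * \<Phi> x * piv_weight \<alpha> ?J k x) * 1 * wish \<alpha> (?J \<union> {}) x \<partial>lborel)"
  proof (rule nn_integral_cong)
    fix x
    have "bart \<alpha> ?K ks (piv ?J k x) = bart \<alpha> ?K ks x"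
      by (rule bart_outside[OF k(3)]) (rule piv_outside)
    then show "(bart \<alpha> ?K ks (piv ?J k x) * \<Psi> (emb ?K (H (piv ?J k x)))) * (piv_weight \<alpha> ?J k x * wish \<alpha> ?J x)
        = (bart \<alpha> ?K ks x * \<Phi> x * piv_weight \<alpha> ?J k x) * 1 * wish \<alpha> (?J \<union> {}) x"
      using \<Psi>[of x] by (cases "0 < x $ k $ k") (simp_all add: piv_weight_def mult_ac)
  qed
  also have "\<dots> = (\<integral>\<^sup>+x. (bart \<alpha> ?K ks x * \<Phi> x * piv_weight \<alpha> ?J k x) * bart \<alpha> {} ks' x * 1 * wish \<alpha> {} x \<partial>lborel)"
  proof (rule nn_integral_wish_eliminate[where \<psi>="\<lambda>_. 1"])
    show "distinct ks'" using d by auto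
    fix x w
    have "bart \<alpha> ?K ks (mix (?J \<times> ?J) x w) = bart \<alpha> ?K ks x"
      by (rule bart_outside[OF k(3)]) (auto simp: mix_nth)
    moreover have "piv_weight \<alpha> ?J k (mix (?J \<times> ?J) x w) = piv_weight \<alpha> ?J k x"
      using k by (simp add: piv_weight_def mix_nth)
    ultimately show "bart \<alpha> ?K ks (mix ((?J \<union> {}) \<times> (?J \<union> {})) x w) * \<Phi> (mix ((?J \<union> {}) \<times> (?J \<union> {})) x w)
         * piv_weight \<alpha> ?J k (mix ((?J \<union> {}) \<times> (?J \<union> {})) x w)
        = bart \<alpha> ?K ks x * \<Phi> x * piv_weight \<alpha> ?J k x"
      by (simp add: \<Phi>)
  qed simp_all
  also have "\<dots> = (\<integral>\<^sup>+x. \<Phi> x * bart \<alpha> {} (ks @ k # ks') x \<partial>lborel)"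
    by (simp add: bart_append mult_ac)
  finally show ?thesis .
qed

section \<open>Moments of the Bartlett factors\<close>

lemma nn_integral_gamma_density:
  assumes "\<beta> > -1"
  shows "(\<integral>\<^sup>+t. (if 0 < t then ennreal (t powr \<beta> * exp (- t)) else 0) \<partial>lborel) = ennreal (Gamma (\<beta> + 1))"
proof -
  have "(\<integral>\<^sup>+t. (if 0 < t then ennreal (t powr \<beta> * exp (- t)) else 0) \<partial>lborel)
      = (\<integral>\<^sup>+t. ennreal (indicator {0..} t * t powr (\<beta> + 1 - 1) / exp t) \<partial>lborel)"
    by (intro nn_integral_cong) (auto simp: indicator_def exp_minus divide_inverse)
  also have "\<dots> = ennreal (Gamma (\<beta> + 1))"
    using Gamma_conv_nn_integral_real[of "\<beta> + 1"] assms by simp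
  finally show ?thesis .
qed

lemma nn_integral_bart_monomial:
  fixes u :: "'p::finite \<Rightarrow> 'p \<Rightarrow> real \<Rightarrow> ennreal"
  assumes d: "distinct ls" "set ls = UNIV" and [measurable]: "\<And>i j. u i j \<in> borel_measurable borel"
    and u: "\<And>i j. (\<integral>\<^sup>+t. u i j t * bart_factor \<alpha> ls i j t \<partial>lborel) = r i j * (\<integral>\<^sup>+t. bart_factor \<alpha> ls i j t \<partial>lborel)"
  shows "(\<integral>\<^sup>+x. (\<Prod>i\<in>UNIV. \<Prod>j\<in>UNIV. u i j (x $ i $ j)) * bart \<alpha> {} ls x \<partial>lborel)
    = (\<Prod>i\<in>UNIV. \<Prod>j\<in>UNIV. r i j) * (\<integral>\<^sup>+x. bart \<alpha> {} ls x \<partial>lborel)"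
  unfolding bart_eq_prod[OF d(1)] d(2) prod.distrib[symmetric]
  by (subst nn_integral_matrix_prod[where f="\<lambda>i j t. u i j t * bart_factor \<alpha> ls i j t"])
     (simp_all add: u nn_integral_matrix_prod prod.distrib)

text \<open>The complex multivariate Gamma function of order \<open>p\<close> at \<open>\<alpha> + p\<close>.\<close>

definition wishart_mass :: "real \<Rightarrow> nat \<Rightarrow> real" where
  "wishart_mass \<alpha> p = pi ^ (p * (p - 1) div 2) * (\<Prod>r<p. Gamma (\<alpha> + 1 + real r))"

lemma wishart_mass_pos: "\<alpha> > -1 \<Longrightarrow> wishart_mass \<alpha> p > 0"
  unfolding wishart_mass_def by (intro mult_pos_pos prod_pos zero_less_power Gamma_real_pos) auto

lemma nn_integral_bart_factor:
  assumes "\<alpha> > -1"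
  shows "(\<integral>\<^sup>+t. bart_factor \<alpha> ls i j t \<partial>lborel)
    = (if i = j then ennreal (Gamma (\<alpha> + 1 + real (rank_from_end ls i))) else ennreal (sqrt pi))"
  using nn_integral_gamma_density[of "\<alpha> + real (rank_from_end ls i)"] nn_integral_gauss_1[of 1] assms
  by (simp add: bart_factor_def add_ac)

lemma nn_integral_bart:
  fixes ls :: "'p::finite list"
  assumes d: "distinct ls" "set ls = UNIV" and a: "\<alpha> > -1"
  shows "(\<integral>\<^sup>+x. bart \<alpha> {} ls x \<partial>lborel) = ennreal (wishart_mass \<alpha> CARD('p))"
proof -
  let ?p = "CARD('p)"
  have len: "length ls = ?p" using d distinct_card[of ls] by simp
  have "(\<integral>\<^sup>+x. bart \<alpha> {} ls x \<partial>lborel) = (\<Prod>i\<in>UNIV. \<Prod>j\<in>UNIV. (\<integral>\<^sup>+t. bart_factor \<alpha> ls i j t \<partial>lborel))"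
    unfolding bart_eq_prod[OF d(1)] d(2) by (rule nn_integral_matrix_prod) simp
  also have "\<dots> = (\<Prod>i\<in>UNIV. ennreal (Gamma (\<alpha> + 1 + real (rank_from_end ls i))) * ennreal (sqrt pi) ^ (?p - 1))"
  proof (rule prod.cong[OF refl])
    fix i
    have "(\<Prod>j\<in>UNIV. (\<integral>\<^sup>+t. bart_factor \<alpha> ls i j t \<partial>lborel))
        = (\<integral>\<^sup>+t. bart_factor \<alpha> ls i i t \<partial>lborel) * (\<Prod>j\<in>UNIV - {i}. (\<integral>\<^sup>+t. bart_factor \<alpha> ls i j t \<partial>lborel))"
      by (rule prod.remove) auto
    also have "(\<Prod>j\<in>UNIV - {i}. (\<integral>\<^sup>+t. bart_factor \<alpha> ls i j t \<partial>lborel)) = (\<Prod>j\<in>UNIV - {i}. ennreal (sqrt pi))"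
      by (intro prod.cong refl) (auto simp: nn_integral_bart_factor[OF a])
    finally show "(\<Prod>j\<in>UNIV. (\<integral>\<^sup>+t. bart_factor \<alpha> ls i j t \<partial>lborel))
        = ennreal (Gamma (\<alpha> + 1 + real (rank_from_end ls i))) * ennreal (sqrt pi) ^ (?p - 1)"
      by (simp add: nn_integral_bart_factor[OF a])
  qed
  also have "\<dots> = ennreal (sqrt pi) ^ ((?p - 1) * ?p) * (\<Prod>r<?p. ennreal (Gamma (\<alpha> + 1 + real r)))"
    using prod_rank_from_end[OF d(1), of "\<lambda>r. ennreal (Gamma (\<alpha> + 1 + real r))"]
    by (simp add: prod.distrib d len mult.commute flip: power_mult)
  also have "ennreal (sqrt pi) ^ ((?p - 1) * ?p) = ennreal (pi ^ (?p * (?p - 1) div 2))"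
  proof -
    have "even (?p * (?p - 1))" by auto
    then have "(?p - 1) * ?p = 2 * (?p * (?p - 1) div 2)" by (simp add: mult.commute)
    then have "sqrt pi ^ ((?p - 1) * ?p) = pi ^ (?p * (?p - 1) div 2)"
      by (metis power_mult real_sqrt_pow2 pi_ge_zero)
    then show ?thesis by (simp add: ennreal_power)
  qed
  finally show ?thesis using a
    by (simp add: wishart_mass_def ennreal_mult prod_ennreal prod_nonneg Gamma_real_pos less_imp_le)
qed

lemma prod_prod_delta:
  "(\<Prod>i\<in>UNIV. \<Prod>j\<in>UNIV. if i = a \<and> j = b then (c::'b::comm_monoid_mult) else 1) = c"
  for a :: "'m::finite" and b :: "'n::finite"
proof -
  have "(\<Prod>j\<in>UNIV. if i = a \<and> j = b then c else 1) = (if i = a then c else 1)" for i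
    by (cases "i = a") simp_all
  then show ?thesis by simp
qed

lemma prod_prod_monomial:
  fixes f :: "'c \<Rightarrow> 'b::comm_monoid_mult" and x :: "'c^'n^'m"
  shows "(\<Prod>i\<in>UNIV. \<Prod>j\<in>UNIV. if i = a \<and> j = b then f (x $ i $ j) else 1) = f (x $ a $ b)"
proof -
  have "(\<Prod>i\<in>UNIV. \<Prod>j\<in>UNIV. if i = a \<and> j = b then f (x $ i $ j) else 1)
      = (\<Prod>i\<in>UNIV. \<Prod>j\<in>UNIV. if i = a \<and> j = b then f (x $ a $ b) else 1)"
    by (intro prod.cong refl) auto
  then show ?thesis by (simp only: prod_prod_delta)
qed

lemma nn_integral_bart_diag:
  assumes a: "\<alpha> > -1" and g_def: "g = \<alpha> + 1 + real (rank_from_end ls k)"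
  shows "(\<integral>\<^sup>+t. ennreal t * bart_factor \<alpha> ls k k t \<partial>lborel) = ennreal g * (\<integral>\<^sup>+t. bart_factor \<alpha> ls k k t \<partial>lborel)"
    "(\<integral>\<^sup>+t. ennreal (t\<^sup>2) * bart_factor \<alpha> ls k k t \<partial>lborel) = ennreal (g * (g + 1)) * (\<integral>\<^sup>+t. bart_factor \<alpha> ls k k t \<partial>lborel)"
proof -
  have g: "g > 0" using a by (simp add: g_def)
  have G1: "Gamma (g + 1) = g * Gamma g"
    using g by (simp add: Gamma_plus1 nonpos_Ints_def)
  have "Gamma (g + 1 + 1) = (g + 1) * Gamma (g + 1)"
    using g by (intro Gamma_plus1) (auto elim!: nonpos_Ints_cases)
  then have G2: "Gamma (g + 1 + 1) = (g + 1) * (g * Gamma g)" unfolding G1 .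
  have f: "bart_factor \<alpha> ls k k t = (if 0 < t then ennreal (t powr (g - 1) * exp (- t)) else 0)" for t
    by (simp add: bart_factor_def g_def)
  have I: "(\<integral>\<^sup>+t. bart_factor \<alpha> ls k k t \<partial>lborel) = ennreal (Gamma g)"
    unfolding f using nn_integral_gamma_density[of "g - 1"] g by simp
  have "(\<integral>\<^sup>+t. ennreal t * bart_factor \<alpha> ls k k t \<partial>lborel) = (\<integral>\<^sup>+t. (if 0 < t then ennreal (t powr g * exp (- t)) else 0) \<partial>lborel)"
    unfolding f by (intro nn_integral_cong) (auto simp: ennreal_mult[symmetric] powr_diff)
  then show "(\<integral>\<^sup>+t. ennreal t * bart_factor \<alpha> ls k k t \<partial>lborel) = ennreal g * (\<integral>\<^sup>+t. bart_factor \<alpha> ls k k t \<partial>lborel)"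
    unfolding I using g nn_integral_gamma_density[of g] by (simp add: G1 ennreal_mult)
  have "(\<integral>\<^sup>+t. ennreal (t\<^sup>2) * bart_factor \<alpha> ls k k t \<partial>lborel) = (\<integral>\<^sup>+t. (if 0 < t then ennreal (t powr (g + 1) * exp (- t)) else 0) \<partial>lborel)"
    unfolding f by (intro nn_integral_cong) (auto simp: ennreal_mult[symmetric] powr_diff powr_add power2_eq_square)
  note eq2 = this
  show "(\<integral>\<^sup>+t. ennreal (t\<^sup>2) * bart_factor \<alpha> ls k k t \<partial>lborel) = ennreal (g * (g + 1)) * (\<integral>\<^sup>+t. bart_factor \<alpha> ls k k t \<partial>lborel)"
  proof -
    have "ennreal ((g + 1) * (g * Gamma g)) = ennreal (g * (g + 1)) * ennreal (Gamma g)"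
      using g by (subst ennreal_mult[symmetric]) (simp_all add: Gamma_real_pos less_imp_le mult_ac)
    moreover have "(\<integral>\<^sup>+t. (if 0 < t then ennreal (t powr (g + 1) * exp (- t)) else 0) \<partial>lborel) = ennreal ((g + 1) * (g * Gamma g))"
      unfolding G2[symmetric] using g by (intro nn_integral_gamma_density) simp
    ultimately show ?thesis unfolding I using eq2 by simp
  qed
qed

lemma nn_integral_bart_offdiag:
  assumes "i \<noteq> j"
  shows "(\<integral>\<^sup>+t. ennreal (t\<^sup>2) * bart_factor \<alpha> ls i j t \<partial>lborel) = ennreal (1 / 2) * (\<integral>\<^sup>+t. bart_factor \<alpha> ls i j t \<partial>lborel)"
proof -
  have "ennreal (sqrt pi / 2) = ennreal (1 / 2) * ennreal (sqrt pi)"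
    by (subst ennreal_mult[symmetric]) simp_all
  then show ?thesis
    using nn_integral_gauss_1[of 1] nn_integral_gauss_2[of 1] assms
    by (simp add: bart_factor_def flip: ennreal_mult)
qed

lemma rank_from_end_append: "k \<notin> set ks \<Longrightarrow> rank_from_end (ks @ k # ks') k = length ks'"
  by (induction ks) auto

text \<open>The elimination order for the moments of row \<open>k\<close>: the complement of \<open>K\<close>, then \<open>k\<close>, then the rest of \<open>K\<close>.\<close>

lemma pivot_order:
  fixes K :: "'p::finite set"
  assumes "k \<in> K"
  obtains ks ks' where "distinct (ks @ k # ks')" "set (ks @ k # ks') = UNIV" "insert k (set ks') = K"
    "1 + real (rank_from_end (ks @ k # ks') k) = real (card K)"
proof -
  obtain ks where ks: "set ks = - K" "distinct ks" using finite_distinct_list[of "- K"] by auto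
  obtain ks' where ks': "set ks' = K - {k}" "distinct ks'" using finite_distinct_list[of "K - {k}"] by auto
  have K: "insert k (set ks') = K" using ks' assms by auto
  have "card (insert k (set ks')) = Suc (length ks')"
  proof -
    have "k \<notin> set ks'" using ks'(1) by auto
    then show ?thesis using distinct_card[OF ks'(2)] by simp
  qed
  then have "card K = Suc (length ks')" by (simp only: K)
  then show thesis using ks ks' K assms
    by (intro that[of ks ks']) (auto simp: rank_from_end_append)
qed

text \<open>The diagonal entry is the pivot itself, a Gamma variable of shape \<open>\<alpha> + card K\<close>.\<close>

lemma nn_integral_schur_diag:
  fixes K :: "'p::finite set"
  assumes a: "\<alpha> > -1" and "k \<in> K"
  shows "(\<integral>\<^sup>+x. ennreal (Re (schur K (H x) $ k $ k)) * wish \<alpha> UNIV x \<partial>lborel)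
    = ennreal (\<alpha> + real (card K)) * ennreal (wishart_mass \<alpha> CARD('p))"
proof -
  obtain ks ks' where d: "distinct (ks @ k # ks')" "set (ks @ k # ks') = UNIV" and K: "insert k (set ks') = K"
    and r: "1 + real (rank_from_end (ks @ k # ks') k) = real (card K)"
    using pivot_order[OF \<open>k \<in> K\<close>] by metis
  let ?ls = "ks @ k # ks'" and ?\<nu> = "\<alpha> + real (card K)"
  have k: "k \<notin> set ks'" using d by simp
  have rk: "?\<nu> = \<alpha> + 1 + real (rank_from_end ?ls k)" using r by simp
  have "(\<integral>\<^sup>+x. ennreal (Re (schur K (H x) $ k $ k)) * wish \<alpha> UNIV x \<partial>lborel)
      = (\<integral>\<^sup>+x. ennreal (x $ k $ k) * bart \<alpha> {} ?ls x \<partial>lborel)"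
    unfolding K[symmetric] using k
    by (intro nn_integral_schur_row[where \<Psi>="\<lambda>M. ennreal (Re (M $ k $ k))"] d)
       (simp_all add: mix_nth emb_nth H_nth piv_kk)
  also have "\<dots> = (\<integral>\<^sup>+x. (\<Prod>i\<in>UNIV. \<Prod>j\<in>UNIV. if i = k \<and> j = k then ennreal (x $ i $ j) else 1) * bart \<alpha> {} ?ls x \<partial>lborel)"
  proof -
    have "(\<Prod>i\<in>UNIV. \<Prod>j\<in>UNIV. if i = k \<and> j = k then ennreal (x $ i $ j) else 1) = ennreal (x $ k $ k)" for x :: "real^'p^'p"
      by (rule prod_prod_monomial)
    then show ?thesis by simp
  qed
  also have "\<dots> = (\<Prod>i\<in>UNIV. \<Prod>j\<in>UNIV. if i = k \<and> j = k then ennreal ?\<nu> else 1) * (\<integral>\<^sup>+x. bart \<alpha> {} ?ls x \<partial>lborel)"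
    by (intro nn_integral_bart_monomial[where u="\<lambda>i j t. if i = k \<and> j = k then ennreal t else 1", OF d])
       (auto simp: nn_integral_bart_diag(1)[OF a rk])
  finally show ?thesis unfolding nn_integral_bart[OF d a] prod_prod_delta .
qed

text \<open>The row consists of the pivot \<open>t\<close> and of complex Gaussian variables multiplied by \<open>sqrt t\<close>; with \<open>\<nu>\<close> the shape of \<open>t\<close>,
  the mean is \<open>\<nu> * (\<nu> + 1)\<close> from the diagonal and \<open>\<nu>\<close> from every other entry.\<close>

lemma nn_integral_schur_row_norm:
  fixes K :: "'p::finite set"
  assumes a: "\<alpha> > -1" and "k \<in> K"
  shows "(\<integral>\<^sup>+x. ennreal (\<Sum>j\<in>K. (cmod (schur K (H x) $ k $ j))\<^sup>2) * wish \<alpha> UNIV x \<partial>lborel)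
    = ennreal ((\<alpha> + real (card K)) * (\<alpha> + 2 * real (card K))) * ennreal (wishart_mass \<alpha> CARD('p))"
proof -
  obtain ks ks' where d: "distinct (ks @ k # ks')" "set (ks @ k # ks') = UNIV" and K: "insert k (set ks') = K"
    and r: "1 + real (rank_from_end (ks @ k # ks') k) = real (card K)"
    using pivot_order[OF \<open>k \<in> K\<close>] by metis
  let ?ls = "ks @ k # ks'" and ?\<nu> = "\<alpha> + real (card K)"
  let ?B = "\<lambda>x. bart \<alpha> {} ?ls x" and ?C = "ennreal (wishart_mass \<alpha> CARD('p))"
  define \<Phi> :: "real^'p^'p \<Rightarrow> ennreal" where "\<Phi> x = ennreal ((x $ k $ k)\<^sup>2)
    + (\<Sum>j\<in>set ks'. ennreal (x $ k $ k) * ennreal ((x $ k $ j)\<^sup>2) + ennreal (x $ k $ k) * ennreal ((x $ j $ k)\<^sup>2))" for x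
  have [measurable]: "\<Phi> \<in> borel_measurable borel" unfolding \<Phi>_def by measurable
  have k: "k \<notin> set ks'" using d by simp
  have rk: "?\<nu> = \<alpha> + 1 + real (rank_from_end ?ls k)" using r by simp
  have nu: "?\<nu> > 0" using a rk by linarith
  have "ennreal (\<Sum>j\<in>K. (cmod (emb K (H (piv (set ks') k x)) $ k $ j))\<^sup>2) = \<Phi> x" if x: "0 < x $ k $ k" for x
  proof -
    have "(\<Sum>j\<in>K. (cmod (emb K (H (piv (set ks') k x)) $ k $ j))\<^sup>2)
        = (x $ k $ k)\<^sup>2 + (\<Sum>j\<in>set ks'. (cmod (H (piv (set ks') k x) $ k $ j))\<^sup>2)"
      unfolding K[symmetric] using k by (simp add: emb_nth H_nth[of _ k k] piv_kk)
    also have "(\<Sum>j\<in>set ks'. (cmod (H (piv (set ks') k x) $ k $ j))\<^sup>2)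
        = (\<Sum>j\<in>set ks'. x $ k $ k * (x $ k $ j)\<^sup>2 + x $ k $ k * (x $ j $ k)\<^sup>2)"
    proof (rule sum.cong[OF refl])
      fix j assume j: "j \<in> set ks'"
      then have "k \<noteq> j" using k by auto
      then show "(cmod (H (piv (set ks') k x) $ k $ j))\<^sup>2 = x $ k $ k * (x $ k $ j)\<^sup>2 + x $ k $ k * (x $ j $ k)\<^sup>2"
        using x by (simp add: H_piv_col[OF k j x] norm_mult power_mult_distrib H_cmod algebra_simps)
    qed
    finally show ?thesis
      using x by (simp add: \<Phi>_def ennreal_plus[symmetric] ennreal_mult[symmetric] sum_nonneg sum_ennreal del: ennreal_plus)
  qed
  then have "(\<integral>\<^sup>+x. ennreal (\<Sum>j\<in>K. (cmod (schur K (H x) $ k $ j))\<^sup>2) * wish \<alpha> UNIV x \<partial>lborel)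
      = (\<integral>\<^sup>+x. \<Phi> x * ?B x \<partial>lborel)"
    unfolding K[symmetric] using k
    by (intro nn_integral_schur_row[where \<Psi>="\<lambda>M. ennreal (\<Sum>j\<in>insert k (set ks'). (cmod (M $ k $ j))\<^sup>2)"] d)
       (simp_all add: mix_nth \<Phi>_def cong: sum.cong)
  also have "\<dots> = (\<integral>\<^sup>+x. ennreal ((x $ k $ k)\<^sup>2) * ?B x \<partial>lborel)
     + (\<Sum>j\<in>set ks'. (\<integral>\<^sup>+x. ennreal (x $ k $ k) * ennreal ((x $ k $ j)\<^sup>2) * ?B x \<partial>lborel)
         + (\<integral>\<^sup>+x. ennreal (x $ k $ k) * ennreal ((x $ j $ k)\<^sup>2) * ?B x \<partial>lborel))"
    unfolding \<Phi>_def distrib_right sum_distrib_right by (simp add: nn_integral_add nn_integral_sum)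
  also have "(\<integral>\<^sup>+x. ennreal ((x $ k $ k)\<^sup>2) * ?B x \<partial>lborel) = ennreal (?\<nu> * (?\<nu> + 1)) * ?C"
  proof -
    have "(\<Prod>i\<in>UNIV. \<Prod>j\<in>UNIV. if i = k \<and> j = k then ennreal ((x $ i $ j)\<^sup>2) else 1) = ennreal ((x $ k $ k)\<^sup>2)" for x :: "real^'p^'p"
      by (rule prod_prod_monomial[where f="\<lambda>t. ennreal (t\<^sup>2)"])
    then have "(\<integral>\<^sup>+x. ennreal ((x $ k $ k)\<^sup>2) * ?B x \<partial>lborel)
        = (\<integral>\<^sup>+x. (\<Prod>i\<in>UNIV. \<Prod>j\<in>UNIV. if i = k \<and> j = k then ennreal ((x $ i $ j)\<^sup>2) else 1) * ?B x \<partial>lborel)" by simp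
    also have "\<dots> = (\<Prod>i\<in>UNIV. \<Prod>j\<in>UNIV. if i = k \<and> j = k then ennreal (?\<nu> * (?\<nu> + 1)) else 1) * (\<integral>\<^sup>+x. ?B x \<partial>lborel)"
      by (intro nn_integral_bart_monomial[where u="\<lambda>i j t. if i = k \<and> j = k then ennreal (t\<^sup>2) else 1", OF d])
         (auto simp: nn_integral_bart_diag(2)[OF a rk])
    finally show ?thesis unfolding nn_integral_bart[OF d a] prod_prod_delta .
  qed
  also have "(\<Sum>j\<in>set ks'. (\<integral>\<^sup>+x. ennreal (x $ k $ k) * ennreal ((x $ k $ j)\<^sup>2) * ?B x \<partial>lborel)
         + (\<integral>\<^sup>+x. ennreal (x $ k $ k) * ennreal ((x $ j $ k)\<^sup>2) * ?B x \<partial>lborel))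
      = (\<Sum>j\<in>set ks'. ennreal ?\<nu> * ?C)"
  proof (rule sum.cong[OF refl])
    fix j assume "j \<in> set ks'"
    then have jk: "j \<noteq> k" using k by auto
    have one: "(\<integral>\<^sup>+x. ennreal (x $ k $ k) * ennreal ((x $ a $ b)\<^sup>2) * ?B x \<partial>lborel) = ennreal (?\<nu> / 2) * ?C"
      if ab: "a \<noteq> b" for a b
    proof -
      have "(\<Prod>i\<in>UNIV. \<Prod>j\<in>UNIV. (if i = k \<and> j = k then ennreal (x $ i $ j) else 1) * (if i = a \<and> j = b then ennreal ((x $ i $ j)\<^sup>2) else 1))
          = ennreal (x $ k $ k) * ennreal ((x $ a $ b)\<^sup>2)" for x :: "real^'p^'p"
        unfolding prod.distrib
        by (intro arg_cong2[where f="(*)"] prod_prod_monomial[where f=ennreal]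
            prod_prod_monomial[where f="\<lambda>t. ennreal (t\<^sup>2)"])
      then have "(\<integral>\<^sup>+x. ennreal (x $ k $ k) * ennreal ((x $ a $ b)\<^sup>2) * ?B x \<partial>lborel)
        = (\<integral>\<^sup>+x. (\<Prod>i\<in>UNIV. \<Prod>j\<in>UNIV. (if i = k \<and> j = k then ennreal (x $ i $ j) else 1) * (if i = a \<and> j = b then ennreal ((x $ i $ j)\<^sup>2) else 1)) * ?B x \<partial>lborel)"
        by simp
      also have "\<dots> = (\<Prod>i\<in>UNIV. \<Prod>j\<in>UNIV. (if i = k \<and> j = k then ennreal ?\<nu> else 1) * (if i = a \<and> j = b then ennreal (1/2) else 1)) * (\<integral>\<^sup>+x. ?B x \<partial>lborel)"
        using ab
        by (intro nn_integral_bart_monomial[where u="\<lambda>i j t. (if i = k \<and> j = k then ennreal t else 1) * (if i = a \<and> j = b then ennreal (t\<^sup>2) else 1)", OF d])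
           (auto simp: nn_integral_bart_diag(1)[OF a rk] nn_integral_bart_offdiag)
      finally have "(\<integral>\<^sup>+x. ennreal (x $ k $ k) * ennreal ((x $ a $ b)\<^sup>2) * ?B x \<partial>lborel) = (ennreal ?\<nu> * ennreal (1/2)) * ?C"
        unfolding nn_integral_bart[OF d \<open>\<alpha> > -1\<close>] prod.distrib prod_prod_delta .
      also have "ennreal ?\<nu> * ennreal (1/2) = ennreal (?\<nu> / 2)"
        using nu by (subst ennreal_mult[symmetric]) simp_all
      finally show ?thesis .
    qed
    show "(\<integral>\<^sup>+x. ennreal (x $ k $ k) * ennreal ((x $ k $ j)\<^sup>2) * ?B x \<partial>lborel)
         + (\<integral>\<^sup>+x. ennreal (x $ k $ k) * ennreal ((x $ j $ k)\<^sup>2) * ?B x \<partial>lborel) = ennreal ?\<nu> * ?C"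
      unfolding one[OF jk] one[OF jk[symmetric]] using nu by (simp add: distrib_right[symmetric] ennreal_plus[symmetric] del: ennreal_plus)
  qed
  also have "ennreal (?\<nu> * (?\<nu> + 1)) * ?C + (\<Sum>j\<in>set ks'. ennreal ?\<nu> * ?C)
      = ennreal (?\<nu> * (?\<nu> + 1) + ?\<nu> * real (card (set ks'))) * ?C"
  proof -
    have "ennreal (?\<nu> * (?\<nu> + 1) + ?\<nu> * real (card (set ks')))
        = ennreal (?\<nu> * (?\<nu> + 1)) + ennreal ?\<nu> * of_nat (card (set ks'))"
      unfolding ennreal_of_nat_eq_real_of_nat using nu
      by (subst ennreal_plus) (auto intro!: arg_cong2[where f="(+)"] ennreal_mult)
    moreover have "(A + B * c) * C = A * C + c * (B * C)" for A B c C :: ennreal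
      unfolding distrib_right by (simp only: mult_ac)
    ultimately show ?thesis unfolding sum_constant by simp
  qed
  also have "?\<nu> * (?\<nu> + 1) + ?\<nu> * real (card (set ks')) = ?\<nu> * (\<alpha> + 2 * real (card K))"
  proof -
    have "real (card K) = 1 + real (card (set ks'))" unfolding K[symmetric] using k by simp
    then show ?thesis by (simp add: algebra_simps)
  qed
  finally show ?thesis .
qed

lemma nn_integral_wish:
  assumes a: "\<alpha> > -1"
  shows "(\<integral>\<^sup>+x. wish \<alpha> UNIV (x::real^'p^'p) \<partial>lborel) = ennreal (wishart_mass \<alpha> CARD('p))"
proof -
  obtain ls :: "'p list" where ls: "set ls = UNIV" "distinct ls" using finite_distinct_list[of "UNIV :: 'p set"] by auto
  have "(\<integral>\<^sup>+x. 1 * 1 * wish \<alpha> (set ls \<union> {}) x \<partial>lborel) = (\<integral>\<^sup>+x. 1 * bart \<alpha> {} ls x * 1 * wish \<alpha> {} x \<partial>lborel)"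
    using ls by (intro nn_integral_wish_eliminate[where \<phi>="\<lambda>_. 1" and \<psi>="\<lambda>_. 1"]) auto
  then show ?thesis using nn_integral_bart[OF ls(2,1) a] by (simp add: ls)
qed

section \<open>Transformations of the normal and Wishart distributions\<close>

lemma jac_matrix_diagonal:
  fixes C :: "'m::finite \<Rightarrow> 'n::finite \<Rightarrow> real"
  assumes C: "\<And>i j. C i j \<noteq> 0"
  shows "jac (\<lambda>x::'a::euclidean_space^'n^'m. \<chi> i j. C i j *\<^sub>R x $ i $ j)
    = 1 / (\<Prod>i\<in>UNIV. \<Prod>j\<in>UNIV. \<bar>C i j\<bar> ^ DIM('a))"
proof -
  define h where "h b = (SOME ij. \<exists>u\<in>Basis. b = axis (fst ij) (axis (snd ij) (u::'a)))" for b :: "'a^'n^'m"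
  have h: "h (axis i (axis j u)) = (i, j)" if "u \<in> Basis" for i j u
    unfolding h_def using that by (intro some_equality) (auto simp: axis_eq_axis nonzero_Basis)
  let ?c = "\<lambda>b. C (fst (h b)) (snd (h b))"
  have "(\<Sum>b\<in>Basis. (?c b * (x \<bullet> b)) *\<^sub>R b) = (\<chi> i j. C i j *\<^sub>R x $ i $ j)" for x :: "'a^'n^'m"
  proof (rule euclidean_eqI)
    fix b :: "'a^'n^'m" assume b: "b \<in> Basis"
    then obtain i j u where u: "b = axis i (axis j u)" "u \<in> Basis" by (auto simp: Basis_vec_def)
    have "(\<Sum>b\<in>Basis. (?c b * (x \<bullet> b)) *\<^sub>R b) \<bullet> b = ?c b * (x \<bullet> b)"
      using b by (simp add: inner_sum_left inner_Basis if_distrib cong: if_cong)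
    then show "(\<Sum>b\<in>Basis. (?c b * (x \<bullet> b)) *\<^sub>R b) \<bullet> b = (\<chi> i j. C i j *\<^sub>R x $ i $ j) \<bullet> b"
      by (simp add: u h inner_axis)
  qed
  then have "jac (\<lambda>x::'a^'n^'m. \<chi> i j. C i j *\<^sub>R x $ i $ j) = 1 / (\<Prod>b\<in>Basis. \<bar>?c b\<bar>)"
    using jac_diagonal[of ?c, OF C] by simp
  also have "(\<Prod>b\<in>Basis. \<bar>?c b\<bar>) = (\<Prod>i\<in>UNIV. \<Prod>j\<in>UNIV. \<bar>C i j\<bar> ^ DIM('a))"
    by (simp add: prod_Basis_vec h cong: prod.cong)
  finally show ?thesis .
qed

lemma bij_right_mult:
  fixes A :: "complex^'n^'n"
  assumes "invertible A"
  shows "bij (\<lambda>Z :: complex^'n^'m. Z ** ctranspose A)"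
proof (rule bij_betw_byWitness[where f'="\<lambda>Z. Z ** ctranspose (matrix_inv A)"])
  show "\<forall>Z\<in>UNIV. Z ** ctranspose A ** ctranspose (matrix_inv A) = Z"
    "\<forall>Z\<in>UNIV. Z ** ctranspose (matrix_inv A) ** ctranspose A = Z"
    by (simp_all add: matrix_mul_assoc[symmetric] ctranspose_mult[symmetric] matrix_inv[OF assms])
qed auto

lemma linear_right_mult: "linear (\<lambda>Z :: complex^'n^'m. Z ** B)"
  by (rule linearI) (simp_all add: matrix_distribs)

lemma jac_right_mult:
  fixes A :: "complex^'n^'n"
  assumes A: "A \<in> pivot_matrices"
  shows "jac (\<lambda>Z :: complex^'n^'m. Z ** ctranspose A) = 1 / cmod (det A) ^ (2 * CARD('m))"
proof (rule character_pivot_matrices[where \<phi>="\<lambda>A. jac (\<lambda>Z :: complex^'n^'m. Z ** ctranspose A)", OF _ _ _ A])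
  fix A B :: "complex^'n^'n" assume A: "invertible A" and B: "invertible B"
  have "(\<lambda>Z :: complex^'n^'m. Z ** ctranspose (A ** B)) = (\<lambda>Z. Z ** ctranspose B ** ctranspose A)"
    by (simp add: ctranspose_mult matrix_mul_assoc)
  then show "jac (\<lambda>Z :: complex^'n^'m. Z ** ctranspose (A ** B))
      = jac (\<lambda>Z :: complex^'n^'m. Z ** ctranspose A) * jac (\<lambda>Z :: complex^'n^'m. Z ** ctranspose B)"
    using jac_compose[OF linear_right_mult bij_right_mult[OF A] linear_right_mult bij_right_mult[OF B]] by simp
next
  fix A :: "complex^'n^'n" assume A: "invertible A"
  show "jac (\<lambda>Z :: complex^'n^'m. Z ** ctranspose A) \<noteq> 0"
    using jac_pos[OF linear_right_mult bij_right_mult[OF A]] by (metis less_irrefl)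
next
  fix k :: 'n and r :: real assume r: "0 < r"
  have eq: "(\<lambda>Z :: complex^'n^'m. Z ** ctranspose (col_scale k r)) = (\<lambda>Z. \<chi> i j. (if j = k then r else 1) *\<^sub>R Z $ i $ j)"
    by (auto simp: fun_eq_iff vec_eq_iff mult_ctranspose_col_scale scaleR_conv_of_real)
  have "(\<Prod>j\<in>(UNIV::'n set). \<bar>if j = k then r else 1\<bar> ^ DIM(complex)) = (\<Prod>j\<in>(UNIV::'n set). if j = k then r ^ 2 else 1)"
    using r by (intro prod.cong) auto
  then show "jac (\<lambda>Z :: complex^'n^'m. Z ** ctranspose (col_scale k r)) = 1 / r ^ (2 * CARD('m))"
    unfolding eq using r by (subst jac_matrix_diagonal) (simp_all add: power_mult)
qed

text \<open>The congruence by \<open>A\<close> in the real coordinates of Hermitian matrices. It preserves the range of \<open>H\<close>, so \<open>inv H\<close> is a true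
  inverse here.\<close>

definition conj_coords :: "complex^'p^'p \<Rightarrow> real^'p^'p \<Rightarrow> real^'p^'p" where
  "conj_coords A x = inv H (A ** H x ** ctranspose A)"

lemma inj_H: "inj H"
  by (rule bij_betw_imp_inj_on[OF bij_betw_hermitian_of_coords])

lemma H_conj_coords: "H (conj_coords A x) = A ** H x ** ctranspose A"
proof -
  have "hermitian (A ** H x ** ctranspose A)"
    using hermitian_hermitian_of_coords[of x]
    by (simp add: hermitian_def ctranspose_mult matrix_mul_assoc)
  then have "A ** H x ** ctranspose A \<in> range H"
    unfolding bij_betw_imp_surj_on[OF bij_betw_hermitian_of_coords] by simp
  then show ?thesis unfolding conj_coords_def by (rule f_inv_into_f)
qed

lemma H_add: "H (x + y) = H x + H y"
  by (auto simp: vec_eq_iff H_nth complex_eq_iff)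

lemma H_scaleR: "H (c *\<^sub>R x) = c *\<^sub>R H x"
  by (auto simp: vec_eq_iff H_nth complex_eq_iff)

lemma linear_conj_coords: "linear (conj_coords A)"
  by (rule linearI; rule injD[OF inj_H])
     (simp_all add: H_conj_coords H_add H_scaleR matrix_distribs)

lemma conj_coords_mult: "conj_coords (A ** B) x = conj_coords A (conj_coords B x)"
  by (rule injD[OF inj_H]) (simp add: H_conj_coords ctranspose_mult matrix_mul_assoc)

lemma conj_coords_1: "conj_coords (mat 1) x = x"
  by (rule injD[OF inj_H]) (simp add: H_conj_coords)

lemma bij_conj_coords:
  assumes "invertible A"
  shows "bij (conj_coords A)"
  by (rule bij_betw_byWitness[where f'="conj_coords (matrix_inv A)"])
     (simp_all add: conj_coords_mult[symmetric] matrix_inv[OF assms] conj_coords_1)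

lemma jac_conj_coords:
  fixes A :: "complex^'p^'p"
  assumes A: "A \<in> pivot_matrices"
  shows "jac (conj_coords A) = 1 / cmod (det A) ^ (2 * CARD('p))"
proof (rule character_pivot_matrices[where \<phi>="\<lambda>A. jac (conj_coords A)", OF _ _ _ A])
  fix A B :: "complex^'p^'p" assume A: "invertible A" and B: "invertible B"
  show "jac (conj_coords (A ** B)) = jac (conj_coords A) * jac (conj_coords B)"
    using jac_compose[OF linear_conj_coords bij_conj_coords[OF A] linear_conj_coords bij_conj_coords[OF B]]
    by (simp add: conj_coords_mult[abs_def])
next
  fix A :: "complex^'p^'p" assume A: "invertible A"
  show "jac (conj_coords A) \<noteq> 0"
    using jac_pos[OF linear_conj_coords bij_conj_coords[OF A]] by (metis less_irrefl)
next
  fix k :: 'p and r :: real assume r: "0 < r"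
  let ?c = "\<lambda>i j. (if i = k then r else 1) * (if j = k then r else 1)"
  have eq: "conj_coords (col_scale k r) = (\<lambda>x. \<chi> i j. ?c i j *\<^sub>R x $ i $ j)"
  proof (rule ext, rule injD[OF inj_H])
    fix x
    have "(col_scale k r ** H x ** ctranspose (col_scale k r)) $ i $ j = of_real (?c i j) * H x $ i $ j" for i j
      by (simp add: mult_ctranspose_col_scale col_scale_mult)
    moreover have "H (\<chi> i j. ?c i j *\<^sub>R x $ i $ j) $ i $ j = of_real (?c i j) * H x $ i $ j" for i j
      by (simp add: H_nth complex_eq_iff)
    ultimately show "H (conj_coords (col_scale k r) x) = H (\<chi> i j. ?c i j *\<^sub>R x $ i $ j)"
      unfolding vec_eq_iff H_conj_coords by simp
  qed
  have "(\<Prod>i\<in>UNIV. \<Prod>j\<in>UNIV. \<bar>?c i j\<bar> ^ DIM(real)) = (\<Prod>i\<in>UNIV. \<Prod>j\<in>UNIV. ?c i j)"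
    using r by (intro prod.cong refl) auto
  also have "\<dots> = r ^ (2 * CARD('p))"
    by (simp add: prod.distrib mult_2 power_add flip: prod_power_distrib)
  finally have c: "(\<Prod>i\<in>UNIV. \<Prod>j\<in>UNIV. \<bar>?c i j\<bar> ^ DIM(real)) = r ^ (2 * CARD('p))" .
  show "jac (conj_coords (col_scale k r)) = 1 / r ^ (2 * CARD('p))"
    unfolding eq c[symmetric] using r by (intro jac_matrix_diagonal) simp
qed

lemma sum_diag_H: "(\<Sum>i\<in>UNIV. x $ i $ i) = Re (trace (H x))"
  by (simp add: trace_def H_nth)

lemma trace_conj: "trace (A ** M ** ctranspose A) = trace (M ** (ctranspose A ** A))"
  for A M :: "complex^'n^'n"
  by (metis matrix_mul_assoc trace_mul_sym)

lemma pos_def_H_conj: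
  assumes "invertible A"
  shows "pos_def (H (conj_coords A x)) \<longleftrightarrow> pos_def (H x)"
  unfolding H_conj_coords by (rule pos_def_congruence_iff[OF assms])

lemma det_H_conj: "Re (det (H (conj_coords A x))) = (cmod (det A))\<^sup>2 * Re (det (H x))"
proof -
  have "det (H (conj_coords A x)) = (det A * cnj (det A)) * det (H x)"
    by (simp add: H_conj_coords det_mul det_ctranspose)
  also have "\<dots> = of_real ((cmod (det A))\<^sup>2) * det (H x)" by (simp only: complex_norm_square)
  finally show ?thesis by (simp del: of_real_power)
qed

lemma wish_UNIV: "wish \<alpha> UNIV x = (if pos_def (H x)
    then ennreal (Re (det (H x)) powr \<alpha> * exp (- Re (trace (H x)))) else 0)"
  by (simp add: wish_def sum_diag_H)

lemma wish_conj:
  assumes "invertible A"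
  shows "wish \<alpha> UNIV (conj_coords A x) = (if pos_def (H x)
    then ennreal (cmod (det A) powr (2 * \<alpha>) * (Re (det (H x)) powr \<alpha> * exp (- Re (trace (H x ** (ctranspose A ** A)))))) else 0)"
proof -
  have "0 < cmod (det A)" using assms by (simp add: invertible_det_nz)
  then have "((cmod (det A))\<^sup>2 * Re (det (H x))) powr \<alpha> = cmod (det A) powr (2 * \<alpha>) * Re (det (H x)) powr \<alpha>"
    if "pos_def (H x)"
    using pos_def_det[OF that] by (auto simp: powr_mult powr_powr simp flip: powr_numeral)
  then show ?thesis
    by (simp add: wish_UNIV pos_def_H_conj[OF assms] det_H_conj, simp add: H_conj_coords trace_conj mult_ac)
qed

lemma cmod_det_unitary:
  fixes U :: "complex^'p^'p"
  assumes U: "ctranspose U ** U = mat 1"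
  shows "cmod (det U) = 1"
proof -
  have "complex_of_real ((cmod (det U))\<^sup>2) = 1"
    unfolding complex_norm_square
    using arg_cong[OF U, of det] by (simp add: det_mul det_ctranspose mult.commute)
  then have "(cmod (det U))\<^sup>2 = 1" by (simp only: of_real_eq_1_iff)
  then have "cmod (det U) = 1 \<or> cmod (det U) = - 1" by (simp only: power2_eq_1_iff)
  then show ?thesis using norm_ge_zero[of "det U"] by linarith
qed

lemma wish_unitary:
  assumes U: "ctranspose U ** U = mat 1"
  shows "wish \<alpha> UNIV (conj_coords U x) = wish \<alpha> UNIV x"
proof -
  have i: "invertible U" using U invertible_left_inverse by blast
  show ?thesis
    by (simp add: wish_conj[OF i] U cmod_det_unitary[OF U]) (simp add: wish_UNIV)
qed

text \<open>Unitary maps preserve Lebesgue measure on Hermitian matrices, because they leave invariant a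
  function with finite nonzero integral, namely the standard Wishart density.\<close>

lemma jac_unitary:
  fixes U :: "complex^'p^'p"
  assumes U: "ctranspose U ** U = mat 1"
  shows "jac (conj_coords U) = 1"
proof -
  have i: "invertible U" using U invertible_left_inverse by blast
  show ?thesis
  proof (rule jac_eq_1I[where f="wish 0 UNIV", OF linear_conj_coords bij_conj_coords[OF i]])
    show "wish 0 UNIV (conj_coords U x) = wish 0 UNIV x" for x
      by (rule wish_unitary[OF U])
    show "(\<integral>\<^sup>+y. wish 0 UNIV (y::real^'p^'p) \<partial>lborel) \<noteq> 0" "(\<integral>\<^sup>+y. wish 0 UNIV (y::real^'p^'p) \<partial>lborel) \<noteq> \<infinity>"
      using wishart_mass_pos[of 0 "CARD('p)"] by (simp_all add: nn_integral_wish)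
  qed simp
qed

lemma nn_integral_hermitian_lebesgue:
  "f \<in> borel_measurable borel \<Longrightarrow> (\<integral>\<^sup>+s. f s \<partial>hermitian_lebesgue) = (\<integral>\<^sup>+x. f (H x) \<partial>lborel)"
  unfolding hermitian_lebesgue_def by (simp add: nn_integral_distr)

lemma sets_hermitian_lebesgue [measurable_cong, simp]: "sets hermitian_lebesgue = sets borel"
  by (simp add: hermitian_lebesgue_def)

lemma sets_cwishart [measurable_cong, simp]: "sets (cwishart \<Sigma> n) = sets borel"
  by (simp add: cwishart_def)

lemma space_cwishart [simp]: "space (cwishart \<Sigma> n) = UNIV"
  using sets_eq_imp_space_eq[OF sets_cwishart] by simp

lemma sets_cnormal [measurable_cong, simp]: "sets (cnormal \<Xi> \<Sigma>) = sets borel"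
  by (simp add: cnormal_def)

lemma space_cnormal [simp]: "space (cnormal \<Xi> \<Sigma>) = UNIV"
  using sets_eq_imp_space_eq[OF sets_cnormal] by simp

text \<open>Reverses the order of the Gamma factors.\<close>

lemma wishart_constant:
  "pi ^ (CARD('p::finite) * (CARD('p) - 1) div 2) * (\<Prod>k = 1..CARD('p). Gamma (n + 1 - real k))
    = wishart_mass (n - real CARD('p)) CARD('p)" for n :: real
proof -
  let ?p = "CARD('p)"
  have "(\<Prod>k = 1..?p. Gamma (n + 1 - real k)) = (\<Prod>r<?p. Gamma (n - real ?p + 1 + real r))"
    by (rule prod.reindex_bij_witness[of _ "\<lambda>r. ?p - r" "\<lambda>k. ?p - k"])
       (auto simp: of_nat_diff intro!: arg_cong[where f=Gamma])
  then show ?thesis by (simp add: wishart_mass_def)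
qed

lemma measurable_pos_def [measurable]: "Measurable.pred borel pos_def"
  by (simp add: pred_def)

lemma nn_integral_cwishart:
  fixes \<Sigma> :: "complex^'p^'p"
  assumes [measurable]: "f \<in> borel_measurable borel"
  shows "(\<integral>\<^sup>+s. f s \<partial>cwishart \<Sigma> n) = (\<integral>\<^sup>+x. (if pos_def (H x) then ennreal
     (Re (det (H x)) powr (n - real CARD('p)) * exp (- Re (trace (H x ** matrix_inv \<Sigma>)))
      / (Re (det \<Sigma>) powr n * wishart_mass (n - real CARD('p)) CARD('p))) else 0) * f (H x) \<partial>lborel)"
  unfolding cwishart_def mult.assoc wishart_constant[where 'p='p]
  by (subst nn_integral_density) (simp_all add: nn_integral_hermitian_lebesgue)

lemma nn_integral_cwishart_1:
  assumes n: "n > real CARD('p::finite) - 1" and [measurable]: "f \<in> borel_measurable borel"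
  shows "(\<integral>\<^sup>+s. f s \<partial>cwishart (mat 1 :: complex^'p^'p) n)
    = ennreal (1 / wishart_mass (n - real CARD('p)) CARD('p)) * (\<integral>\<^sup>+x. f (H x) * wish (n - real CARD('p)) UNIV x \<partial>lborel)"
proof -
  let ?m = "wishart_mass (n - real CARD('p)) CARD('p)"
  have "?m > 0" using n by (intro wishart_mass_pos) simp
  then have "ennreal (r / (Re (det (mat 1 :: complex^'p^'p)) powr n * ?m)) = ennreal (1 / ?m) * ennreal r" for r
    by (subst ennreal_mult'[symmetric]) simp_all
  note c = this
  have "(if pos_def (H x) then ennreal
     (Re (det (H x)) powr (n - real CARD('p)) * exp (- Re (trace (H x ** matrix_inv (mat 1))))
      / (Re (det (mat 1 :: complex^'p^'p)) powr n * ?m)) else 0)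
     = ennreal (1 / ?m) * wish (n - real CARD('p)) UNIV x" for x :: "real^'p^'p"
    unfolding wish_UNIV c by simp
  then show ?thesis
    by (simp add: nn_integral_cwishart nn_integral_cmult[symmetric] mult_ac)
qed

text \<open>\<open>A\<close> stands for an inverse square root of \<open>\<Sigma>\<close>.\<close>

lemma congruent_to_1_inv_det:
  fixes \<Sigma> A :: "complex^'p^'p"
  assumes i: "invertible A" and A: "A ** \<Sigma> ** ctranspose A = mat 1"
  shows "matrix_inv \<Sigma> = ctranspose A ** A" "Re (det \<Sigma>) = 1 / (cmod (det A))\<^sup>2"
proof -
  let ?d = "cmod (det A)"
  have d: "?d > 0" using i by (simp add: invertible_det_nz)
  have "\<Sigma> ** (ctranspose A ** A) = matrix_inv A ** (A ** \<Sigma> ** ctranspose A) ** A"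
    by (simp add: matrix_mul_assoc matrix_inv[OF i])
  then have S: "\<Sigma> ** (ctranspose A ** A) = mat 1" by (simp add: A matrix_inv[OF i])
  show "matrix_inv \<Sigma> = ctranspose A ** A" by (rule matrix_inv_unique(2)[OF S])
  have "det \<Sigma> * (cnj (det A) * det A) = 1" using arg_cong[OF S, of det] by (simp add: det_mul det_ctranspose)
  then have "det \<Sigma> * of_real (?d\<^sup>2) = 1" unfolding complex_norm_square by (simp add: mult.commute)
  then have "det \<Sigma> = of_real (1 / ?d\<^sup>2)" using d by (simp add: field_simps)
  then show "Re (det \<Sigma>) = 1 / ?d\<^sup>2" by (simp only: Re_complex_of_real)
qed

text \<open>The powers of \<open>det A\<close> in the density and in the Jacobian of the congruence cancel against the power of \<open>det \<Sigma>\<close>.\<close>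

lemma nn_integral_cwishart_transform:
  fixes \<Sigma> A :: "complex^'p^'p"
  assumes n: "n > real CARD('p) - 1" and A: "A \<in> pivot_matrices" "A ** \<Sigma> ** ctranspose A = mat 1"
    and [measurable]: "f \<in> borel_measurable borel"
  shows "(\<integral>\<^sup>+s. f (A ** s ** ctranspose A) \<partial>cwishart \<Sigma> n) = (\<integral>\<^sup>+s. f s \<partial>cwishart (mat 1) n)"
proof -
  let ?p = "CARD('p)" and ?\<alpha> = "n - real CARD('p)"
  let ?m = "wishart_mass ?\<alpha> ?p" and ?d = "cmod (det A)"
  have m: "?m > 0" using n by (intro wishart_mass_pos) simp
  note i = pivot_matrices_invertible[OF A(1)]
  have d: "?d > 0" using i by (simp add: invertible_det_nz)
  note inv = congruent_to_1_inv_det(1)[OF i A(2)] and det = congruent_to_1_inv_det(2)[OF i A(2)]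
  have "?d\<^sup>2 = ?d powr 2" using d by simp
  then have "(?d\<^sup>2) powr n = ?d powr (2 * n)" by (simp only: powr_powr)
  then have detn: "1 / Re (det \<Sigma>) powr n = ?d powr (2 * n)"
    unfolding det by (simp add: powr_divide)
  have dd: "?d powr (2 * n) = ?d ^ (2 * ?p) * ?d powr (2 * ?\<alpha>)"
    using d by (simp add: powr_realpow[symmetric] powr_add[symmetric] algebra_simps)
  have [measurable]: "(\<lambda>x. f (H x) * wish ?\<alpha> UNIV x) \<in> borel_measurable borel" by measurable
  have "(\<integral>\<^sup>+s. f (A ** s ** ctranspose A) \<partial>cwishart \<Sigma> n)
      = (\<integral>\<^sup>+x. ennreal (?d ^ (2 * ?p) / ?m) * (f (H (conj_coords A x)) * wish ?\<alpha> UNIV (conj_coords A x)) \<partial>lborel)"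
  proof -
    have "(if pos_def (H x) then ennreal (Re (det (H x)) powr ?\<alpha> * exp (- Re (trace (H x ** matrix_inv \<Sigma>)))
      / (Re (det \<Sigma>) powr n * ?m)) else 0) = ennreal (?d ^ (2 * ?p) / ?m) * wish ?\<alpha> UNIV (conj_coords A x)" for x
    proof -
      have "r * e / (Re (det \<Sigma>) powr n * ?m) = ?d ^ (2 * ?p) / ?m * (?d powr (2 * ?\<alpha>) * (r * e))" for r e
      proof -
        have "r * e / (Re (det \<Sigma>) powr n * ?m) = (1 / Re (det \<Sigma>) powr n) * (r * e) / ?m" by simp
        then show ?thesis unfolding detn dd by simp
      qed
      note h = this
      show ?thesis
      proof (cases "pos_def (H x)")
        case True
        show ?thesis unfolding wish_conj[OF i] inv h if_P[OF True]
          using m by (intro ennreal_mult') simp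
      qed (simp add: wish_conj[OF i])
    qed
    then have "(\<integral>\<^sup>+s. f (A ** s ** ctranspose A) \<partial>cwishart \<Sigma> n)
      = (\<integral>\<^sup>+x. (ennreal (?d ^ (2 * ?p) / ?m) * wish ?\<alpha> UNIV (conj_coords A x)) * f (A ** H x ** ctranspose A) \<partial>lborel)"
      by (subst nn_integral_cwishart) simp_all
    then show "(\<integral>\<^sup>+s. f (A ** s ** ctranspose A) \<partial>cwishart \<Sigma> n)
      = (\<integral>\<^sup>+x. ennreal (?d ^ (2 * ?p) / ?m) * (f (H (conj_coords A x)) * wish ?\<alpha> UNIV (conj_coords A x)) \<partial>lborel)"
      by (simp add: H_conj_coords mult_ac)
  qed
  also have "\<dots> = ennreal (jac (conj_coords A)) * (\<integral>\<^sup>+x. ennreal (?d ^ (2 * ?p) / ?m) * (f (H x) * wish ?\<alpha> UNIV x) \<partial>lborel)"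
    by (rule nn_integral_linear[OF linear_conj_coords bij_conj_coords[OF i],
        where f="\<lambda>x. ennreal (?d ^ (2 * ?p) / ?m) * (f (H x) * wish ?\<alpha> UNIV x)"]) measurable
  also have "\<dots> = (ennreal (1 / ?d ^ (2 * ?p)) * ennreal (?d ^ (2 * ?p) / ?m)) * (\<integral>\<^sup>+x. f (H x) * wish ?\<alpha> UNIV x \<partial>lborel)"
    by (subst nn_integral_cmult) (simp_all add: jac_conj_coords[OF A(1)] mult.assoc)
  also have "ennreal (1 / ?d ^ (2 * ?p)) * ennreal (?d ^ (2 * ?p) / ?m) = ennreal (1 / ?m)"
    using d m by (subst ennreal_mult[symmetric]) simp_all
  finally show ?thesis using nn_integral_cwishart_1[OF n, of f] by simp
qed

lemma nn_integral_cwishart_unitary: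
  fixes U :: "complex^'p^'p"
  assumes n: "n > real CARD('p) - 1" and U: "ctranspose U ** U = mat 1"
    and [measurable]: "f \<in> borel_measurable borel"
  shows "(\<integral>\<^sup>+s. f (U ** s ** ctranspose U) \<partial>cwishart (mat 1) n) = (\<integral>\<^sup>+s. f s \<partial>cwishart (mat 1) n)"
proof -
  have i: "invertible U" using U invertible_left_inverse by blast
  let ?\<alpha> = "n - real CARD('p)"
  note w = wish_unitary[OF U, of ?\<alpha>]
  have "(\<integral>\<^sup>+x. f (H (conj_coords U x)) * wish ?\<alpha> UNIV (conj_coords U x) \<partial>lborel)
      = ennreal (jac (conj_coords U)) * (\<integral>\<^sup>+x. f (H x) * wish ?\<alpha> UNIV x \<partial>lborel)"
    by (rule nn_integral_linear[OF linear_conj_coords bij_conj_coords[OF i],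
        where f="\<lambda>x. f (H x) * wish ?\<alpha> UNIV x"]) measurable
  then show ?thesis
    by (simp add: nn_integral_cwishart_1[OF n] jac_unitary[OF U] w H_conj_coords)
qed

lemma prob_space_cwishart_1:
  assumes n: "n > real CARD('p::finite) - 1"
  shows "prob_space (cwishart (mat 1 :: complex^'p^'p) n)"
proof (rule prob_spaceI)
  let ?m = "wishart_mass (n - real CARD('p)) CARD('p)"
  have m: "?m > 0" using n by (intro wishart_mass_pos) simp
  have "(\<integral>\<^sup>+s. 1 \<partial>cwishart (mat 1 :: complex^'p^'p) n) = ennreal (1 / ?m) * ennreal ?m"
    using nn_integral_cwishart_1[OF n, of "\<lambda>_. 1"] n by (simp add: nn_integral_wish)
  also have "\<dots> = 1" using m by (simp flip: ennreal_mult)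
  finally show "emeasure (cwishart (mat 1 :: complex^'p^'p) n) (space (cwishart (mat 1 :: complex^'p^'p) n)) = 1"
    by simp
qed

lemma AE_cwishart_pos_def: "AE s in cwishart \<Sigma> n. pos_def s"
  unfolding cwishart_def by (subst AE_density) (auto intro!: AE_I2)

section \<open>Moments of Schur complements of a Wishart matrix\<close>

lemma trace_pos_def_mult_nonneg:
  fixes N F :: "complex^'n^'n"
  assumes "pos_def N" "pos_def F"
  shows "0 \<le> Re (trace (N ** F))"
proof -
  obtain C :: "complex^'n^'n" where C: "N = C ** ctranspose C" using pos_def_factor[OF assms(1)] by metis
  obtain B :: "complex^'n^'n" where B: "F = B ** ctranspose B" using pos_def_factor[OF assms(2)] by metis
  have "trace (N ** F) = trace (C ** (ctranspose C ** B ** ctranspose B))"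
    by (simp add: C B matrix_mul_assoc)
  also have "\<dots> = trace (ctranspose (ctranspose B ** C) ** (ctranspose B ** C))"
    by (subst trace_mul_sym) (simp add: ctranspose_mult matrix_mul_assoc)
  also have "Re \<dots> = (ctranspose B ** C) \<bullet> (ctranspose B ** C)" by (simp add: inner_matrix_trace)
  finally show ?thesis by simp
qed

lemma pos_def_entry_bound:
  fixes M :: "complex^'n^'n"
  assumes "pos_def M"
  shows "cmod (M $ a $ b) \<le> Re (M $ a $ a) + Re (M $ b $ b)"
proof -
  obtain B :: "complex^'n^'n" where B: "M = B ** ctranspose B" using pos_def_factor[OF assms] by metis
  have d: "Re (M $ i $ i) = (\<Sum>c\<in>UNIV. (cmod (B $ i $ c))\<^sup>2)" for i
    by (simp add: B matrix_matrix_mult_def cmod_power2, simp add: power2_eq_square)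
  have "cmod (M $ a $ b) \<le> (\<Sum>c\<in>UNIV. cmod (B $ a $ c) * cmod (B $ b $ c))"
    unfolding B matrix_matrix_mult_def by (simp, rule order_trans[OF norm_sum]) (simp add: norm_mult)
  also have "\<dots> \<le> (\<Sum>c\<in>UNIV. (cmod (B $ a $ c))\<^sup>2 + (cmod (B $ b $ c))\<^sup>2)"
  proof (rule sum_mono)
    fix c show "cmod (B $ a $ c) * cmod (B $ b $ c) \<le> (cmod (B $ a $ c))\<^sup>2 + (cmod (B $ b $ c))\<^sup>2"
      using sum_squares_bound[of "cmod (B $ a $ c)" "cmod (B $ b $ c)"]
        mult_nonneg_nonneg[of "cmod (B $ a $ c)" "cmod (B $ b $ c)"]
      unfolding mult.assoc by (simp del: mult_nonneg_nonneg)
  qed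
  finally show ?thesis by (simp add: d sum.distrib)
qed

lemma pos_def_diag_real: "pos_def M \<Longrightarrow> M $ a $ a = complex_of_real (Re (M $ a $ a))"
  using pos_def_hermitian[of M] by (metis Reals_cnj_iff complex_is_Real_iff ctranspose_nth of_real_Re)

lemma pos_def_square: "pos_def T \<Longrightarrow> pos_def (T ** T)"
  using pos_def_congruence_iff[of T "mat 1"] pos_def_hermitian[of T] pos_def_invertible[of T] by simp

text \<open>The restriction of vectors to the coordinates in the range of \<open>e\<close>.\<close>

definition sel :: "('k \<Rightarrow> 'p) \<Rightarrow> complex^'p^'k" where
  "sel e = (\<chi> a j. if j = e a then 1 else 0)"

lemma sel_mult: "(sel e ** M) $ a $ j = M $ e a $ j"
proof -
  have "(sel e ** M) $ a $ j = (\<Sum>l\<in>UNIV. if l = e a then M $ e a $ j else 0)"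
    unfolding matrix_matrix_mult_def vec_lambda_beta by (rule sum.cong) (auto simp: sel_def)
  then show ?thesis by simp
qed

lemma mult_ctranspose_sel: "(M ** ctranspose (sel e)) $ i $ a = M $ i $ e a"
proof -
  have "M ** ctranspose (sel e) = ctranspose (sel e ** ctranspose M)" by (simp add: ctranspose_mult)
  then show ?thesis by (simp add: sel_mult)
qed

lemma sel_inj_ker: "ctranspose (sel e) *v x = 0 \<Longrightarrow> x = 0" if "inj e"
proof -
  assume 0: "ctranspose (sel e) *v x = 0"
  have "x $ a = (ctranspose (sel e) *v x) $ e a" for a
  proof -
    have "(ctranspose (sel e) *v x) $ e a = (\<Sum>b\<in>UNIV. if b = a then x $ a else 0)"
      unfolding matrix_vector_mult_def vec_lambda_beta
      by (rule sum.cong) (use \<open>inj e\<close> in \<open>auto simp: sel_def inj_eq\<close>)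
    then show ?thesis by simp
  qed
  then show "x = 0" by (simp add: 0 vec_eq_iff)
qed

text \<open>\<open>schur\<close> without padding, as a matrix of the smaller size.\<close>

definition block_schur :: "('k \<Rightarrow> 'p) \<Rightarrow> complex^'p^'p \<Rightarrow> complex^'k^'k" where
  "block_schur e S = matrix_inv (sel e ** matrix_inv S ** ctranspose (sel e))"

lemma measurable_block_schur [measurable (raw)]:
  "f \<in> borel_measurable M \<Longrightarrow> (\<lambda>x. block_schur e (f x)) \<in> borel_measurable M"
  unfolding block_schur_def by (intro measurable_matrix_inv measurable_matrix_mult borel_measurable_const)

lemma pos_def_sel:
  assumes "inj e" "pos_def S"
  shows "pos_def (sel e ** S ** ctranspose (sel e))"
  using pos_def_congruence[of S "ctranspose (sel e)"] sel_inj_ker[OF assms(1)] assms(2) by simp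

lemma pos_def_block_schur: "inj e \<Longrightarrow> pos_def S \<Longrightarrow> pos_def (block_schur e S)"
  unfolding block_schur_def by (intro pos_def_matrix_inv pos_def_sel)

lemma block_schur_nth:
  fixes e :: "'k::finite \<Rightarrow> 'p::finite"
  assumes e: "inj e" and S: "pos_def S"
  shows "block_schur e S $ a $ b = schur (range e) S $ e a $ e b"
proof -
  let ?K = "range e"
  let ?X = "emb ?K (matrix_inv S)"
  define Y where "Y = schur ?K S"
  have X: "pos_def ?X" by (intro pos_def_emb pos_def_matrix_inv S)
  have Y: "Y = matrix_inv ?X" by (simp add: Y_def schur_def)
  have XE: "sel e ** matrix_inv S ** ctranspose (sel e) = sel e ** ?X ** ctranspose (sel e)"
    by (simp add: vec_eq_iff sel_mult mult_ctranspose_sel emb_nth)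
  have "((sel e ** ?X ** ctranspose (sel e)) ** (sel e ** Y ** ctranspose (sel e))) $ a $ b = mat 1 $ a $ b" for a b
  proof -
    have "((sel e ** ?X ** ctranspose (sel e)) ** (sel e ** Y ** ctranspose (sel e))) $ a $ b
        = (\<Sum>c\<in>UNIV. ?X $ e a $ e c * Y $ e c $ e b)"
      unfolding matrix_matrix_mult_def[of "sel e ** ?X ** ctranspose (sel e)"] vec_lambda_beta
      by (simp add: sel_mult mult_ctranspose_sel)
    also have "\<dots> = (\<Sum>l\<in>?K. ?X $ e a $ l * Y $ l $ e b)"
      by (simp add: sum.reindex[OF e])
    also have "\<dots> = (\<Sum>l\<in>UNIV. ?X $ e a $ l * Y $ l $ e b)"
      by (intro sum.mono_neutral_left) (auto simp: emb_nth mat_def)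
    also have "\<dots> = (?X ** Y) $ e a $ e b" by (simp add: matrix_matrix_mult_def)
    also have "\<dots> = mat 1 $ a $ b"
      by (simp add: Y matrix_inv[OF pos_def_invertible[OF X]]) (simp add: mat_def inj_eq[OF e])
    finally show ?thesis .
  qed
  then have "(sel e ** ?X ** ctranspose (sel e)) ** (sel e ** Y ** ctranspose (sel e)) = mat 1"
    by (simp add: vec_eq_iff)
  from matrix_inv_unique(2)[OF this] show ?thesis
    unfolding block_schur_def XE Y_def[symmetric] by (simp add: sel_mult mult_ctranspose_sel)
qed

lemma block_schur_id: "pos_def S \<Longrightarrow> block_schur (\<lambda>i. i) S = S"
proof -
  assume S: "pos_def S"
  have "sel (\<lambda>i. i) = (mat 1 :: complex^'a^'a)" by (simp add: vec_eq_iff sel_def mat_def)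
  then show ?thesis by (simp add: block_schur_def matrix_inv_matrix_inv pos_def_invertible[OF S])
qed

lemma nn_integral_block_schur_diag:
  fixes e :: "'k::finite \<Rightarrow> 'p::finite"
  assumes n: "n > real CARD('p) - 1" and e: "inj e"
  defines "\<nu> \<equiv> n - real CARD('p) + real CARD('k)"
  shows "(\<integral>\<^sup>+S. ennreal (Re (block_schur e S $ a $ a)) \<partial>cwishart (mat 1) n) = ennreal \<nu>"
    and "(\<integral>\<^sup>+S. ennreal (Re ((block_schur e S ** block_schur e S) $ a $ a)) \<partial>cwishart (mat 1) n)
      = ennreal (\<nu> * (\<nu> + real CARD('k)))"
proof -
  let ?\<alpha> = "n - real CARD('p)"
  let ?m = "wishart_mass ?\<alpha> CARD('p)"
  have m: "?m > 0" using n by (intro wishart_mass_pos) simp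
  have al: "?\<alpha> > -1" using n by simp
  have cK: "card (range e) = CARD('k)" using e by (simp add: card_image)
  have cancel: "ennreal (1 / ?m) * (x * ennreal ?m) = x" for x
  proof -
    have "ennreal (1 / ?m) * ennreal ?m = 1" using m by (simp flip: ennreal_mult)
    then show ?thesis by (simp add: mult.left_commute)
  qed
  have "(\<integral>\<^sup>+S. ennreal (Re (block_schur e S $ a $ a)) \<partial>cwishart (mat 1) n)
      = ennreal (1 / ?m) * (\<integral>\<^sup>+x. ennreal (Re (schur (range e) (H x) $ e a $ e a)) * wish ?\<alpha> UNIV x \<partial>lborel)"
  proof -
    have "ennreal (Re (block_schur e (H x) $ a $ a)) * wish ?\<alpha> UNIV x
        = ennreal (Re (schur (range e) (H x) $ e a $ e a)) * wish ?\<alpha> UNIV x" for x :: "real^'p^'p"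
      by (cases "pos_def (H x)") (simp_all add: wish_UNIV block_schur_nth[OF e])
    then show ?thesis by (subst nn_integral_cwishart_1[OF n]) simp_all
  qed
  then show "(\<integral>\<^sup>+S. ennreal (Re (block_schur e S $ a $ a)) \<partial>cwishart (mat 1) n) = ennreal \<nu>"
    unfolding nn_integral_schur_diag[OF al rangeI] cancel by (simp add: cK \<nu>_def)
  have sq: "Re ((block_schur e S ** block_schur e S) $ a $ a) = (\<Sum>j\<in>range e. (cmod (schur (range e) S $ e a $ j))\<^sup>2)"
    if S: "pos_def S" for S
  proof -
    let ?T = "block_schur e S"
    have "Re ((?T ** ?T) $ a $ a) = (\<Sum>b\<in>UNIV. (cmod (?T $ a $ b))\<^sup>2)"
    proof -
      have "?T $ b $ a = cnj (?T $ a $ b)" for b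
        using pos_def_hermitian[OF pos_def_block_schur[OF e S]] by (metis ctranspose_nth)
      then show ?thesis by (simp add: matrix_matrix_mult_def cmod_power2, simp add: power2_eq_square)
    qed
    then show ?thesis by (simp add: block_schur_nth[OF e S] sum.reindex[OF e])
  qed
  have "(\<integral>\<^sup>+S. ennreal (Re ((block_schur e S ** block_schur e S) $ a $ a)) \<partial>cwishart (mat 1) n)
      = ennreal (1 / ?m) * (\<integral>\<^sup>+x. ennreal (\<Sum>j\<in>range e. (cmod (schur (range e) (H x) $ e a $ j))\<^sup>2) * wish ?\<alpha> UNIV x \<partial>lborel)"
  proof -
    have "ennreal (Re ((block_schur e (H x) ** block_schur e (H x)) $ a $ a)) * wish ?\<alpha> UNIV x
        = ennreal (\<Sum>j\<in>range e. (cmod (schur (range e) (H x) $ e a $ j))\<^sup>2) * wish ?\<alpha> UNIV x" for x :: "real^'p^'p"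
      by (cases "pos_def (H x)") (simp_all add: wish_UNIV sq)
    then show ?thesis by (subst nn_integral_cwishart_1[OF n]) simp_all
  qed
  then show "(\<integral>\<^sup>+S. ennreal (Re ((block_schur e S ** block_schur e S) $ a $ a)) \<partial>cwishart (mat 1) n)
      = ennreal (\<nu> * (\<nu> + real CARD('k)))"
    unfolding nn_integral_schur_row_norm[OF al rangeI] cancel by (simp add: cK \<nu>_def algebra_simps)
qed

lemma ctranspose_flip: "ctranspose (col_scale k (-1)) = (col_scale k (-1) :: complex^'l^'l)"
  by (auto simp: vec_eq_iff col_scale_def)

lemma flip_flip: "col_scale k (-1) ** col_scale k (-1) = (mat 1 :: complex^'l^'l)"
  by (simp add: vec_eq_iff col_scale_mult) (simp add: col_scale_def mat_def)

lemma block_schur_flip: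
  fixes e :: "'k::finite \<Rightarrow> 'p::finite"
  assumes e: "inj e" and S: "pos_def S"
  shows "block_schur e (col_scale (e a) (-1) ** S ** ctranspose (col_scale (e a) (-1)))
    = col_scale a (-1) ** block_schur e S ** ctranspose (col_scale a (-1))"
proof -
  let ?D = "col_scale (e a) (-1)" and ?D' = "col_scale a (-1) :: complex^'k^'k"
  note inv = matrix_inv_unique[OF flip_flip]
  have ED: "sel e ** ?D = ?D' ** sel e"
  proof -
    have "(sel e ** ?D) $ i $ j = (?D' ** sel e) $ i $ j" for i j
      using e by (auto simp: sel_mult col_scale_mult) (auto simp: col_scale_def sel_def inj_eq)
    then show ?thesis by (simp add: vec_eq_iff)
  qed
  have ED': "?D ** ctranspose (sel e) = ctranspose (sel e) ** ?D'"
    using arg_cong[OF ED, of ctranspose] by (simp add: ctranspose_mult ctranspose_flip)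
  have "sel e ** matrix_inv (?D ** S ** ctranspose ?D) ** ctranspose (sel e)
      = (sel e ** ?D) ** matrix_inv S ** (?D ** ctranspose (sel e))"
    using pos_def_invertible[OF S] by (simp add: inv ctranspose_flip matrix_inv_mult invertible_mult matrix_mul_assoc)
  also have "\<dots> = ?D' ** (sel e ** matrix_inv S ** ctranspose (sel e)) ** ?D'"
    unfolding ED ED' by (simp add: matrix_mul_assoc)
  finally have eq: "sel e ** matrix_inv (?D ** S ** ctranspose ?D) ** ctranspose (sel e)
      = ?D' ** (sel e ** matrix_inv S ** ctranspose (sel e)) ** ?D'" .
  have "matrix_inv (?D' ** W ** ?D') = ?D' ** matrix_inv W ** ?D'" if "invertible W" for W
    using that by (simp add: inv matrix_inv_mult invertible_mult matrix_mul_assoc)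
  then show ?thesis
    unfolding block_schur_def eq unfolding ctranspose_flip
    using pos_def_invertible[OF pos_def_sel[OF e pos_def_matrix_inv[OF S]]] by blast
qed

text \<open>Sign changes of a coordinate preserve the standard Wishart law, so the off-diagonal entries of an
  equivariant function of the Schur complement have mean zero.\<close>

lemma nn_integral_trace_equivariant:
  fixes e :: "'k::finite \<Rightarrow> 'p::finite" and F :: "complex^'k^'k \<Rightarrow> complex^'k^'k" and N :: "complex^'k^'k"
  assumes n: "n > real CARD('p) - 1" and e: "inj e" and [measurable]: "F \<in> borel_measurable borel"
    and F: "\<And>T. pos_def T \<Longrightarrow> pos_def (F T)"
    and equiv: "\<And>T a. F (col_scale a (-1) ** T ** ctranspose (col_scale a (-1)))
      = col_scale a (-1) ** F T ** ctranspose (col_scale a (-1))"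
    and diag: "\<And>a. (\<integral>\<^sup>+S. ennreal (Re (F (block_schur e S) $ a $ a)) \<partial>cwishart (mat 1) n) = ennreal \<mu>"
    and mu: "\<mu> \<ge> 0" and N: "pos_def N"
  shows "(\<integral>\<^sup>+S. ennreal (Re (trace (N ** F (block_schur e S)))) \<partial>cwishart (mat 1) n) = ennreal (\<mu> * Re (trace N))"
proof -
  let ?P = "cwishart (mat 1 :: complex^'p^'p) n"
  let ?X = "\<lambda>S. F (block_schur e S)"
  interpret prob_space ?P by (rule prob_space_cwishart_1[OF n])
  have AEpd: "AE S in ?P. pos_def S" by (rule AE_cwishart_pos_def)
  have Xpd: "AE S in ?P. pos_def (?X S)"
    using AEpd by eventually_elim (intro F pos_def_block_schur e)
  have Re_int: "integrable ?P (\<lambda>S. Re (?X S $ a $ a)) \<and> integral\<^sup>L ?P (\<lambda>S. Re (?X S $ a $ a)) = \<mu>" for a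
  proof -
    have "AE S in ?P. 0 \<le> Re (?X S $ a $ a)"
      using Xpd by eventually_elim (intro less_imp_le pos_def_diag)
    then have "has_bochner_integral ?P (\<lambda>S. Re (?X S $ a $ a)) \<mu>"
      using mu by (intro has_bochner_integral_nn_integral diag) simp_all
    then show ?thesis by (simp add: has_bochner_integral_iff)
  qed
  have int: "integrable ?P (\<lambda>S. ?X S $ a $ b)" for a b
  proof (rule Bochner_Integration.integrable_bound)
    show "integrable ?P (\<lambda>S. Re (?X S $ a $ a) + Re (?X S $ b $ b))" using Re_int by simp
    show "AE S in ?P. cmod (?X S $ a $ b) \<le> norm (Re (?X S $ a $ a) + Re (?X S $ b $ b))"
      using Xpd by eventually_elim (rule order_trans[OF pos_def_entry_bound], assumption, simp)
  qed simp
  have dg: "integral\<^sup>L ?P (\<lambda>S. ?X S $ a $ a) = of_real \<mu>" for a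
  proof -
    have "integral\<^sup>L ?P (\<lambda>S. ?X S $ a $ a) = integral\<^sup>L ?P (\<lambda>S. of_real (Re (?X S $ a $ a)))"
    proof (rule integral_cong_AE)
      show "AE S in ?P. ?X S $ a $ a = of_real (Re (?X S $ a $ a))"
        using Xpd by eventually_elim (rule pos_def_diag_real)
    qed simp_all
    then show ?thesis using Re_int[of a] by simp
  qed
  have off: "integral\<^sup>L ?P (\<lambda>S. ?X S $ a $ b) = 0" if ab: "a \<noteq> b" for a b
  proof -
    let ?D = "col_scale (e a) (-1) :: complex^'p^'p"
    have U: "ctranspose ?D ** ?D = mat 1" unfolding ctranspose_flip by (rule flip_flip)
    have inv: "distr ?P borel (\<lambda>S. ?D ** S ** ctranspose ?D) = ?P"
    proof (rule measure_eqI)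
      fix A assume "A \<in> sets (distr ?P borel (\<lambda>S. ?D ** S ** ctranspose ?D))"
      then have A: "A \<in> sets borel" by simp
      have "emeasure (distr ?P borel (\<lambda>S. ?D ** S ** ctranspose ?D)) A = (\<integral>\<^sup>+S. indicator A S \<partial>distr ?P borel (\<lambda>S. ?D ** S ** ctranspose ?D))"
        using A by simp
      also have "\<dots> = (\<integral>\<^sup>+S. indicator A (?D ** S ** ctranspose ?D) \<partial>?P)"
        using A by (subst nn_integral_distr) simp_all
      also have "\<dots> = (\<integral>\<^sup>+S. indicator A S \<partial>?P)"
        using A by (intro nn_integral_cwishart_unitary n U) simp
      finally show "emeasure (distr ?P borel (\<lambda>S. ?D ** S ** ctranspose ?D)) A = emeasure ?P A"
        using A by simp
    qed simp
    have "integral\<^sup>L ?P (\<lambda>S. ?X S $ a $ b) = integral\<^sup>L (distr ?P borel (\<lambda>S. ?D ** S ** ctranspose ?D)) (\<lambda>S. ?X S $ a $ b)"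
      by (simp only: inv)
    also have "\<dots> = integral\<^sup>L ?P (\<lambda>S. ?X (?D ** S ** ctranspose ?D) $ a $ b)"
      by (rule integral_distr) simp_all
    also have "\<dots> = integral\<^sup>L ?P (\<lambda>S. - ?X S $ a $ b)"
    proof (rule integral_cong_AE)
      show "AE S in ?P. ?X (?D ** S ** ctranspose ?D) $ a $ b = - ?X S $ a $ b"
        using AEpd by eventually_elim
          (use ab in \<open>simp add: block_schur_flip[OF e] equiv col_scale_mult mult_ctranspose_col_scale\<close>)
    qed simp_all
    finally show ?thesis by simp
  qed
  have tr: "trace (N ** ?X S) = (\<Sum>a\<in>UNIV. \<Sum>b\<in>UNIV. N $ a $ b * ?X S $ b $ a)" for S
    by (simp add: trace_def matrix_matrix_mult_def)
  have tint: "integrable ?P (\<lambda>S. trace (N ** ?X S))" unfolding tr by (intro Bochner_Integration.integrable_sum integrable_mult_right int)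
  have "integral\<^sup>L ?P (\<lambda>S. trace (N ** ?X S)) = (\<Sum>a\<in>UNIV. \<Sum>b\<in>UNIV. N $ a $ b * integral\<^sup>L ?P (\<lambda>S. ?X S $ b $ a))"
    unfolding tr by (simp add: int)
  also have "\<dots> = (\<Sum>a\<in>UNIV. \<Sum>b\<in>UNIV. if b = a then N $ a $ a * of_real \<mu> else 0)"
    by (intro sum.cong refl) (auto simp: dg off)
  also have "\<dots> = of_real \<mu> * trace N" by (simp add: trace_def sum_distrib_left mult.commute)
  finally have "integral\<^sup>L ?P (\<lambda>S. Re (trace (N ** ?X S))) = \<mu> * Re (trace N)"
    using tint by (simp add: integral_Re)
  moreover have "AE S in ?P. 0 \<le> Re (trace (N ** ?X S))"
    using Xpd by eventually_elim (intro trace_pos_def_mult_nonneg N)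
  ultimately show ?thesis using tint by (subst nn_integral_eq_integral) auto
qed

text \<open>The first two moments of the Schur complement \<open>T\<close> are \<open>E T = \<nu>\<close> and \<open>E (T ** T) = \<nu> * (\<nu> + k)\<close> times the identity, tested
  against a positive definite matrix to avoid integrability questions.\<close>

lemma nn_integral_trace_block_schur:
  fixes e :: "'k::finite \<Rightarrow> 'p::finite" and N :: "complex^'k^'k"
  assumes n: "n > real CARD('p) - 1" and e: "inj e" and N: "pos_def N"
  defines "\<nu> \<equiv> n - real CARD('p) + real CARD('k)"
  shows "(\<integral>\<^sup>+S. ennreal (Re (trace (N ** block_schur e S))) \<partial>cwishart (mat 1) n) = ennreal (\<nu> * Re (trace N))"
    and "(\<integral>\<^sup>+S. ennreal (Re (trace (N ** (block_schur e S ** block_schur e S)))) \<partial>cwishart (mat 1) n)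
      = ennreal (\<nu> * (\<nu> + real CARD('k)) * Re (trace N))"
proof -
  have k: "real CARD('k) \<ge> 1" by simp
  have nu: "\<nu> \<ge> 0" unfolding \<nu>_def using n k by linarith
  have D: "ctranspose (col_scale a (-1)) ** col_scale a (-1) = (mat 1 :: complex^'k^'k)" for a :: 'k
    unfolding ctranspose_flip by (rule flip_flip)
  have DD: "(D' ** T ** ctranspose D') ** (D' ** T ** ctranspose D') = D' ** T ** (ctranspose D' ** D') ** T ** ctranspose D'"
    for D' T :: "complex^'k^'k" by (simp add: matrix_mul_assoc)
  have equiv: "(col_scale a (-1) ** T ** ctranspose (col_scale a (-1))) ** (col_scale a (-1) ** T ** ctranspose (col_scale a (-1)))
      = col_scale a (-1) ** (T ** T) ** ctranspose (col_scale a (-1))" for a :: 'k and T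
    unfolding DD D by (simp add: matrix_mul_assoc)
  show "(\<integral>\<^sup>+S. ennreal (Re (trace (N ** block_schur e S))) \<partial>cwishart (mat 1) n) = ennreal (\<nu> * Re (trace N))"
    using nn_integral_block_schur_diag(1)[OF n e]
    by (intro nn_integral_trace_equivariant[OF n e, where F="\<lambda>T. T"] nu N) (simp_all add: \<nu>_def)
  show "(\<integral>\<^sup>+S. ennreal (Re (trace (N ** (block_schur e S ** block_schur e S)))) \<partial>cwishart (mat 1) n)
      = ennreal (\<nu> * (\<nu> + real CARD('k)) * Re (trace N))"
    using nn_integral_block_schur_diag(2)[OF n e] nu
    by (intro nn_integral_trace_equivariant[OF n e, where F="\<lambda>T. T ** T"] N pos_def_square)
       (simp_all add: \<nu>_def equiv)
qed

text \<open>Completion of orthonormal rows to a unitary matrix, one row at a time: as long as a row is missing, the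
  square matrix padded with zero rows has a nontrivial kernel.\<close>

lemma unitary_completion:
  fixes Y :: "complex^'p^'k" and e :: "'k::finite \<Rightarrow> 'p::finite"
  assumes Y: "Y ** ctranspose Y = mat 1" and e: "inj e"
  obtains U :: "complex^'p^'p" where "U ** ctranspose U = mat 1" "Y = sel e ** U"
proof -
  have entry: "(U ** ctranspose U) $ i $ j = (\<Sum>l\<in>UNIV. U $ i $ l * cnj (U $ j $ l))" for U :: "complex^'p^'q" and i j
    by (simp add: matrix_matrix_mult_def)
  have "\<exists>U. (\<forall>a. U $ e a = Y $ a) \<and> (\<forall>i\<in>range e \<union> A. \<forall>j\<in>range e \<union> A. (U ** ctranspose U) $ i $ j = mat 1 $ i $ j)"
    if "finite A" "A \<inter> range e = {}" for A
    using that
  proof (induction A)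
    case empty
    let ?U = "\<chi> i. if i \<in> range e then Y $ (inv e i) else 0"
    have 1: "?U $ e a = Y $ a" for a using e by simp
    have "(?U ** ctranspose ?U) $ e a $ e b = mat 1 $ e a $ e b" for a b
    proof -
      have "(?U ** ctranspose ?U) $ e a $ e b = (Y ** ctranspose Y) $ a $ b" unfolding entry 1 ..
      then show ?thesis using e by (simp add: Y) (simp add: mat_def inj_eq)
    qed
    with 1 show ?case by (intro exI[of _ ?U]) auto
  next
    case (insert k A)
    then have "A \<inter> range e = {}" by auto
    from insert.IH[OF this] obtain U where "(\<forall>a. U $ e a = Y $ a) \<and>
        (\<forall>i\<in>range e \<union> A. \<forall>j\<in>range e \<union> A. (U ** ctranspose U) $ i $ j = mat 1 $ i $ j)" by (rule exE)
    then have U1: "\<And>a. U $ e a = Y $ a"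
      and U2: "\<And>i j. i \<in> range e \<union> A \<Longrightarrow> j \<in> range e \<union> A \<Longrightarrow> (U ** ctranspose U) $ i $ j = mat 1 $ i $ j" by blast+
    let ?J = "range e \<union> A"
    have k: "k \<notin> ?J" using insert by auto
    define V where "V = (\<chi> i. if i \<in> ?J then U $ i else 0)"
    have "\<not> invertible V"
    proof
      assume "invertible V"
      then have "(V ** matrix_inv V) $ k $ k = 1" by (simp add: matrix_inv) (simp add: mat_def)
      moreover have "(V ** matrix_inv V) $ k $ k = 0" using k by (simp add: matrix_matrix_mult_def V_def)
      ultimately show False by simp
    qed
    then obtain x where x: "V *v x = 0" "x \<noteq> 0" by (auto simp: invertible_iff_ker)
    define u where "u = (1 / norm x) *\<^sub>R x"
    have u1: "norm u = 1" using x by (simp add: u_def)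
    have Vu: "(\<Sum>l\<in>UNIV. U $ i $ l * u $ l) = 0" if "i \<in> ?J" for i
    proof -
      have "(\<Sum>l\<in>UNIV. U $ i $ l * u $ l) = (1 / norm x) *\<^sub>R (V *v x) $ i"
        using that by (simp add: V_def u_def matrix_vector_mult_def scaleR_right.sum)
      then show ?thesis by (simp add: x)
    qed
    have uu: "(\<Sum>l\<in>UNIV. cnj (u $ l) * u $ l) = 1"
    proof -
      have "(norm u)\<^sup>2 = (\<Sum>l\<in>UNIV. (cmod (u $ l))\<^sup>2)"
        by (simp add: norm_vec_def L2_set_def sum_nonneg)
      then have "complex_of_real (\<Sum>l\<in>UNIV. (cmod (u $ l))\<^sup>2) = 1" using u1 by simp
      then show ?thesis unfolding of_real_sum complex_norm_square by (simp add: mult.commute)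
    qed
    define U' where "U' = (\<chi> i. if i = k then (\<chi> j. cnj (u $ j)) else U $ i)"
    have nk: "U' $ i = U $ i" if "i \<noteq> k" for i using that by (simp add: U'_def)
    have kk: "U' $ k $ l = cnj (u $ l)" for l by (simp add: U'_def)
    have "(U' ** ctranspose U') $ i $ j = mat 1 $ i $ j" if ij: "i \<in> insert k ?J" "j \<in> insert k ?J" for i j
    proof -
      consider "i = k" "j = k" | "i = k" "j \<in> ?J" "j \<noteq> k" | "i \<in> ?J" "j = k" "i \<noteq> k" | "i \<in> ?J" "j \<in> ?J" "i \<noteq> k" "j \<noteq> k"
        using ij k by blast
      then show ?thesis
      proof cases
        case 1 then show ?thesis unfolding entry by (simp add: kk uu) (simp add: mat_def)
      next
        case 2
        have "(\<Sum>l\<in>UNIV. cnj (u $ l) * cnj (U $ j $ l)) = cnj (\<Sum>l\<in>UNIV. U $ j $ l * u $ l)" by (simp add: mult.commute)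
        then show ?thesis unfolding entry using 2 Vu[OF 2(2)] by (simp add: kk nk) (simp add: mat_def)
      next
        case 3
        then show ?thesis unfolding entry using Vu[OF 3(1)] by (simp add: kk nk) (simp add: mat_def)
      next
        case 4
        then show ?thesis using U2[OF 4(1,2)] unfolding entry by (simp add: nk)
      qed
    qed
    moreover have "U' $ e a = Y $ a" for a using k by (metis U1 UnI1 nk rangeI)
    ultimately show ?case by (intro exI[of _ U']) auto
  qed
  from this[of "- range e"] obtain U where U: "\<And>a. U $ e a = Y $ a" "U ** ctranspose U = mat 1"
    by (auto simp: vec_eq_iff[of "_ ** _"] vec_eq_iff[of "(_ ** _) $ _"])
  moreover have "Y = sel e ** U" by (simp add: vec_eq_iff sel_mult U(1))
  ultimately show thesis by (intro that)
qed

text \<open>Factor \<open>Z = T ** Y\<close> with \<open>T\<close> invertible and orthonormal rows of \<open>Y\<close>, and complete \<open>Y\<close> to a unitary matrix. Since the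
  law of \<open>S\<close> is unitarily invariant, \<open>Y\<close> may be taken to be a coordinate restriction, where \<open>V S\<close> is congruent to a
  Schur complement by \<open>matrix_inv T\<close>.\<close>

lemma nn_integral_cwishart_compression:
  fixes Z :: "complex^'p^'k" and e :: "'k::finite \<Rightarrow> 'p::finite"
  assumes n: "n > real CARD('p) - 1" and e: "inj e" and Z: "pos_def (Z ** ctranspose Z)"
  defines "\<nu> \<equiv> n - real CARD('p) + real CARD('k)" and "V \<equiv> \<lambda>S. matrix_inv (Z ** matrix_inv S ** ctranspose Z)"
  shows "(\<integral>\<^sup>+S. ennreal (Re (trace (V S))) \<partial>cwishart (mat 1) n) = ennreal (\<nu> * Re (trace (matrix_inv (Z ** ctranspose Z))))"
    and "(\<integral>\<^sup>+S. ennreal (Re (trace (V S ** (Z ** ctranspose Z) ** V S))) \<partial>cwishart (mat 1) n)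
      = ennreal (\<nu> * (\<nu> + real CARD('k)) * Re (trace (matrix_inv (Z ** ctranspose Z))))"
proof -
  obtain T :: "complex^'k^'k" where T: "invertible T" "Z ** ctranspose Z = T ** ctranspose T"
    using pos_def_factor[OF Z] by metis
  let ?T' = "matrix_inv T"
  define Y where "Y = ?T' ** Z"
  note iT = matrix_inv[OF T(1)]
  have "Y ** ctranspose Y = ?T' ** (Z ** ctranspose Z) ** ctranspose ?T'"
    by (simp add: Y_def ctranspose_mult matrix_mul_assoc)
  also have "\<dots> = (?T' ** T) ** ctranspose (?T' ** T)" by (simp add: T ctranspose_mult matrix_mul_assoc)
  finally have YY: "Y ** ctranspose Y = mat 1" by (simp add: iT)
  obtain U :: "complex^'p^'p" where U: "U ** ctranspose U = mat 1" "Y = sel e ** U" using unitary_completion[OF YY e] by metis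
  have U': "ctranspose U ** U = mat 1" using U(1) by (simp add: matrix_left_right_inverse)
  have TY: "Z = T ** Y" by (simp add: Y_def matrix_mul_assoc iT)
  define N where "N = ?T' ** ctranspose ?T'"
  have "pos_def (?T' ** mat 1 ** ctranspose ?T')"
    using pos_def_congruence_iff[OF invertible_matrix_inv[OF T(1)], of "mat 1"] by simp
  then have N: "pos_def N" by (simp add: N_def)
  have ZZ: "matrix_inv (Z ** ctranspose Z) = ctranspose ?T' ** ?T'"
    using T by (simp add: matrix_inv_mult invertible_ctranspose matrix_inv_ctranspose)
  have trN: "trace N = trace (matrix_inv (Z ** ctranspose Z))"
    unfolding ZZ N_def by (rule trace_mul_sym)
  have V: "V S = ctranspose ?T' ** block_schur e (U ** S ** ctranspose U) ** ?T'" if S: "pos_def S" for S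
  proof -
    have iS: "matrix_inv (U ** S ** ctranspose U) = U ** matrix_inv S ** ctranspose U"
    proof (rule matrix_inv_unique(2))
      have "U ** S ** ctranspose U ** (U ** matrix_inv S ** ctranspose U) = U ** S ** (ctranspose U ** U) ** matrix_inv S ** ctranspose U"
        by (simp add: matrix_mul_assoc)
      also have "\<dots> = U ** (S ** matrix_inv S) ** ctranspose U" by (simp add: U' matrix_mul_assoc)
      finally show "U ** S ** ctranspose U ** (U ** matrix_inv S ** ctranspose U) = mat 1"
        by (simp add: matrix_inv[OF pos_def_invertible[OF S]] U)
    qed
    let ?W = "sel e ** matrix_inv (U ** S ** ctranspose U) ** ctranspose (sel e)"
    have W: "?W = Y ** matrix_inv S ** ctranspose Y"
      unfolding iS U(2) by (simp add: ctranspose_mult matrix_mul_assoc)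
    have "pos_def (U ** S ** ctranspose U)" using pos_def_congruence_iff[of U S] S U invertible_right_inverse[of U] by blast
    then have iW: "invertible ?W" by (intro pos_def_invertible pos_def_sel e pos_def_matrix_inv)
    have "Z ** matrix_inv S ** ctranspose Z = T ** ?W ** ctranspose T"
      unfolding W TY by (simp add: ctranspose_mult matrix_mul_assoc)
    moreover have "matrix_inv (T ** W ** ctranspose T) = ctranspose ?T' ** matrix_inv W ** ?T'" if "invertible W" for W
      using that T(1)
      by (simp add: matrix_inv_mult invertible_mult invertible_ctranspose matrix_inv_ctranspose matrix_mul_assoc)
    ultimately show ?thesis
      unfolding V_def block_schur_def using iW by simp
  qed
  let ?B = "\<lambda>S. block_schur e (U ** S ** ctranspose U)"
  have "trace (V S) = trace (N ** ?B S)" if "pos_def S" for S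
    unfolding V[OF that] N_def by (subst trace_mul_sym) (simp add: matrix_mul_assoc)
  note tr = this
  have "(\<integral>\<^sup>+S. ennreal (Re (trace (V S))) \<partial>cwishart (mat 1) n) = (\<integral>\<^sup>+S. ennreal (Re (trace (N ** ?B S))) \<partial>cwishart (mat 1) n)"
  proof (rule nn_integral_cong_AE)
    show "AE S in cwishart (mat 1) n. ennreal (Re (trace (V S))) = ennreal (Re (trace (N ** ?B S)))"
      using AE_cwishart_pos_def by eventually_elim (simp add: tr)
  qed
  also have "\<dots> = (\<integral>\<^sup>+S. ennreal (Re (trace (N ** block_schur e S))) \<partial>cwishart (mat 1) n)"
    by (rule nn_integral_cwishart_unitary[OF n U', where f="\<lambda>S. ennreal (Re (trace (N ** block_schur e S)))"]) measurable
  finally show "(\<integral>\<^sup>+S. ennreal (Re (trace (V S))) \<partial>cwishart (mat 1) n) = ennreal (\<nu> * Re (trace (matrix_inv (Z ** ctranspose Z))))"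
    unfolding nn_integral_trace_block_schur(1)[OF n e N] trN \<nu>_def .
  have "trace (V S ** (Z ** ctranspose Z) ** V S) = trace (N ** (?B S ** ?B S))" if "pos_def S" for S
  proof -
    have "V S ** (Z ** ctranspose Z) ** V S = ctranspose ?T' ** ?B S ** (?T' ** T) ** ctranspose (?T' ** T) ** ?B S ** ?T'"
      unfolding V[OF that] T(2) by (simp add: ctranspose_mult matrix_mul_assoc)
    also have "\<dots> = (ctranspose ?T' ** ?B S ** ?B S) ** ?T'" by (simp add: iT)
    finally have eq: "V S ** (Z ** ctranspose Z) ** V S = (ctranspose ?T' ** ?B S ** ?B S) ** ?T'" .
    show ?thesis unfolding eq N_def by (subst trace_mul_sym) (simp add: matrix_mul_assoc)
  qed
  note tr = this
  have "(\<integral>\<^sup>+S. ennreal (Re (trace (V S ** (Z ** ctranspose Z) ** V S))) \<partial>cwishart (mat 1) n)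
      = (\<integral>\<^sup>+S. ennreal (Re (trace (N ** (?B S ** ?B S)))) \<partial>cwishart (mat 1) n)"
  proof (rule nn_integral_cong_AE)
    show "AE S in cwishart (mat 1) n. ennreal (Re (trace (V S ** (Z ** ctranspose Z) ** V S))) = ennreal (Re (trace (N ** (?B S ** ?B S))))"
      using AE_cwishart_pos_def by eventually_elim (simp add: tr)
  qed
  also have "\<dots> = (\<integral>\<^sup>+S. ennreal (Re (trace (N ** (block_schur e S ** block_schur e S)))) \<partial>cwishart (mat 1) n)"
    by (rule nn_integral_cwishart_unitary[OF n U', where f="\<lambda>S. ennreal (Re (trace (N ** (block_schur e S ** block_schur e S))))"]) measurable
  finally show "(\<integral>\<^sup>+S. ennreal (Re (trace (V S ** (Z ** ctranspose Z) ** V S))) \<partial>cwishart (mat 1) n)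
      = ennreal (\<nu> * (\<nu> + real CARD('k)) * Re (trace (matrix_inv (Z ** ctranspose Z))))"
    unfolding nn_integral_trace_block_schur(2)[OF n e N] trN \<nu>_def .
qed

section \<open>Stein's identity\<close>

lemma bounded_bilinear_matrix_mult: "bounded_bilinear ((**) :: complex^'n^'m \<Rightarrow> complex^'l^'n \<Rightarrow> complex^'l^'m)"
  unfolding bilinear_conv_bounded_bilinear[symmetric] bilinear_def
  by (auto intro!: linearI simp: matrix_distribs)

lemma has_vector_derivative_iff_quotient:
  "(f has_vector_derivative f') (at (0::real)) \<longleftrightarrow> ((\<lambda>t. (f t - f 0) /\<^sub>R t) \<longlongrightarrow> f') (at 0)"
proof -
  have "norm (f h - f 0 - h *\<^sub>R f') / norm h = norm ((f h - f 0) /\<^sub>R h - f')" if "h \<noteq> 0" for h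
  proof -
    have "(f h - f 0) /\<^sub>R h - f' = (f h - f 0 - h *\<^sub>R f') /\<^sub>R h" using that by (simp add: scaleR_diff_right)
    then show ?thesis using that by (simp add: divide_inverse mult.commute)
  qed
  then have "((\<lambda>h. norm (f (0 + h) - f 0 - h *\<^sub>R f') / norm h) \<longlongrightarrow> 0) (at 0)
      \<longleftrightarrow> ((\<lambda>h. norm ((f h - f 0) /\<^sub>R h - f')) \<longlongrightarrow> 0) (at 0)"
    by (intro filterlim_cong refl) (auto simp: eventually_at_filter)
  then show ?thesis
    by (simp add: has_vector_derivative_def has_derivative_at bounded_linear_scaleR_left tendsto_norm_zero_iff Lim_null[of "\<lambda>t. (f t - f 0) /\<^sub>R t"])
qed

text \<open>From \<open>M t - M 0 = - M t ** (A t - A 0) ** M 0\<close> for the inverses: boundedness of the inverses gives continuity, and continuity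
  gives the derivative.\<close>

lemma has_vector_derivative_matrix_inv:
  fixes A :: "real \<Rightarrow> complex^'n^'n"
  assumes A: "(A has_vector_derivative A') (at 0)" and inv: "\<And>t. invertible (A t)"
    and B: "\<And>t. norm (matrix_inv (A t)) \<le> B"
  shows "((\<lambda>t. matrix_inv (A t)) has_vector_derivative - (matrix_inv (A 0) ** A' ** matrix_inv (A 0))) (at 0)"
proof -
  interpret bounded_bilinear "(**) :: complex^'n^'n \<Rightarrow> complex^'n^'n \<Rightarrow> complex^'n^'n"
    by (rule bounded_bilinear_matrix_mult)
  let ?M = "\<lambda>t. matrix_inv (A t)"
  have diff: "?M t - ?M 0 = - (?M t ** (A t - A 0) ** ?M 0)" for t
    using matrix_inv[OF inv] by (simp add: matrix_distribs matrix_mul_assoc[symmetric])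
  have "\<exists>K>0. \<forall>(a :: complex^'n^'n) (b :: complex^'n^'n). norm (a ** b) \<le> norm a * norm b * K"
    by (rule bounded_bilinear.pos_bounded[OF bounded_bilinear_matrix_mult])
  then obtain K where K': "K > 0" "\<forall>(a :: complex^'n^'n) (b :: complex^'n^'n). norm (a ** b) \<le> norm a * norm b * K"
    by (elim exE conjE)
  note K = K'(1) K'(2)[rule_format]
  have "continuous (at 0) A" using A by (rule has_vector_derivative_continuous)
  then have A0: "((\<lambda>t. A t - A 0) \<longlongrightarrow> 0) (at 0)" by (simp add: continuous_at LIM_zero)
  have "((\<lambda>t. ?M t - ?M 0) \<longlongrightarrow> 0) (at 0)"
  proof (rule Lim_null_comparison)
    show "\<forall>\<^sub>F t in at 0. norm (?M t - ?M 0) \<le> B * norm (A t - A 0) * K * norm (?M 0) * K"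
    proof (rule always_eventually, rule allI)
      fix t
      have "norm (?M t - ?M 0) \<le> norm (?M t ** (A t - A 0)) * norm (?M 0) * K"
        unfolding diff norm_minus_cancel by (rule K)
      also have "\<dots> \<le> (norm (?M t) * norm (A t - A 0) * K) * norm (?M 0) * K"
        using K by (intro mult_right_mono) auto
      also have "\<dots> \<le> (B * norm (A t - A 0) * K) * norm (?M 0) * K"
        using K(1) B by (intro mult_right_mono) auto
      finally show "norm (?M t - ?M 0) \<le> B * norm (A t - A 0) * K * norm (?M 0) * K" .
    qed
    show "((\<lambda>t. B * norm (A t - A 0) * K * norm (?M 0) * K) \<longlongrightarrow> 0) (at 0)"
      by (intro tendsto_mult_left_zero tendsto_mult_right_zero tendsto_norm_zero A0)
  qed
  then have M: "(?M \<longlongrightarrow> ?M 0) (at 0)" by (simp add: LIM_zero_iff)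
  have "((\<lambda>t. - (?M t ** ((A t - A 0) /\<^sub>R t) ** ?M 0)) \<longlongrightarrow> - (?M 0 ** A' ** ?M 0)) (at 0)"
    using A unfolding has_vector_derivative_iff_quotient
    by (intro tendsto_minus tendsto M tendsto_const)
  moreover have "(?M t - ?M 0) /\<^sub>R t = - (?M t ** ((A t - A 0) /\<^sub>R t) ** ?M 0)" for t
    unfolding diff by (simp add: scaleR_matrix_mult_left scaleR_matrix_mult_right)
  ultimately show ?thesis unfolding has_vector_derivative_iff_quotient by simp
qed

lemma
  fixes h :: "'a::euclidean_space \<Rightarrow> real"
  shows integral_lborel_translate: "h \<in> borel_measurable borel \<Longrightarrow> integral\<^sup>L lborel (\<lambda>x. h (x + c)) = integral\<^sup>L lborel h"
    and integrable_lborel_translate: "integrable lborel h \<Longrightarrow> integrable lborel (\<lambda>x. h (x + c))"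
proof -
  assume [measurable]: "h \<in> borel_measurable borel"
  have "integral\<^sup>L lborel h = integral\<^sup>L (distr lborel borel ((+) c)) h" by (simp only: lborel_distr_plus)
  also have "\<dots> = integral\<^sup>L lborel (\<lambda>x. h (c + x))" by (rule integral_distr) simp_all
  finally show "integral\<^sup>L lborel (\<lambda>x. h (x + c)) = integral\<^sup>L lborel h" by (simp add: add.commute)
next
  assume h: "integrable lborel h"
  then have "integrable (distr lborel borel ((+) c)) h" by (simp only: lborel_distr_plus)
  then have "integrable lborel (\<lambda>x. h (c + x))"
    using h by (subst (asm) integrable_distr_eq) simp_all
  then show "integrable lborel (\<lambda>x. h (x + c))" by (simp add: add.commute)
qed

lemma integrable_exp_norm_sq:
  assumes a: "0 < a"
  shows "integrable lborel (\<lambda>x::'a::euclidean_space. exp (- a * (norm (x - X))\<^sup>2))"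
proof -
  have "integrable lborel (\<lambda>x::'a. exp (- a * (norm x)\<^sup>2))"
    by (rule integrableI_nonneg) (simp_all add: nn_integral_gauss[OF a, simplified])
  from integrable_lborel_translate[OF this, of "- X"] show ?thesis by simp
qed

text \<open>The rate 3 leaves room for the factor \<open>1 + 2 * r\<close> in \<open>(1 + 2 * r) * exp r \<le> exp (3 * r)\<close>, which the derivative of a Gaussian
  product produces.\<close>

lemma integrable_gauss_bound:
  fixes h :: "'a::euclidean_space \<Rightarrow> real"
  assumes [measurable]: "h \<in> borel_measurable borel" and h: "\<And>x. \<bar>h x\<bar> \<le> K * exp (3 * norm (x - X))"
  shows "integrable lborel (\<lambda>x. h x * exp (- (norm (x - X))\<^sup>2))"
proof (rule Bochner_Integration.integrable_bound)
  show "integrable lborel (\<lambda>x. K * exp (9/2) * exp (- (1/2) * (norm (x - X))\<^sup>2))"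
    by (intro integrable_mult_right integrable_exp_norm_sq) simp
  have K: "K \<ge> 0" using h[of X] by (simp add: order_trans[OF abs_ge_zero])
  have "norm (h x * exp (- (norm (x - X))\<^sup>2)) \<le> norm (K * exp (9/2) * exp (- (1/2) * (norm (x - X))\<^sup>2))" for x
  proof -
    let ?r = "norm (x - X)"
    have "0 \<le> (?r - 3)\<^sup>2 / 2" by simp
    then have "3 * ?r - ?r\<^sup>2 \<le> 9/2 - (1/2) * ?r\<^sup>2" by (simp add: power2_eq_square field_simps)
    then have e: "exp (3 * ?r) * exp (- ?r\<^sup>2) \<le> exp (9/2) * exp (- (1/2) * ?r\<^sup>2)"
      by (simp flip: exp_add)
    have "\<bar>h x\<bar> * exp (- ?r\<^sup>2) \<le> K * exp (3 * ?r) * exp (- ?r\<^sup>2)"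
      by (intro mult_right_mono h) simp
    also have "\<dots> \<le> K * (exp (9/2) * exp (- (1/2) * ?r\<^sup>2))"
      unfolding mult.assoc by (intro mult_left_mono e K)
    finally show ?thesis using K by (simp add: abs_mult)
  qed
  then show "AE x in lborel. norm (h x * exp (- (norm (x - X))\<^sup>2)) \<le> norm (K * exp (9/2) * exp (- (1/2) * (norm (x - X))\<^sup>2))"
    by (intro AE_I2)
qed simp

text \<open>The mean derivative of a function that decays like a Gaussian vanishes, because its integral is translation invariant
  and the difference quotients are dominated.\<close>

lemma stein_coordinate:
  fixes f f' :: "'a::euclidean_space \<Rightarrow> real"
  assumes [measurable]: "f \<in> borel_measurable borel" "f' \<in> borel_measurable borel" and b: "b \<in> Basis"
    and der: "\<And>x. ((\<lambda>t. f (x + t *\<^sub>R b)) has_real_derivative f' x) (at 0)"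
    and bd: "\<And>x. \<bar>f x\<bar> \<le> K * exp (norm (x - X))" "\<And>x. \<bar>f' x\<bar> \<le> K * exp (norm (x - X))"
  shows "(LBINT x. ((x - X) \<bullet> b) * f x * exp (- (norm (x - X))\<^sup>2)) = (LBINT x. f' x * exp (- (norm (x - X))\<^sup>2)) / 2"
proof -
  have K: "K \<ge> 0" using bd(1)[of X] by (simp add: order_trans[OF abs_ge_zero])
  have nb: "norm b = 1" using b by simp
  define h where "h x = f x * exp (- (norm (x - X))\<^sup>2)" for x
  define D where "D x = (f' x - 2 * ((x - X) \<bullet> b) * f x) * exp (- (norm (x - X))\<^sup>2)" for x
  have [measurable]: "h \<in> borel_measurable borel" "D \<in> borel_measurable borel"
    unfolding h_def D_def by measurable
  have e3: "exp r \<le> exp (3 * r)" "(1 + 2 * r) * exp r \<le> exp (3 * r)" if "r \<ge> 0" for r :: real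
  proof -
    show "exp r \<le> exp (3 * r)" using that by simp
    have "(1 + 2 * r) * exp r \<le> exp (2 * r) * exp r"
      by (intro mult_right_mono exp_ge_add_one_self) simp
    then show "(1 + 2 * r) * exp r \<le> exp (3 * r)" by (simp flip: exp_add)
  qed
  have xb: "\<bar>(x - X) \<bullet> b\<bar> \<le> norm (x - X)" for x
    using Basis_le_norm[OF b] by simp
  have f'3: "\<bar>f' x\<bar> \<le> K * exp (3 * norm (x - X))" and f3: "\<bar>f x\<bar> \<le> K * exp (3 * norm (x - X))" for x
    using bd[of x] mult_left_mono[OF e3(1)[of "norm (x - X)"] K] by (auto intro: order_trans)
  have xf3: "\<bar>(x - X) \<bullet> b * f x\<bar> \<le> K * exp (3 * norm (x - X))" for x
  proof -
    let ?r = "norm (x - X)"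
    have "\<bar>(x - X) \<bullet> b * f x\<bar> \<le> ?r * (K * exp ?r)"
      unfolding abs_mult using K by (intro mult_mono xb bd) simp_all
    also have "\<dots> \<le> K * ((1 + 2 * ?r) * exp ?r)"
      using K by (simp add: algebra_simps)
    also have "\<dots> \<le> K * exp (3 * ?r)" by (intro mult_left_mono e3 K) simp
    finally show ?thesis .
  qed
  have int_f': "integrable lborel (\<lambda>x. f' x * exp (- (norm (x - X))\<^sup>2))"
    by (rule integrable_gauss_bound[OF _ f'3]) simp
  have int_h: "integrable lborel h"
    unfolding h_def by (rule integrable_gauss_bound[OF _ f3]) simp
  have int_xf: "integrable lborel (\<lambda>x. ((x - X) \<bullet> b) * f x * exp (- (norm (x - X))\<^sup>2))"
    by (rule integrable_gauss_bound[OF _ xf3]) simp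
  have Db: "\<bar>D x\<bar> \<le> K * exp (9/2) * exp (- (1/2) * (norm (x - X))\<^sup>2)" for x
  proof -
    let ?r = "norm (x - X)"
    have "\<bar>f' x - 2 * ((x - X) \<bullet> b) * f x\<bar> \<le> \<bar>f' x\<bar> + 2 * (\<bar>(x - X) \<bullet> b\<bar> * \<bar>f x\<bar>)"
      by (rule order_trans[OF abs_triangle_ineq4]) (simp add: abs_mult)
    also have "\<dots> \<le> K * exp ?r + 2 * (?r * (K * exp ?r))"
      using K by (intro add_mono mult_left_mono mult_mono xb bd) simp_all
    also have "\<dots> = K * ((1 + 2 * ?r) * exp ?r)" by (simp add: algebra_simps)
    also have "\<dots> \<le> K * exp (3 * ?r)" by (intro mult_left_mono e3 K) simp
    finally have "\<bar>D x\<bar> \<le> K * exp (3 * ?r) * exp (- ?r\<^sup>2)"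
      unfolding D_def abs_mult by (simp add: mult_right_mono)
    moreover have "0 \<le> (?r - 3)\<^sup>2 / 2" by simp
    then have "3 * ?r - ?r\<^sup>2 \<le> 9/2 - (1/2) * ?r\<^sup>2" by (simp add: power2_eq_square field_simps)
    then have "exp (3 * ?r) * exp (- ?r\<^sup>2) \<le> exp (9/2) * exp (- (1/2) * ?r\<^sup>2)"
      by (simp flip: exp_add)
    from mult_left_mono[OF this K] have "K * exp (3 * ?r) * exp (- ?r\<^sup>2) \<le> K * exp (9/2) * exp (- (1/2) * ?r\<^sup>2)"
      by (simp add: mult.assoc)
    ultimately show ?thesis by (rule order_trans)
  qed
  have der0: "((\<lambda>t. h (x + t *\<^sub>R b)) has_real_derivative D x) (at 0)" for x
  proof -
    have bb: "b \<bullet> b = 1" using b by simp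
    have n: "(norm (x + t *\<^sub>R b - X))\<^sup>2 = (norm (x - X))\<^sup>2 + 2 * t * ((x - X) \<bullet> b) + t\<^sup>2" for t
    proof -
      have "x + t *\<^sub>R b - X = (x - X) + t *\<^sub>R b" by simp
      then show ?thesis
        unfolding power2_norm_eq_inner
        by (simp only: inner_add_left inner_add_right inner_scaleR_left inner_scaleR_right inner_commute[of b "x - X"] bb)
           (simp add: power2_eq_square algebra_simps)
    qed
    have "((\<lambda>t. f (x + t *\<^sub>R b) * exp (- ((norm (x - X))\<^sup>2 + 2 * t * ((x - X) \<bullet> b) + t\<^sup>2))) has_real_derivative
        f' x * exp (- (norm (x - X))\<^sup>2) + exp (- (norm (x - X))\<^sup>2) * (- (2 * ((x - X) \<bullet> b))) * f x) (at 0)"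
      by (rule derivative_eq_intros der | simp)+
    then show ?thesis unfolding h_def n by (simp add: D_def algebra_simps)
  qed
  have der: "((\<lambda>t. h (x + t *\<^sub>R b)) has_real_derivative D (x + s *\<^sub>R b)) (at s)" for x s
  proof -
    have "((\<lambda>t. h (x + (t + s) *\<^sub>R b)) has_real_derivative D (x + s *\<^sub>R b)) (at 0)"
      using der0[of "x + s *\<^sub>R b"] by (simp add: algebra_simps)
    then show ?thesis using DERIV_shift[of "\<lambda>t. h (x + t *\<^sub>R b)" "D (x + s *\<^sub>R b)" 0 s] by simp
  qed
  define t where "t n = 1 / real (Suc n)" for n
  have t: "t n > 0" "t n \<le> 1" for n by (simp_all add: t_def)
  define q where "q n x = (h (x + t n *\<^sub>R b) - h x) / t n" for n x
  have [measurable]: "q n \<in> borel_measurable borel" for n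
    unfolding q_def[abs_def] by measurable
  have "(\<lambda>n. integral\<^sup>L lborel (q n)) \<longlonglongrightarrow> integral\<^sup>L lborel D"
  proof (rule integral_dominated_convergence[where w="\<lambda>x. K * exp 5 * exp (- (1/4) * (norm (x - X))\<^sup>2)"])
    show "integrable lborel (\<lambda>x. K * exp 5 * exp (- (1/4) * (norm (x - X))\<^sup>2))"
      by (intro integrable_mult_right integrable_exp_norm_sq) simp
    have "(\<lambda>n. q n x) \<longlonglongrightarrow> D x" for x
    proof -
      have "((\<lambda>s. (h (x + (0 + s) *\<^sub>R b) - h (x + 0 *\<^sub>R b)) / s) \<longlongrightarrow> D x) (at 0)"
        using der0[of x] by (simp only: DERIV_def)
      moreover have "filterlim t (at 0) sequentially"
        unfolding filterlim_at t_def using LIMSEQ_inverse_real_of_nat by (auto simp: inverse_eq_divide)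
      ultimately show ?thesis unfolding q_def by (auto dest: filterlim_compose)
    qed
    then show "AE x in lborel. (\<lambda>n. q n x) \<longlonglongrightarrow> D x" by simp
    fix n
    have "norm (q n x) \<le> K * exp 5 * exp (- (1/4) * (norm (x - X))\<^sup>2)" for x
    proof -
      obtain s where s: "0 < s" "s < t n" "h (x + t n *\<^sub>R b) - h (x + 0 *\<^sub>R b) = (t n - 0) * D (x + s *\<^sub>R b)"
        using MVT2[of 0 "t n" "\<lambda>s. h (x + s *\<^sub>R b)" "\<lambda>s. D (x + s *\<^sub>R b)"] der t by blast
      have qD: "q n x = D (x + s *\<^sub>R b)" using s t(1)[of n] by (simp add: q_def)
      let ?y = "norm (x + s *\<^sub>R b - X)" and ?r = "norm (x - X)"
      have "?r \<le> ?y + norm (s *\<^sub>R b)"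
        using norm_triangle_ineq4[of "x + s *\<^sub>R b - X" "s *\<^sub>R b"] by (simp add: algebra_simps)
      also have "norm (s *\<^sub>R b) \<le> 1" using s t(2)[of n] nb by simp
      finally have "?r \<le> ?y + 1" by simp
      then have "?r\<^sup>2 \<le> (?y + 1)\<^sup>2" by (intro power_mono) auto
      also have "\<dots> \<le> 2 * ?y\<^sup>2 + 2"
        using zero_le_power2[of "?y - 1"] by (simp add: power2_eq_square algebra_simps)
      finally have "9/2 - (1/2) * ?y\<^sup>2 \<le> 5 - (1/4) * ?r\<^sup>2" by simp
      then have "exp (9/2) * exp (- (1/2) * ?y\<^sup>2) \<le> exp 5 * exp (- (1/4) * ?r\<^sup>2)"
        by (simp flip: exp_add)
      from mult_left_mono[OF this K] show ?thesis
        using Db[of "x + s *\<^sub>R b"] by (simp add: qD mult.assoc)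
    qed
    then show "AE x in lborel. norm (q n x) \<le> K * exp 5 * exp (- (1/4) * (norm (x - X))\<^sup>2)" by simp
  qed simp_all
  moreover have "integral\<^sup>L lborel (q n) = 0" for n
  proof -
    have "integral\<^sup>L lborel (q n) = (integral\<^sup>L lborel (\<lambda>x. h (x + t n *\<^sub>R b)) - integral\<^sup>L lborel h) / t n"
      unfolding q_def using int_h integrable_lborel_translate[OF int_h] by simp
    then show ?thesis by (simp add: integral_lborel_translate)
  qed
  ultimately have "integral\<^sup>L lborel D = 0" by (simp add: LIMSEQ_const_iff)
  moreover have "integral\<^sup>L lborel D = (LBINT x. f' x * exp (- (norm (x - X))\<^sup>2))
      - 2 * (LBINT x. ((x - X) \<bullet> b) * f x * exp (- (norm (x - X))\<^sup>2))"
  proof -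
    have "D = (\<lambda>x. f' x * exp (- (norm (x - X))\<^sup>2) - 2 * (((x - X) \<bullet> b) * f x * exp (- (norm (x - X))\<^sup>2)))"
      by (auto simp: D_def algebra_simps)
    then show ?thesis using int_f' int_xf by simp
  qed
  ultimately show ?thesis by simp
qed

text \<open>A growth condition that is inherited by the sums and products from which the estimators are built, and that suffices for
  integrability against a Gaussian.\<close>

definition poly_bounded :: "('a::real_normed_vector \<Rightarrow> 'b::real_normed_vector) \<Rightarrow> bool" where
  "poly_bounded f \<longleftrightarrow> (\<exists>K q. \<forall>x. norm (f x) \<le> K * (1 + norm x) ^ q)"

lemma poly_boundedE:
  assumes "poly_bounded f"
  obtains K q where "K \<ge> 0" "\<And>x. norm (f x) \<le> K * (1 + norm x) ^ q"
proof -
  obtain K q where Kq': "\<forall>x. norm (f x) \<le> K * (1 + norm x) ^ q" using assms by (auto simp: poly_bounded_def)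
  note Kq = Kq'[rule_format]
  have "K \<ge> 0" using Kq[of 0] by (simp add: order_trans[OF norm_ge_zero])
  then show thesis using Kq by (rule that)
qed

lemma poly_bounded_const [intro]: "poly_bounded (\<lambda>x. c)"
  unfolding poly_bounded_def by (rule exI[of _ "norm c"], rule exI[of _ 0]) simp

lemma poly_bounded_bound: "(\<And>x. norm (f x) \<le> B) \<Longrightarrow> poly_bounded f"
  unfolding poly_bounded_def by (rule exI[of _ B], rule exI[of _ 0]) simp

lemma poly_bounded_id [intro]: "poly_bounded (\<lambda>x. x)"
  unfolding poly_bounded_def by (rule exI[of _ 1], rule exI[of _ 1]) simp

lemma poly_bounded_bilinear:
  assumes "bounded_bilinear B" and f: "poly_bounded f" and g: "poly_bounded g"
  shows "poly_bounded (\<lambda>x. B (f x) (g x))"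
proof -
  interpret bounded_bilinear B by fact
  obtain C where C': "C > 0" "\<forall>a b. norm (B a b) \<le> norm a * norm b * C" using pos_bounded by auto
  note C = C'(1) C'(2)[rule_format]
  obtain K p where f: "K \<ge> 0" "\<And>x. norm (f x) \<le> K * (1 + norm x) ^ p" using f by (rule poly_boundedE) blast
  obtain L q where g: "L \<ge> 0" "\<And>x. norm (g x) \<le> L * (1 + norm x) ^ q" using g by (rule poly_boundedE) blast
  have "norm (B (f x) (g x)) \<le> (K * L * C) * (1 + norm x) ^ (p + q)" for x
  proof -
    have "norm (B (f x) (g x)) \<le> norm (f x) * norm (g x) * C" by (rule C)
    also have "\<dots> \<le> (K * (1 + norm x) ^ p) * (L * (1 + norm x) ^ q) * C"
      using C f g by (intro mult_right_mono mult_mono) auto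
    finally show ?thesis by (simp add: power_add mult_ac)
  qed
  then show ?thesis unfolding poly_bounded_def by blast
qed

lemma poly_bounded_add:
  assumes f: "poly_bounded f" and g: "poly_bounded g"
  shows "poly_bounded (\<lambda>x. f x + g x)"
proof -
  obtain K p where f: "K \<ge> 0" "\<And>x. norm (f x) \<le> K * (1 + norm x) ^ p" using f by (rule poly_boundedE) blast
  obtain L q where g: "L \<ge> 0" "\<And>x. norm (g x) \<le> L * (1 + norm x) ^ q" using g by (rule poly_boundedE) blast
  have "norm (f x + g x) \<le> (K + L) * (1 + norm x) ^ (p + q)" for x
  proof -
    have "norm (f x + g x) \<le> K * (1 + norm x) ^ p + L * (1 + norm x) ^ q"
      using norm_triangle_ineq[of "f x" "g x"] f(2)[of x] g(2)[of x] by linarith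
    also have "\<dots> \<le> K * (1 + norm x) ^ (p + q) + L * (1 + norm x) ^ (p + q)"
      using f(1) g(1) by (intro add_mono mult_left_mono power_increasing) auto
    finally show ?thesis by (simp add: distrib_right)
  qed
  then show ?thesis unfolding poly_bounded_def by blast
qed

lemma poly_bounded_linear:
  assumes "bounded_linear L" and f: "poly_bounded f"
  shows "poly_bounded (\<lambda>x. L (f x))"
proof -
  obtain C where C': "C > 0" "\<forall>a. norm (L a) \<le> norm a * C" using bounded_linear.pos_bounded[OF assms(1)] by auto
  note C = C'(1) C'(2)[rule_format]
  obtain K p where f: "K \<ge> 0" "\<And>x. norm (f x) \<le> K * (1 + norm x) ^ p" using f by (rule poly_boundedE) blast
  have "norm (L (f x)) \<le> (K * C) * (1 + norm x) ^ p" for x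
    using order_trans[OF C(2) mult_right_mono[OF f(2)[of x]]] C(1) by (simp add: mult_ac)
  then show ?thesis unfolding poly_bounded_def by blast
qed

lemma poly_bounded_minus: "poly_bounded f \<Longrightarrow> poly_bounded (\<lambda>x. - f x)"
  by (simp add: poly_bounded_def)

lemmas poly_bounded_matrix_mult = poly_bounded_bilinear[OF bounded_bilinear_matrix_mult]
lemmas poly_bounded_inner = poly_bounded_bilinear[OF bounded_bilinear_inner]

lemma poly_bounded_exp:
  assumes "poly_bounded f"
  obtains K where "\<And>x. norm (f x) \<le> K * exp (norm (x - X))"
proof -
  obtain K q where f: "K \<ge> 0" "\<And>x. norm (f x) \<le> K * (1 + norm x) ^ q" using assms by (rule poly_boundedE) blast
  let ?q = "real (Suc q)"
  have "norm (f x) \<le> (K * (1 + norm X) ^ Suc q * ?q ^ Suc q) * exp (norm (x - X))" for x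
  proof -
    let ?r = "norm (x - X)"
    have "norm x \<le> norm X + ?r" using norm_triangle_ineq[of X "x - X"] by simp
    also have "1 + (norm X + ?r) \<le> (1 + norm X) * (1 + ?r)" by (simp add: algebra_simps)
    finally have "1 + norm x \<le> (1 + norm X) * (1 + ?r)" by simp
    also have "1 + ?r \<le> ?q * (1 + ?r / ?q)" by (simp add: field_simps)
    also have "\<dots> \<le> ?q * exp (?r / ?q)" by (intro mult_left_mono exp_ge_add_one_self) simp
    finally have "1 + norm x \<le> (1 + norm X) * (?q * exp (?r / ?q))" by (simp add: mult_left_mono)
    then have "(1 + norm x) ^ Suc q \<le> ((1 + norm X) * (?q * exp (?r / ?q))) ^ Suc q" by (intro power_mono) auto
    also have "exp (?r / ?q) ^ Suc q = exp ?r" unfolding exp_of_nat_mult[symmetric] by simp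
    then have "((1 + norm X) * (?q * exp (?r / ?q))) ^ Suc q = (1 + norm X) ^ Suc q * (?q ^ Suc q * exp ?r)"
      unfolding power_mult_distrib by simp
    finally have 1: "(1 + norm x) ^ Suc q \<le> (1 + norm X) ^ Suc q * (?q ^ Suc q * exp ?r)" .
    have 2: "norm (f x) \<le> K * (1 + norm x) ^ Suc q"
      using f(2)[of x] mult_left_mono[OF power_increasing[of q "Suc q" "1 + norm x"] f(1)] by simp
    show ?thesis using order_trans[OF 2 mult_left_mono[OF 1 f(1)]] by (simp only: mult.assoc)
  qed
  then show thesis by (rule that)
qed

lemma integrable_gauss_poly:
  fixes f :: "'a::euclidean_space \<Rightarrow> real"
  assumes m: "f \<in> borel_measurable borel" and "poly_bounded f"
  shows "integrable lborel (\<lambda>x. f x * exp (- (norm (x - X))\<^sup>2))"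
proof -
  obtain K where K: "\<And>x. norm (f x) \<le> K * exp (norm (x - X))" using assms(2) by (rule poly_bounded_exp) blast
  have "K \<ge> 0" using K[of X] by (simp add: order_trans[OF abs_ge_zero])
  then have "\<bar>f x\<bar> \<le> K * exp (3 * norm (x - X))" for x
    using K[of x] mult_left_mono[of "exp (norm (x - X))" "exp (3 * norm (x - X))" K] by simp
  then show ?thesis by (rule integrable_gauss_bound[OF m])
qed

text \<open>The factor one half is the variance of each real coordinate under the density proportional to \<open>exp (- (norm x)\<^sup>2)\<close>.\<close>

lemma stein:
  fixes G :: "'a::euclidean_space \<Rightarrow> 'a" and D :: "'a \<Rightarrow> 'a \<Rightarrow> 'a"
  assumes [measurable]: "G \<in> borel_measurable borel" "\<And>b. D b \<in> borel_measurable borel"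
    and G: "poly_bounded G" and D: "\<And>b. b \<in> Basis \<Longrightarrow> poly_bounded (D b)"
    and der: "\<And>x b. b \<in> Basis \<Longrightarrow> ((\<lambda>t. G (x + t *\<^sub>R b)) has_vector_derivative D b x) (at 0)"
  shows "(LBINT x. ((x - X) \<bullet> G x) * exp (- (norm (x - X))\<^sup>2))
    = (LBINT x. (\<Sum>b\<in>Basis. D b x \<bullet> b) * exp (- (norm (x - X))\<^sup>2)) / 2"
proof -
  have x: "poly_bounded (\<lambda>x. x - X)" using poly_bounded_add[of "\<lambda>x. x" "\<lambda>x. - X"] by auto
  have "(LBINT x. ((x - X) \<bullet> G x) * exp (- (norm (x - X))\<^sup>2))
      = (LBINT x. (\<Sum>b\<in>Basis. ((x - X) \<bullet> b) * (G x \<bullet> b) * exp (- (norm (x - X))\<^sup>2)))"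
    by (intro Bochner_Integration.integral_cong refl) (subst euclidean_inner, rule sum_distrib_right)
  also have "\<dots> = (\<Sum>b\<in>Basis. (LBINT x. ((x - X) \<bullet> b) * (G x \<bullet> b) * exp (- (norm (x - X))\<^sup>2)))"
    by (intro Bochner_Integration.integral_sum integrable_gauss_poly poly_bounded_bilinear[OF bounded_bilinear_mult] poly_bounded_inner x G poly_bounded_const) measurable
  also have "\<dots> = (\<Sum>b\<in>Basis. (LBINT x. (D b x \<bullet> b) * exp (- (norm (x - X))\<^sup>2)) / 2)"
  proof (rule sum.cong[OF refl])
    fix b :: 'a assume b: "b \<in> Basis"
    obtain K where K: "\<And>x. norm (G x \<bullet> b) \<le> K * exp (norm (x - X))"
      using poly_bounded_inner[OF G poly_bounded_const] by (rule poly_bounded_exp) blast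
    obtain L where L: "\<And>x. norm (D b x \<bullet> b) \<le> L * exp (norm (x - X))"
      using poly_bounded_inner[OF D[OF b] poly_bounded_const] by (rule poly_bounded_exp) blast
    let ?M = "max K L"
    have M: "K * exp r \<le> ?M * exp r" "L * exp r \<le> ?M * exp r" for r by simp_all
    show "(LBINT x. ((x - X) \<bullet> b) * (G x \<bullet> b) * exp (- (norm (x - X))\<^sup>2)) = (LBINT x. (D b x \<bullet> b) * exp (- (norm (x - X))\<^sup>2)) / 2"
    proof (rule stein_coordinate[OF _ _ b, where K="?M"])
      show "((\<lambda>t. G (x + t *\<^sub>R b) \<bullet> b) has_real_derivative D b x \<bullet> b) (at 0)" for x
        using bounded_linear.has_vector_derivative[OF bounded_linear_inner_left der[OF b]]
        by (simp add: has_real_derivative_iff_has_vector_derivative)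
      show "\<bar>G x \<bullet> b\<bar> \<le> ?M * exp (norm (x - X))" for x
        using order_trans[OF K[of x] M(1)] by (simp only: real_norm_def)
      show "\<bar>D b x \<bullet> b\<bar> \<le> ?M * exp (norm (x - X))" for x
        using order_trans[OF L[of x] M(2)] by (simp only: real_norm_def)
    qed measurable
  qed
  also have "\<dots> = (LBINT x. (\<Sum>b\<in>Basis. (D b x \<bullet> b) * exp (- (norm (x - X))\<^sup>2))) / 2"
    unfolding sum_divide_distrib[symmetric]
    by (subst Bochner_Integration.integral_sum)
       (auto intro!: integrable_gauss_poly poly_bounded_inner D)
  finally show ?thesis by (simp add: sum_distrib_right)
qed

section \<open>The risk bound for fixed second argument\<close>

lemma norm_sq_trace: "(norm A)\<^sup>2 = Re (trace (A ** ctranspose A))" for A :: "complex^'n^'m"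
  unfolding power2_norm_eq_inner inner_matrix_trace by (subst trace_mul_sym) simp

lemma cnormal_1:
  fixes X :: "complex^'p^'m"
  shows "cnormal X (mat 1) = density lborel (\<lambda>z. ennreal (exp (- (norm (z - X))\<^sup>2) / pi ^ (CARD('m) * CARD('p))))"
  unfolding cnormal_def by (simp add: norm_sq_trace)

lemma nn_integral_cnormal_1:
  fixes X :: "complex^'p^'m"
  assumes [measurable]: "f \<in> borel_measurable borel"
  shows "(\<integral>\<^sup>+z. f z \<partial>cnormal X (mat 1))
    = (\<integral>\<^sup>+z. ennreal (exp (- (norm (z - X))\<^sup>2) / pi ^ (CARD('m) * CARD('p))) * f z \<partial>lborel)"
  unfolding cnormal_1 by (rule nn_integral_density) measurable

lemma DIM_complex_matrix: "DIM(complex^'p^'m) = 2 * (CARD('m) * CARD('p))"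
  by simp

lemma sqrt_pi_DIM: "sqrt pi ^ DIM(complex^'p^'m) = pi ^ (CARD('m) * CARD('p))"
  unfolding DIM_complex_matrix power_mult by simp

lemma prob_space_cnormal_1: "prob_space (cnormal (X :: complex^'p^'m) (mat 1))"
proof (rule prob_spaceI)
  let ?c = "pi ^ (CARD('m) * CARD('p))"
  have "(\<integral>\<^sup>+z. 1 \<partial>cnormal X (mat 1)) = (\<integral>\<^sup>+z. ennreal (1 / ?c) * ennreal (exp (- (norm (z - X))\<^sup>2)) \<partial>lborel)"
    by (subst nn_integral_cnormal_1) (simp_all add: ennreal_mult[symmetric])
  also have "\<dots> = ennreal (1 / ?c) * (\<integral>\<^sup>+z. ennreal (exp (- (norm (z + - X))\<^sup>2)) \<partial>lborel)"
    by (subst nn_integral_cmult) simp_all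
  also have "(\<integral>\<^sup>+z. ennreal (exp (- (norm (z + - X))\<^sup>2)) \<partial>lborel) = ennreal ?c"
    using nn_integral_gauss[of 1, where 'a="complex^'p^'m", unfolded div_by_1 sqrt_pi_DIM]
    by (subst nn_integral_translate[where h="\<lambda>z. ennreal (exp (- (norm z)\<^sup>2))"]) simp_all
  also have "ennreal (1 / ?c) * ennreal ?c = 1" by (simp flip: ennreal_mult)
  finally show "emeasure (cnormal X (mat 1)) (space (cnormal X (mat 1))) = 1" by simp
qed

lemma nn_integral_cnormal_1_norm_sq:
  fixes X :: "complex^'p^'m"
  shows "(\<integral>\<^sup>+z. ennreal ((norm (z - X))\<^sup>2) \<partial>cnormal X (mat 1)) = ennreal (real (CARD('m) * CARD('p)))"
proof -
  let ?c = "pi ^ (CARD('m) * CARD('p))" and ?d = "real (CARD('m) * CARD('p))"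
  have "(\<integral>\<^sup>+z. ennreal ((norm (z - X))\<^sup>2) \<partial>cnormal X (mat 1))
      = (\<integral>\<^sup>+z. ennreal (1 / ?c) * ennreal ((norm (z - X))\<^sup>2 * exp (- (norm (z - X))\<^sup>2)) \<partial>lborel)"
    by (subst nn_integral_cnormal_1) (simp_all add: ennreal_mult[symmetric] mult.commute)
  also have "\<dots> = ennreal (1 / ?c) * (\<integral>\<^sup>+z. ennreal ((norm (z + - X))\<^sup>2 * exp (- (norm (z + - X))\<^sup>2)) \<partial>lborel)"
    by (subst nn_integral_cmult) simp_all
  also have "(\<integral>\<^sup>+z. ennreal ((norm (z + - X))\<^sup>2 * exp (- (norm (z + - X))\<^sup>2)) \<partial>lborel) = ennreal (?d * ?c)"
    using nn_integral_gauss_norm_sq[of 1, where 'a="complex^'p^'m", unfolded div_by_1 sqrt_pi_DIM, unfolded DIM_complex_matrix]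
    by (subst nn_integral_translate[where h="\<lambda>z. ennreal ((norm z)\<^sup>2 * exp (- (norm z)\<^sup>2))"]) simp_all
  also have "ennreal (1 / ?c) * ennreal (?d * ?c) = ennreal ?d" by (subst ennreal_mult[symmetric]) simp_all
  finally show ?thesis .
qed

lemma
  fixes X :: "complex^'p^'m" and f :: "complex^'p^'m \<Rightarrow> real"
  assumes [measurable]: "f \<in> borel_measurable borel"
  shows integral_cnormal_1: "integral\<^sup>L (cnormal X (mat 1)) f
      = (LBINT z. f z * exp (- (norm (z - X))\<^sup>2)) / pi ^ (CARD('m) * CARD('p))"
    and integrable_cnormal_1: "poly_bounded f \<Longrightarrow> integrable (cnormal X (mat 1)) f"
proof -
  let ?c = "pi ^ (CARD('m) * CARD('p))"
  have "integral\<^sup>L (cnormal X (mat 1)) f = (LBINT z. exp (- (norm (z - X))\<^sup>2) / ?c * f z)"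
    unfolding cnormal_1 by (rule integral_real_density) auto
  also have "\<dots> = (LBINT z. (f z * exp (- (norm (z - X))\<^sup>2)) / ?c)" by (simp add: mult.commute)
  finally show "integral\<^sup>L (cnormal X (mat 1)) f = (LBINT z. f z * exp (- (norm (z - X))\<^sup>2)) / ?c" by simp
  assume "poly_bounded f"
  then have "integrable lborel (\<lambda>z. (f z * exp (- (norm (z - X))\<^sup>2)) / ?c)"
    by (intro integrable_divide integrable_gauss_poly) simp_all
  then have "integrable lborel (\<lambda>z. exp (- (norm (z - X))\<^sup>2) / ?c * f z)" by (simp add: mult.commute)
  then show "integrable (cnormal X (mat 1)) f"
    unfolding cnormal_1 by (subst integrable_real_density) auto
qed

lemma norm_sq_diff_scaleR: "(norm (v - c *\<^sub>R g))\<^sup>2 = (norm v)\<^sup>2 - 2 * c * (v \<bullet> g) + c\<^sup>2 * (norm g)\<^sup>2"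
  unfolding power2_norm_eq_inner
  by (simp only: inner_diff_left inner_diff_right inner_scaleR_left inner_scaleR_right inner_commute[of g v])
     (simp add: power2_eq_square algebra_simps)

text \<open>The weighted Gram matrix, shifted by \<open>\<epsilon>\<close> so that its inverse is bounded and differentiable everywhere.\<close>

definition ridge :: "complex^'k^'k \<Rightarrow> real \<Rightarrow> complex^'l^'k \<Rightarrow> complex^'l^'l" where
  "ridge R \<epsilon> Y = ctranspose Y ** R ** Y + \<epsilon> *\<^sub>R mat 1"

lemma inner_pos_def_nonneg:
  fixes R :: "complex^'k^'k" and A :: "complex^'l^'k"
  assumes "pos_def R"
  shows "0 \<le> A \<bullet> (R ** A)"
proof -
  obtain B :: "complex^'k^'k" where B: "R = B ** ctranspose B" using pos_def_factor[OF assms] by metis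
  have "A \<bullet> (R ** A) = (ctranspose B ** A) \<bullet> (ctranspose B ** A)"
    by (simp add: inner_matrix_trace B ctranspose_mult matrix_mul_assoc)
  then show ?thesis by simp
qed

lemma pos_def_ridge:
  fixes R :: "complex^'k^'k" and Y :: "complex^'l^'k"
  assumes R: "pos_def R" and e: "\<epsilon> > 0"
  shows "pos_def (ridge R \<epsilon> Y)"
  unfolding pos_def_iff
proof (intro conjI allI impI)
  show "ctranspose (ridge R \<epsilon> Y) = ridge R \<epsilon> Y"
    using pos_def_hermitian[OF R] by (simp add: ridge_def ctranspose_add ctranspose_scaleR ctranspose_mult matrix_mul_assoc)
  fix x :: "complex^'l" assume x: "x \<noteq> 0"
  have "0 \<le> (Y *v x) \<bullet> (R *v (Y *v x))"
    using R by (cases "Y *v x = 0") (auto simp: pos_def_iff less_imp_le)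
  then show "0 < x \<bullet> (ridge R \<epsilon> Y *v x)"
    using e x unfolding ridge_def matrix_vector_mult_add_rdistrib inner_add_right inner_gram
    by (simp add: scaleR_matrix_vector_mult add_nonneg_pos)
qed

text \<open>Pair \<open>M\<close>, the inverse of the shifted matrix, with \<open>ridge R \<epsilon> Y ** M = mat 1\<close>; the Gram part contributes nonnegatively.\<close>

lemma norm_ridge_inv:
  fixes R :: "complex^'k^'k" and Y :: "complex^'l^'k"
  assumes R: "pos_def R" and e: "\<epsilon> > 0"
  shows "norm (matrix_inv (ridge R \<epsilon> Y)) \<le> norm (mat 1 :: complex^'l^'l) / \<epsilon>"
proof -
  let ?M = "matrix_inv (ridge R \<epsilon> Y)"
  note inv = matrix_inv[OF pos_def_invertible[OF pos_def_ridge[OF R e, of Y]]]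
  have "(Y ** ?M) \<bullet> (R ** (Y ** ?M)) = ?M \<bullet> (ctranspose Y ** R ** Y ** ?M)"
    by (simp add: inner_matrix_trace ctranspose_mult matrix_mul_assoc)
  then have "0 \<le> ?M \<bullet> (ctranspose Y ** R ** Y ** ?M)" using inner_pos_def_nonneg[OF R, of "Y ** ?M"] by simp
  moreover have "?M \<bullet> (ridge R \<epsilon> Y ** ?M) = ?M \<bullet> (ctranspose Y ** R ** Y ** ?M) + \<epsilon> * (norm ?M)\<^sup>2"
    by (simp add: ridge_def matrix_distribs inner_add_right power2_norm_eq_inner)
  moreover have "?M \<bullet> (ridge R \<epsilon> Y ** ?M) \<le> norm ?M * norm (mat 1 :: complex^'l^'l)"
    unfolding inv by (rule norm_cauchy_schwarz)
  ultimately have "\<epsilon> * norm ?M * norm ?M \<le> norm (mat 1 :: complex^'l^'l) * norm ?M"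
    by (simp add: power2_eq_square mult_ac)
  then have "\<epsilon> * norm ?M \<le> norm (mat 1 :: complex^'l^'l)"
    by (cases "norm ?M = 0") simp_all
  then show ?thesis using e by (simp add: field_simps)
qed

lemma bounded_linear_ctranspose: "bounded_linear ctranspose"
  using linear_ctranspose linear_conv_bounded_linear by blast

lemma unit_matrix_mult_diag: "(axis i (axis j u) ** N) $ a $ b = (if a = i then u * N $ j $ b else 0)"
  for N :: "complex^'n^'l" and i :: "'k::finite"
proof (cases "a = i")
  case True
  have "(axis i (axis j u) ** N) $ a $ b = (\<Sum>c\<in>UNIV. if c = j then u * N $ j $ b else 0)"
    unfolding matrix_matrix_mult_def vec_lambda_beta using True by (intro sum.cong) (auto simp: axis_def)
  then show ?thesis using True by simp
qed (simp add: matrix_matrix_mult_def axis_def)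

text \<open>Summing a real-linear map over the real basis of the complex matrices: only the complex-linear part contributes.\<close>

lemma sum_Basis_divergence:
  fixes P :: "complex^'k^'k" and N :: "complex^'l^'l" and V W :: "complex^'l^'k"
  shows "(\<Sum>b\<in>(Basis :: (complex^'l^'k) set). (b ** N - P ** b ** N - V ** ctranspose b ** W ** N) \<bullet> b)
    = 2 * Re (trace N * (of_nat CARD('k) - trace P))"
proof -
  have one: "(\<Sum>u\<in>Basis. (axis i (axis j u) ** N - P ** axis i (axis j u) ** N
      - V ** ctranspose (axis i (axis j u)) ** W ** N) \<bullet> axis i (axis j u))
      = 2 * Re (N $ j $ j - P $ i $ i * N $ j $ j)" for i :: 'k and j :: 'l
  proof -
    have e: "(P ** axis i (axis j u) ** N) $ i $ j = u * (P $ i $ i * N $ j $ j)" for u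
    proof -
      have "(P ** axis i (axis j u) ** N) $ i $ j = (\<Sum>a\<in>UNIV. P $ i $ a * (axis i (axis j u) ** N) $ a $ j)"
        unfolding matrix_mul_assoc[symmetric] by (simp add: matrix_matrix_mult_def[of P])
      also have "\<dots> = (\<Sum>a\<in>UNIV. if a = i then u * (P $ i $ i * N $ j $ j) else 0)"
        by (intro sum.cong) (auto simp: unit_matrix_mult_diag)
      finally show ?thesis by simp
    qed
    have ct: "ctranspose (axis i (axis j u)) = axis j (axis i (cnj u))" for u
      by (auto simp: vec_eq_iff axis_def)
    have f: "(V ** ctranspose (axis i (axis j u)) ** W ** N) $ i $ j = cnj u * (V $ i $ j * (W ** N) $ i $ j)" for u
    proof -
      have "(V ** ctranspose (axis i (axis j u)) ** W ** N) $ i $ j = (\<Sum>a\<in>UNIV. V $ i $ a * (axis j (axis i (cnj u)) ** (W ** N)) $ a $ j)"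
        unfolding matrix_mul_assoc[symmetric] ct by (simp add: matrix_matrix_mult_def[of V])
      also have "\<dots> = (\<Sum>a\<in>UNIV. if a = j then cnj u * (V $ i $ j * (W ** N) $ i $ j) else 0)"
        by (intro sum.cong) (auto simp: unit_matrix_mult_diag)
      finally show ?thesis by simp
    qed
    show ?thesis
      by (simp add: inner_axis e f unit_matrix_mult_diag Basis_complex_def inner_complex_def)
  qed
  have "(\<Sum>b\<in>(Basis :: (complex^'l^'k) set). (b ** N - P ** b ** N - V ** ctranspose b ** W ** N) \<bullet> b)
      = (\<Sum>i\<in>UNIV. \<Sum>j\<in>UNIV. 2 * Re (N $ j $ j - P $ i $ i * N $ j $ j))"
    unfolding sum_Basis_vec one ..
  also have "\<dots> = 2 * Re (\<Sum>i\<in>UNIV. \<Sum>j\<in>UNIV. N $ j $ j - P $ i $ i * N $ j $ j)"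
    by (simp add: sum_distrib_left)
  also have "(\<Sum>i\<in>UNIV. \<Sum>j\<in>UNIV. N $ j $ j - P $ i $ i * N $ j $ j) = trace N * (of_nat CARD('k) - trace P)"
    by (simp add: sum_subtractf trace_def sum_distrib_left[symmetric] sum_distrib_right[symmetric] algebra_simps)
  finally show ?thesis .
qed

lemma trace_pos_def_real: "pos_def A \<Longrightarrow> trace A = complex_of_real (Re (trace A))"
  using trace_ctranspose[of A] pos_def_hermitian[of A] by (simp add: complex_eq_iff)

text \<open>The divergence of \<open>Y ** M Y ** C\<close> is a product of traces, because in the directions of all basis matrices the derivative
  of \<open>M\<close> contributes through \<open>trace (Y ** M Y ** ctranspose Y ** R) = l - \<epsilon> * trace (M Y)\<close>.\<close>

lemma stein_ridge:
  fixes R :: "complex^'k^'k" and C :: "complex^'l^'l" and X :: "complex^'l^'k"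
  assumes R: "pos_def R" and e: "\<epsilon> > 0"
  defines "M \<equiv> \<lambda>Y. matrix_inv (ridge R \<epsilon> Y)"
  shows "integral\<^sup>L (cnormal X (mat 1)) (\<lambda>Y. (Y - X) \<bullet> (Y ** M Y ** C))
    = integral\<^sup>L (cnormal X (mat 1)) (\<lambda>Y. Re (trace (M Y ** C)) * (real CARD('k) - real CARD('l) + \<epsilon> * Re (trace (M Y))))"
    and "poly_bounded (\<lambda>Y. Y ** M Y ** C)" "poly_bounded M"
proof -
  let ?G = "\<lambda>Y. Y ** M Y ** C"
  let ?D = "\<lambda>b Y. b ** (M Y ** C) - (Y ** M Y ** ctranspose Y ** R) ** b ** (M Y ** C)
      - (Y ** M Y) ** ctranspose b ** (R ** Y) ** (M Y ** C)"
  have [measurable]: "M \<in> borel_measurable borel" unfolding M_def ridge_def by measurable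
  show pbM: "poly_bounded M"
    unfolding M_def by (rule poly_bounded_bound) (rule norm_ridge_inv[OF R e])
  note pb = poly_bounded_matrix_mult poly_bounded_id poly_bounded_const pbM
    poly_bounded_linear[OF bounded_linear_ctranspose]
  show pbG: "poly_bounded ?G" by (intro pb)
  have pbD: "poly_bounded (?D b)" for b
    unfolding diff_conv_add_uminus by (intro poly_bounded_add poly_bounded_minus pb)
  have inv: "invertible (ridge R \<epsilon> Y)" for Y :: "complex^'l^'k" by (rule pos_def_invertible[OF pos_def_ridge[OF R e]])
  have der: "((\<lambda>t. ?G (Y + t *\<^sub>R b)) has_vector_derivative ?D b Y) (at 0)" for Y b
  proof -
    let ?Yt = "\<lambda>t. Y + t *\<^sub>R b"
    have Yt: "(?Yt has_vector_derivative b) (at 0)"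
      by (auto intro!: derivative_eq_intros)
    note ct = bounded_linear.has_vector_derivative[OF bounded_linear_ctranspose Yt]
    note mm = bounded_bilinear.has_vector_derivative[OF bounded_bilinear_matrix_mult]
    have "((\<lambda>t. ridge R \<epsilon> (?Yt t)) has_vector_derivative (ctranspose Y ** R ** b + ctranspose b ** R ** Y)) (at 0)"
      unfolding ridge_def
      using has_vector_derivative_add[OF mm[OF mm[OF ct has_vector_derivative_const[of R]] Yt] has_vector_derivative_const[of "\<epsilon> *\<^sub>R mat 1"]]
      by (simp add: matrix_mul_assoc)
    from has_vector_derivative_matrix_inv[OF this inv norm_ridge_inv[OF R e]]
    have Mt: "((\<lambda>t. M (?Yt t)) has_vector_derivative - (M Y ** (ctranspose Y ** R ** b + ctranspose b ** R ** Y) ** M Y)) (at 0)"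
      by (simp add: M_def)
    have "((\<lambda>t. ?G (?Yt t)) has_vector_derivative
        (Y ** (- (M Y ** (ctranspose Y ** R ** b + ctranspose b ** R ** Y) ** M Y)) + b ** M Y) ** C) (at 0)"
      using mm[OF mm[OF Yt Mt] has_vector_derivative_const[of C]] by simp
    moreover have "(Y ** (- (M Y ** (ctranspose Y ** R ** b + ctranspose b ** R ** Y) ** M Y)) + b ** M Y) ** C = ?D b Y"
    proof -
      have neg: "A ** (- B) = - (A ** B)" for A :: "complex^'l^'k" and B :: "complex^'l^'l"
        using matrix_minus_ldistrib[of A 0 B] by simp
      show ?thesis by (simp add: neg matrix_distribs matrix_mul_assoc diff_conv_add_uminus[symmetric] add.commute[of "- _"] algebra_simps)
    qed
    ultimately show ?thesis by simp
  qed
  have div: "(\<Sum>b\<in>Basis. ?D b Y \<bullet> b) = 2 * (Re (trace (M Y ** C)) * (real CARD('k) - real CARD('l) + \<epsilon> * Re (trace (M Y))))" for Y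
  proof -
    have "trace (Y ** M Y ** ctranspose Y ** R) = trace (M Y ** (ctranspose Y ** R ** Y))"
      by (simp add: matrix_mul_assoc[symmetric], subst trace_mul_sym, simp add: matrix_mul_assoc)
    also have "ctranspose Y ** R ** Y = ridge R \<epsilon> Y - \<epsilon> *\<^sub>R mat 1" by (simp add: ridge_def)
    also have "trace (M Y ** (ridge R \<epsilon> Y - \<epsilon> *\<^sub>R mat 1)) = of_nat CARD('l) - \<epsilon> *\<^sub>R trace (M Y)"
      by (simp add: matrix_distribs trace_sub trace_scaleR M_def matrix_inv[OF inv] trace_I)
    also have "\<dots> = complex_of_real (real CARD('l) - \<epsilon> * Re (trace (M Y)))"
      using trace_pos_def_real[OF pos_def_matrix_inv[OF pos_def_ridge[OF R e, of Y]]]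
      by (simp add: M_def scaleR_conv_of_real)
    finally have P: "trace (Y ** M Y ** ctranspose Y ** R) = complex_of_real (real CARD('l) - \<epsilon> * Re (trace (M Y)))" .
    have "of_nat CARD('k) - complex_of_real (real CARD('l) - \<epsilon> * Re (trace (M Y)))
        = complex_of_real (real CARD('k) - real CARD('l) + \<epsilon> * Re (trace (M Y)))" by simp
    note k = this
    have "Re (z * complex_of_real r) = Re z * r" for z r by simp
    then show ?thesis unfolding sum_Basis_divergence P k by (simp only:)
  qed
  have [measurable]: "?D b \<in> borel_measurable borel" for b by measurable
  have m1: "(\<lambda>Y. (Y - X) \<bullet> ?G Y) \<in> borel_measurable borel"
    and m2: "(\<lambda>Y. Re (trace (M Y ** C)) * (real CARD('k) - real CARD('l) + \<epsilon> * Re (trace (M Y)))) \<in> borel_measurable borel"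
    by measurable
  have "(LBINT Y. ((Y - X) \<bullet> ?G Y) * exp (- (norm (Y - X))\<^sup>2)) = (LBINT Y. (\<Sum>b\<in>Basis. ?D b Y \<bullet> b) * exp (- (norm (Y - X))\<^sup>2)) / 2"
    by (rule stein[OF _ _ pbG pbD der]) measurable
  also have "\<dots> = (LBINT Y. (Re (trace (M Y ** C)) * (real CARD('k) - real CARD('l) + \<epsilon> * Re (trace (M Y)))) * exp (- (norm (Y - X))\<^sup>2))"
    unfolding div by (simp add: mult.assoc)
  finally show "integral\<^sup>L (cnormal X (mat 1)) (\<lambda>Y. (Y - X) \<bullet> (Y ** M Y ** C))
    = integral\<^sup>L (cnormal X (mat 1)) (\<lambda>Y. Re (trace (M Y ** C)) * (real CARD('k) - real CARD('l) + \<epsilon> * Re (trace (M Y))))"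
    unfolding integral_cnormal_1[OF m1] integral_cnormal_1[OF m2] by simp
qed

text \<open>Expanding the loss, Stein's identity turns the cross term into a divergence of favourable sign.\<close>

text \<open>Expand the square and apply Stein's identity to the mixed term; the part of the divergence with the factor \<open>\<epsilon>\<close> is nonnegative
  and is dropped.\<close>

lemma ridge_risk_bound:
  fixes R :: "complex^'k^'k" and C :: "complex^'l^'l" and X :: "complex^'l^'k"
  assumes R: "pos_def R" and C: "pos_def C" and e: "\<epsilon> > 0" and c: "c \<ge> 0" and kl: "CARD('l) < CARD('k)"
  defines "M \<equiv> \<lambda>Y. matrix_inv (ridge R \<epsilon> Y)" and "\<delta> \<equiv> real CARD('k) - real CARD('l)"
  shows "(\<integral>\<^sup>+Y. ennreal ((norm (Y - c *\<^sub>R (Y ** M Y ** C) - X))\<^sup>2) \<partial>cnormal X (mat 1))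
      + ennreal (2 * c * \<delta>) * (\<integral>\<^sup>+Y. ennreal (Re (trace (M Y ** C))) \<partial>cnormal X (mat 1))
    \<le> ennreal (real (CARD('k) * CARD('l))) + ennreal (c\<^sup>2) * (\<integral>\<^sup>+Y. ennreal ((norm (Y ** M Y ** C))\<^sup>2) \<partial>cnormal X (mat 1))"
proof -
  let ?P = "cnormal X (mat 1)" and ?G = "\<lambda>Y. Y ** M Y ** C" and ?d = "real (CARD('k) * CARD('l))"
  let ?tr = "\<lambda>Y. Re (trace (M Y ** C))" and ?div = "\<lambda>Y. Re (trace (M Y ** C)) * (\<delta> + \<epsilon> * Re (trace (M Y)))"
  have [measurable]: "M \<in> borel_measurable borel" unfolding M_def ridge_def by measurable
  have S1: "integral\<^sup>L ?P (\<lambda>Y. (Y - X) \<bullet> ?G Y) = integral\<^sup>L ?P ?div"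
    unfolding M_def \<delta>_def by (rule stein_ridge(1)[OF R e])
  have S: "poly_bounded ?G" unfolding M_def by (rule stein_ridge(2)[OF R e])
  have pbM: "poly_bounded M" unfolding M_def by (rule stein_ridge(3)[OF R e])
  have Mpd: "pos_def (M Y)" for Y unfolding M_def by (intro pos_def_matrix_inv pos_def_ridge R e)
  have tr0: "0 \<le> ?tr Y" for Y by (rule trace_pos_def_mult_nonneg[OF Mpd C])
  have trM0: "0 \<le> Re (trace (M Y))" for Y using trace_pos_def_mult_nonneg[OF Mpd pos_def_mat_1, of Y] by simp
  have bl: "bounded_linear (\<lambda>A :: complex^'l^'l. Re (trace A))"
    by (intro linear_conv_bounded_linear[THEN iffD1] linearI) (simp_all add: trace_add trace_scaleR)
  have pd: "poly_bounded (\<lambda>Y. Y - X)" using poly_bounded_add[OF poly_bounded_id poly_bounded_const[of "- X"]] by simp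
  have pbtr: "poly_bounded ?tr" by (intro poly_bounded_linear[OF bl] poly_bounded_matrix_mult pbM poly_bounded_const)
  have pbdiv: "poly_bounded ?div"
    by (intro poly_bounded_bilinear[OF bounded_bilinear_mult] pbtr poly_bounded_add poly_bounded_const poly_bounded_linear[OF bl] pbM)
  have i1: "integrable ?P (\<lambda>Y. (norm (Y - X))\<^sup>2)"
    unfolding power2_norm_eq_inner by (intro integrable_cnormal_1 poly_bounded_inner pd) measurable
  have i2: "integrable ?P (\<lambda>Y. (Y - X) \<bullet> ?G Y)"
    by (intro integrable_cnormal_1 poly_bounded_inner pd S) measurable
  have i3: "integrable ?P (\<lambda>Y. (norm (?G Y))\<^sup>2)"
    unfolding power2_norm_eq_inner by (intro integrable_cnormal_1 poly_bounded_inner S) measurable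
  have i4: "integrable ?P ?tr" by (intro integrable_cnormal_1 pbtr) measurable
  have i5: "integrable ?P ?div" by (intro integrable_cnormal_1 pbdiv) measurable
  have ex: "(norm (Y - c *\<^sub>R ?G Y - X))\<^sup>2 = (norm (Y - X))\<^sup>2 - 2 * c * ((Y - X) \<bullet> ?G Y) + c\<^sup>2 * (norm (?G Y))\<^sup>2" for Y
    using norm_sq_diff_scaleR[of "Y - X" c "?G Y"] by (simp add: algebra_simps)
  have i0: "integrable ?P (\<lambda>Y. (norm (Y - c *\<^sub>R ?G Y - X))\<^sup>2)" unfolding ex using i1 i2 i3 by simp
  have E1: "integral\<^sup>L ?P (\<lambda>Y. (norm (Y - X))\<^sup>2) = ?d"
    using nn_integral_cnormal_1_norm_sq[of X] i1
    by (subst (asm) nn_integral_eq_integral) (auto simp del: of_nat_mult)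
  have "integral\<^sup>L ?P (\<lambda>Y. (norm (Y - c *\<^sub>R ?G Y - X))\<^sup>2) = ?d - 2 * c * integral\<^sup>L ?P ?div + c\<^sup>2 * integral\<^sup>L ?P (\<lambda>Y. (norm (?G Y))\<^sup>2)"
    unfolding ex using i1 i2 i3 by (simp add: E1 S1 del: of_nat_mult)
  moreover have "\<delta> * integral\<^sup>L ?P ?tr \<le> integral\<^sup>L ?P ?div"
  proof -
    have "\<delta> * integral\<^sup>L ?P ?tr = integral\<^sup>L ?P (\<lambda>Y. \<delta> * ?tr Y)" by simp
    also have "\<dots> \<le> integral\<^sup>L ?P ?div"
    proof (rule integral_mono)
      show "\<delta> * ?tr Y \<le> ?div Y" for Y using tr0[of Y] trM0[of Y] e by (simp add: algebra_simps)
    qed (use i4 i5 in simp_all)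
    finally show ?thesis .
  qed
  from mult_left_mono[OF this, of "2 * c"] have "2 * c * \<delta> * integral\<^sup>L ?P ?tr \<le> 2 * c * integral\<^sup>L ?P ?div"
    using c by (simp add: mult.assoc)
  ultimately have "integral\<^sup>L ?P (\<lambda>Y. (norm (Y - c *\<^sub>R ?G Y - X))\<^sup>2) + 2 * c * \<delta> * integral\<^sup>L ?P ?tr
      \<le> ?d + c\<^sup>2 * integral\<^sup>L ?P (\<lambda>Y. (norm (?G Y))\<^sup>2)" by linarith
  then have "ennreal (integral\<^sup>L ?P (\<lambda>Y. (norm (Y - c *\<^sub>R ?G Y - X))\<^sup>2)) + ennreal (2 * c * \<delta>) * ennreal (integral\<^sup>L ?P ?tr)
      \<le> ennreal ?d + ennreal (c\<^sup>2) * ennreal (integral\<^sup>L ?P (\<lambda>Y. (norm (?G Y))\<^sup>2))"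
    using c kl tr0 by (simp add: ennreal_mult[symmetric] ennreal_plus[symmetric] \<delta>_def integral_nonneg del: ennreal_plus of_nat_mult)
  then show ?thesis
    using i0 i3 i4 tr0 by (simp add: nn_integral_eq_integral del: of_nat_mult)
qed

section \<open>Removing the ridge\<close>

lemma tendsto_det:
  fixes f :: "'b \<Rightarrow> complex^'n^'n"
  assumes "(f \<longlongrightarrow> A) F"
  shows "((\<lambda>x. det (f x)) \<longlongrightarrow> det A) F"
  unfolding det_def by (intro tendsto_intros tendsto_vec_nth assms)

lemma tendsto_matrix_inv:
  fixes f :: "'b \<Rightarrow> complex^'n^'n"
  assumes f: "(f \<longlongrightarrow> A) F" and A: "invertible A" and i: "\<And>x. invertible (f x)"
  shows "((\<lambda>x. matrix_inv (f x)) \<longlongrightarrow> matrix_inv A) F"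
proof -
  have nz: "det A \<noteq> 0" "det (f x) \<noteq> 0" for x using A i invertible_det_nz by blast+
  have inv: "matrix_inv B = (\<chi> i j. det (\<chi> a b. if b = i then mat 1 $ a $ j else B $ a $ b) / det B)"
    if "det B \<noteq> 0" for B :: "complex^'n^'n"
    using that by (subst matrix_inv_cramer) simp
  have "((\<lambda>x. \<chi> i j. det (\<chi> a b. if b = i then mat 1 $ a $ j else f x $ a $ b) / det (f x))
      \<longlongrightarrow> (\<chi> i j. det (\<chi> a b. if b = i then mat 1 $ a $ j else A $ a $ b) / det A)) F"
  proof (intro tendsto_vec_lambda tendsto_divide tendsto_det nz f)
    show "((\<lambda>x. if b = i then mat 1 $ a $ j else f x $ a $ b) \<longlongrightarrow> (if b = i then mat 1 $ a $ j else A $ a $ b)) F" for i j a b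
      by (cases "b = i") (auto intro!: tendsto_vec_nth f)
  qed
  then show ?thesis unfolding inv[OF nz(1)] inv[OF nz(2)] .
qed

lemma norm_matrix_vector_le:
  fixes A :: "complex^'n^'m"
  shows "norm (A *v v) \<le> norm A * norm v"
proof -
  have "norm ((A *v v) $ i) \<le> norm (A $ i) * norm v" for i
  proof -
    have "norm ((A *v v) $ i) \<le> (\<Sum>j\<in>UNIV. \<bar>norm (A $ i $ j)\<bar> * \<bar>norm (v $ j)\<bar>)"
      unfolding matrix_vector_mult_def by (simp, rule order_trans[OF norm_sum]) (simp add: norm_mult)
    also have "\<dots> \<le> norm (A $ i) * norm v"
      unfolding norm_vec_def by (rule L2_set_mult_ineq)
    finally show ?thesis .
  qed
  then have "norm (A *v v) \<le> L2_set (\<lambda>i. norm (A $ i) * norm v) UNIV"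
    unfolding norm_vec_def[of "A *v v"] by (intro L2_set_mono) simp_all
  also have "\<dots> = norm A * norm v"
    unfolding norm_vec_def[of A] by (simp add: L2_set_left_distrib)
  finally show ?thesis .
qed

lemma pos_def_inner_le_trace:
  fixes M :: "complex^'n^'n"
  assumes "pos_def M"
  shows "v \<bullet> (M *v v) \<le> Re (trace M) * (norm v)\<^sup>2"
proof -
  obtain B :: "complex^'n^'n" where B: "M = B ** ctranspose B" using pos_def_factor[OF assms] by metis
  have "v \<bullet> (M *v v) = (norm (ctranspose B *v v))\<^sup>2"
    unfolding power2_norm_eq_inner B matrix_vector_mul_assoc[symmetric]
    by (subst inner_matrix_vector_ctranspose) simp
  also have "\<dots> \<le> (norm (ctranspose B) * norm v)\<^sup>2"
    by (intro power_mono norm_matrix_vector_le) simp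
  also have "\<dots> = Re (trace M) * (norm v)\<^sup>2"
    by (simp add: power_mult_distrib norm_ctranspose norm_sq_trace B)
  finally show ?thesis .
qed

lemma matrix_vector_mult_scaleR_right: "A *v (c *\<^sub>R v) = c *\<^sub>R (A *v v)" for A :: "complex^'n^'m"
  by (simp add: vec_eq_iff matrix_vector_mult_def scaleR_right.sum)

text \<open>The trace of the shifted inverse dominates the squared norm of the correction, and blows up with \<open>1 / \<epsilon>\<close> at singular Gram matrices.\<close>

lemma ridge_trace_bounds:
  fixes Y :: "complex^'l^'k"
  assumes e: "\<epsilon> > 0"
  defines "M \<equiv> matrix_inv (ridge (mat 1) \<epsilon> Y)"
  shows "(norm (Y ** M))\<^sup>2 \<le> Re (trace M)"
    and "\<not> invertible (ctranspose Y ** Y) \<Longrightarrow> 1 / \<epsilon> \<le> Re (trace M)"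
proof -
  have pd: "pos_def (ridge (mat 1) \<epsilon> Y)" by (rule pos_def_ridge[OF pos_def_mat_1 e])
  note inv = matrix_inv[OF pos_def_invertible[OF pd], folded M_def]
  have Mpd: "pos_def M" unfolding M_def by (rule pos_def_matrix_inv[OF pd])
  note hM = pos_def_hermitian[OF Mpd]
  have W: "ctranspose Y ** Y = ridge (mat 1) \<epsilon> Y - \<epsilon> *\<^sub>R mat 1" by (simp add: ridge_def)
  have "(norm (Y ** M))\<^sup>2 = Re (trace (M ** (ctranspose Y ** Y) ** M))"
    unfolding power2_norm_eq_inner inner_matrix_trace by (simp add: ctranspose_mult hM matrix_mul_assoc)
  also have "\<dots> = Re (trace M) - \<epsilon> * Re (trace (M ** M))"
    unfolding W by (simp add: matrix_distribs inv trace_sub trace_scaleR)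
  also have "\<dots> \<le> Re (trace M)"
    using e trace_pos_def_mult_nonneg[OF Mpd Mpd] by simp
  finally show "(norm (Y ** M))\<^sup>2 \<le> Re (trace M)" .
  assume "\<not> invertible (ctranspose Y ** Y)"
  then obtain v where v: "(ctranspose Y ** Y) *v v = 0" "v \<noteq> 0" by (auto simp: invertible_iff_ker)
  have "ridge (mat 1) \<epsilon> Y *v v = \<epsilon> *\<^sub>R v"
    by (simp add: ridge_def matrix_vector_mult_add_rdistrib scaleR_matrix_vector_mult v)
  then have "(M ** ridge (mat 1) \<epsilon> Y) *v v = \<epsilon> *\<^sub>R (M *v v)"
    by (simp add: matrix_vector_mul_assoc[symmetric] matrix_vector_mult_scaleR_right)
  then have "v = \<epsilon> *\<^sub>R (M *v v)" by (simp add: inv)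
  then have "v \<bullet> v = \<epsilon> * (v \<bullet> (M *v v))" by (metis inner_scaleR_right)
  then have "v \<bullet> (M *v v) = (norm v)\<^sup>2 / \<epsilon>" using e by (simp add: power2_norm_eq_inner field_simps)
  with pos_def_inner_le_trace[OF Mpd, of v] have "(norm v)\<^sup>2 / \<epsilon> \<le> Re (trace M) * (norm v)\<^sup>2" by simp
  then show "1 / \<epsilon> \<le> Re (trace M)"
    using v(2) mult_le_cancel_right[of "1 / \<epsilon>" "(norm v)\<^sup>2" "Re (trace M)"] by simp
qed

text \<open>Uniform bound for the mean trace: the risk bound with coefficient \<open>k - l\<close>, whose first term is nonnegative.\<close>

lemma nn_integral_trace_ridge_inv:
  fixes X :: "complex^'l^'k"
  assumes e: "\<epsilon> > 0" and kl: "CARD('l) < CARD('k)"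
  defines "\<delta> \<equiv> real CARD('k) - real CARD('l)"
  shows "(\<integral>\<^sup>+Y. ennreal (Re (trace (matrix_inv (ridge (mat 1) \<epsilon> Y)))) \<partial>cnormal X (mat 1))
    \<le> ennreal (real (CARD('k) * CARD('l)) / \<delta>\<^sup>2)"
proof -
  let ?P = "cnormal X (mat 1)" and ?M = "\<lambda>Y :: complex^'l^'k. matrix_inv (ridge (mat 1) \<epsilon> Y)" and ?d = "real (CARD('k) * CARD('l))"
  interpret prob_space ?P by (rule prob_space_cnormal_1)
  have [measurable]: "?M \<in> borel_measurable borel" unfolding ridge_def by measurable
  have d: "\<delta> > 0" using kl by (simp add: \<delta>_def)
  let ?t = "\<integral>\<^sup>+Y. ennreal (Re (trace (?M Y))) \<partial>?P"
  have "?t \<le> (\<integral>\<^sup>+Y. ennreal (norm (mat 1 :: complex^'l^'l) * (norm (mat 1 :: complex^'l^'l) / \<epsilon>)) \<partial>?P)"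
  proof (intro nn_integral_mono ennreal_leI)
    fix Y
    have "Re (trace (?M Y)) = (mat 1) \<bullet> ?M Y" by (simp add: inner_matrix_trace)
    also have "\<dots> \<le> norm (mat 1 :: complex^'l^'l) * norm (?M Y)" by (rule norm_cauchy_schwarz)
    also have "\<dots> \<le> norm (mat 1 :: complex^'l^'l) * (norm (mat 1 :: complex^'l^'l) / \<epsilon>)"
      by (intro mult_left_mono norm_ridge_inv e pos_def_mat_1) simp
    finally show "Re (trace (?M Y)) \<le> norm (mat 1 :: complex^'l^'l) * (norm (mat 1 :: complex^'l^'l) / \<epsilon>)" .
  qed
  also have "\<dots> < \<infinity>" using emeasure_space_1 by simp
  finally obtain t where t: "?t = ennreal t" "t \<ge> 0" by (cases ?t rule: ennreal_cases) auto
  have "ennreal (2 * \<delta> * \<delta>) * ?t \<le> ennreal ?d + ennreal (\<delta>\<^sup>2) * (\<integral>\<^sup>+Y. ennreal ((norm (Y ** ?M Y ** mat 1))\<^sup>2) \<partial>?P)"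
  proof -
    have "?t = (\<integral>\<^sup>+Y. ennreal (Re (trace (?M Y ** mat 1))) \<partial>?P)" by simp
    then have "(\<integral>\<^sup>+Y. ennreal ((norm (Y - \<delta> *\<^sub>R (Y ** ?M Y ** mat 1) - X))\<^sup>2) \<partial>?P) + ennreal (2 * \<delta> * \<delta>) * ?t
        \<le> ennreal ?d + ennreal (\<delta>\<^sup>2) * (\<integral>\<^sup>+Y. ennreal ((norm (Y ** ?M Y ** mat 1))\<^sup>2) \<partial>?P)"
      using ridge_risk_bound[OF pos_def_mat_1 pos_def_mat_1 e less_imp_le[OF d] kl, of X, folded \<delta>_def] by (simp only:)
    then show ?thesis by (rule order_trans[OF add_increasing[OF zero_le order_refl]])
  qed
  also have "\<dots> \<le> ennreal ?d + ennreal (\<delta>\<^sup>2) * ?t"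
    by (intro add_left_mono mult_left_mono nn_integral_mono ennreal_leI) (simp_all add: ridge_trace_bounds(1)[OF e])
  finally have "2 * \<delta> * \<delta> * t \<le> ?d + \<delta>\<^sup>2 * t"
    using t d by (simp add: ennreal_mult[symmetric] ennreal_plus[symmetric] del: ennreal_plus of_nat_mult)
  then have "t \<le> ?d / \<delta>\<^sup>2" using d by (simp add: field_simps power2_eq_square)
  then show ?thesis using t by (simp add: ennreal_leI)
qed

text \<open>On the singular set the trace of the shifted inverse is at least \<open>1 / \<epsilon>\<close>, while its mean is bounded uniformly in \<open>\<epsilon>\<close>.\<close>

lemma AE_cnormal_gram_invertible:
  fixes X :: "complex^'l^'k"
  assumes kl: "CARD('l) < CARD('k)"
  shows "AE Y in cnormal X (mat 1). invertible (ctranspose Y ** Y)"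
proof -
  let ?P = "cnormal X (mat 1)" and ?N = "{Y :: complex^'l^'k. \<not> invertible (ctranspose Y ** Y)}"
  have "?N = {Y \<in> space borel. det (ctranspose Y ** Y) = 0}" by (simp add: invertible_det_nz)
  also have "\<dots> \<in> sets borel" by measurable
  finally have N: "?N \<in> sets ?P" by simp
  define K where "K = real (CARD('k) * CARD('l)) / (real CARD('k) - real CARD('l))\<^sup>2"
  have "emeasure ?P ?N \<le> ennreal (r * K)" if r: "r > 0" for r
  proof -
    have "ennreal (1 / r) * emeasure ?P ?N = (\<integral>\<^sup>+Y. ennreal (1 / r) * indicator ?N Y \<partial>?P)"
      using N by (subst nn_integral_cmult) simp_all
    also have "\<dots> \<le> (\<integral>\<^sup>+Y. ennreal (Re (trace (matrix_inv (ridge (mat 1) r Y)))) \<partial>?P)"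
      using ridge_trace_bounds(2)[OF r] by (intro nn_integral_mono) (auto simp: indicator_def intro!: ennreal_leI)
    also have "\<dots> \<le> ennreal K" unfolding K_def by (rule nn_integral_trace_ridge_inv[OF r kl])
    finally have "ennreal r * (ennreal (1 / r) * emeasure ?P ?N) \<le> ennreal r * ennreal K" by (rule mult_left_mono) simp
    then show ?thesis using r by (simp add: mult.assoc[symmetric] ennreal_mult'[symmetric])
  qed
  note le = this
  have "((\<lambda>r. ennreal (r * K)) \<longlongrightarrow> ennreal (0 * K)) (at_right 0)"
    by (intro tendsto_ennrealI tendsto_intros)
  then have "emeasure ?P ?N \<le> ennreal (0 * K)"
    by (rule tendsto_lowerbound) (auto intro!: eventually_at_rightI[of 0 1] le)
  then have "emeasure ?P ?N = 0" by simp
  then show ?thesis using N by (intro AE_I[of _ _ ?N]) auto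
qed

lemma gram_ker: "invertible (ctranspose Y ** Y) \<Longrightarrow> Y *v x = 0 \<Longrightarrow> x = 0" for Y :: "complex^'l^'k"
  by (metis invertible_iff_ker matrix_vector_mul_assoc matrix_vector_mult_0_right)

lemma pos_def_gram: "invertible (ctranspose Y ** Y) \<Longrightarrow> pos_def R \<Longrightarrow> pos_def (ctranspose Y ** R ** Y)" for Y :: "complex^'l^'k"
  using gram_ker by (intro pos_def_congruence) auto

lemma ridge_inv_tendsto:
  fixes Y :: "complex^'l^'k"
  assumes Y: "invertible (ctranspose Y ** Y)" and R: "pos_def R"
  shows "(\<lambda>n. matrix_inv (ridge R (1 / real (Suc n)) Y)) \<longlonglongrightarrow> matrix_inv (ctranspose Y ** R ** Y)"
proof (rule tendsto_matrix_inv)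
  have "(\<lambda>n. 1 / real (Suc n)) \<longlonglongrightarrow> 0" using LIMSEQ_inverse_real_of_nat by (simp add: inverse_eq_divide)
  then have "(\<lambda>n. ctranspose Y ** R ** Y + (1 / real (Suc n)) *\<^sub>R mat 1) \<longlonglongrightarrow> ctranspose Y ** R ** Y + 0 *\<^sub>R mat 1"
    by (intro tendsto_add tendsto_const tendsto_scaleR)
  then show "(\<lambda>n. ridge R (1 / real (Suc n)) Y) \<longlonglongrightarrow> ctranspose Y ** R ** Y"
    unfolding ridge_def by simp
  show "invertible (ctranspose Y ** R ** Y)" by (intro pos_def_invertible pos_def_gram Y R)
  show "invertible (ridge R (1 / real (Suc n)) Y)" for n by (intro pos_def_invertible pos_def_ridge R) simp
qed

lemma nn_integral_trace_gram_inv_finite: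
  fixes X :: "complex^'l^'k"
  assumes kl: "CARD('l) < CARD('k)"
  shows "(\<integral>\<^sup>+Y. ennreal (Re (trace (matrix_inv (ctranspose Y ** Y)))) \<partial>cnormal X (mat 1)) < \<infinity>"
proof -
  let ?P = "cnormal X (mat 1)"
  define K where "K = real (CARD('k) * CARD('l)) / (real CARD('k) - real CARD('l))\<^sup>2"
  let ?f = "\<lambda>n Y. ennreal (Re (trace (matrix_inv (ridge (mat 1) (1 / real (Suc n)) Y))))"
  have "(\<integral>\<^sup>+Y. ennreal (Re (trace (matrix_inv (ctranspose Y ** Y)))) \<partial>?P) = (\<integral>\<^sup>+Y. liminf (\<lambda>n. ?f n Y) \<partial>?P)"
  proof (rule nn_integral_cong_AE)
    have "liminf (\<lambda>n. ?f n Y) = ennreal (Re (trace (matrix_inv (ctranspose Y ** Y))))"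
      if "invertible (ctranspose Y ** Y)" for Y :: "complex^'l^'k"
      unfolding trace_def
      using ridge_inv_tendsto[OF that pos_def_mat_1]
      by (intro lim_imp_Liminf tendsto_ennrealI tendsto_Re tendsto_sum tendsto_vec_nth) simp_all
    note L = this
    show "AE Y in ?P. ennreal (Re (trace (matrix_inv (ctranspose Y ** Y)))) = liminf (\<lambda>n. ?f n Y)"
      using AE_cnormal_gram_invertible[OF kl] by eventually_elim (rule L[symmetric])
  qed
  also have "\<dots> \<le> liminf (\<lambda>n. \<integral>\<^sup>+Y. ?f n Y \<partial>?P)"
    unfolding ridge_def by (rule nn_integral_liminf) measurable
  also have "\<dots> \<le> liminf (\<lambda>n. ennreal K)"
    unfolding K_def by (intro Liminf_mono always_eventually allI nn_integral_trace_ridge_inv kl) simp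
  also have "\<dots> < \<infinity>" by (simp add: Liminf_const)
  finally show ?thesis .
qed

text \<open>Fatou's lemma lets the ridge tend to zero, provided it only shrinks the correction term.\<close>

lemma shrinkage_risk_bound:
  fixes R :: "complex^'k^'k" and C :: "complex^'l^'l" and X :: "complex^'l^'k"
  assumes R: "pos_def R" and C: "pos_def C" and c: "c \<ge> 0" and kl: "CARD('l) < CARD('k)"
    and mono: "\<And>Y \<epsilon>. invertible (ctranspose Y ** Y) \<Longrightarrow> \<epsilon> > 0 \<Longrightarrow>
      norm (Y ** matrix_inv (ridge R \<epsilon> Y) ** C) \<le> norm (Y ** matrix_inv (ctranspose Y ** R ** Y) ** C)"
  defines "M \<equiv> \<lambda>Y. matrix_inv (ctranspose Y ** R ** Y)" and "\<delta> \<equiv> real CARD('k) - real CARD('l)"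
  shows "(\<integral>\<^sup>+Y. ennreal ((norm (Y - c *\<^sub>R (Y ** M Y ** C) - X))\<^sup>2) \<partial>cnormal X (mat 1))
      + ennreal (2 * c * \<delta>) * (\<integral>\<^sup>+Y. ennreal (Re (trace (M Y ** C))) \<partial>cnormal X (mat 1))
    \<le> ennreal (real (CARD('k) * CARD('l))) + ennreal (c\<^sup>2) * (\<integral>\<^sup>+Y. ennreal ((norm (Y ** M Y ** C))\<^sup>2) \<partial>cnormal X (mat 1))"
proof -
  let ?P = "cnormal X (mat 1)" and ?d = "real (CARD('k) * CARD('l))"
  define N where "N n Y = matrix_inv (ridge R (1 / real (Suc n)) Y)" for n and Y :: "complex^'l^'k"
  have [measurable]: "N n \<in> borel_measurable borel" "M \<in> borel_measurable borel" for n
    unfolding N_def[abs_def] M_def ridge_def by measurable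
  let ?h = "\<lambda>N Y. ennreal ((norm (Y - c *\<^sub>R (Y ** N Y ** C) - X))\<^sup>2) + ennreal (2 * c * \<delta>) * ennreal (Re (trace (N Y ** C)))"
  have split: "(\<integral>\<^sup>+Y. ?h N Y \<partial>?P) = (\<integral>\<^sup>+Y. ennreal ((norm (Y - c *\<^sub>R (Y ** N Y ** C) - X))\<^sup>2) \<partial>?P)
      + ennreal (2 * c * \<delta>) * (\<integral>\<^sup>+Y. ennreal (Re (trace (N Y ** C))) \<partial>?P)"
    if [measurable]: "N \<in> borel_measurable borel" for N
    by (simp add: nn_integral_add nn_integral_cmult)
  have "(\<integral>\<^sup>+Y. ?h M Y \<partial>?P) = (\<integral>\<^sup>+Y. liminf (\<lambda>n. ?h (N n) Y) \<partial>?P)"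
  proof (rule nn_integral_cong_AE)
    have "liminf (\<lambda>n. ?h (N n) Y) = ?h M Y" if "invertible (ctranspose Y ** Y)" for Y :: "complex^'l^'k"
    proof (rule lim_imp_Liminf)
      have lim: "(\<lambda>n. N n Y) \<longlonglongrightarrow> M Y" unfolding N_def M_def by (rule ridge_inv_tendsto[OF that R])
      note mm = bounded_bilinear.tendsto[OF bounded_bilinear_matrix_mult]
      have NC: "(\<lambda>n. N n Y ** C) \<longlonglongrightarrow> M Y ** C" by (intro mm lim tendsto_const)
      have tr: "(\<lambda>n. trace (N n Y ** C)) \<longlonglongrightarrow> trace (M Y ** C)"
        unfolding trace_def by (intro tendsto_sum tendsto_vec_nth NC)
      show "(\<lambda>n. ?h (N n) Y) \<longlonglongrightarrow> ?h M Y"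
        by (intro tendsto_add tendsto_ennrealI tendsto_power tendsto_norm tendsto_diff tendsto_const tendsto_scaleR mm lim
            ennreal_tendsto_cmult tendsto_Re tr) simp
    qed simp
    note L = this
    show "AE Y in ?P. ?h M Y = liminf (\<lambda>n. ?h (N n) Y)"
      using AE_cnormal_gram_invertible[OF kl] by eventually_elim (rule L[symmetric])
  qed
  also have "\<dots> \<le> liminf (\<lambda>n. \<integral>\<^sup>+Y. ?h (N n) Y \<partial>?P)"
    by (rule nn_integral_liminf) measurable
  also have "\<dots> \<le> liminf (\<lambda>n. ennreal ?d + ennreal (c\<^sup>2) * (\<integral>\<^sup>+Y. ennreal ((norm (Y ** M Y ** C))\<^sup>2) \<partial>?P))"
  proof (intro Liminf_mono always_eventually allI)
    fix n
    have "(\<integral>\<^sup>+Y. ?h (N n) Y \<partial>?P) \<le> ennreal ?d + ennreal (c\<^sup>2) * (\<integral>\<^sup>+Y. ennreal ((norm (Y ** N n Y ** C))\<^sup>2) \<partial>?P)"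
      unfolding split[OF \<open>N n \<in> _\<close>] unfolding N_def \<delta>_def by (rule ridge_risk_bound[OF R C _ c kl]) simp
    also have "\<dots> \<le> ennreal ?d + ennreal (c\<^sup>2) * (\<integral>\<^sup>+Y. ennreal ((norm (Y ** M Y ** C))\<^sup>2) \<partial>?P)"
    proof (intro add_left_mono mult_left_mono nn_integral_mono_AE)
      show "AE Y in ?P. ennreal ((norm (Y ** N n Y ** C))\<^sup>2) \<le> ennreal ((norm (Y ** M Y ** C))\<^sup>2)"
        using AE_cnormal_gram_invertible[OF kl] unfolding N_def M_def
        by eventually_elim (intro ennreal_leI power_mono mono, simp_all)
    qed simp
    finally show "(\<integral>\<^sup>+Y. ?h (N n) Y \<partial>?P) \<le> ennreal ?d + ennreal (c\<^sup>2) * (\<integral>\<^sup>+Y. ennreal ((norm (Y ** M Y ** C))\<^sup>2) \<partial>?P)" .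
  qed
  also have "\<dots> = ennreal ?d + ennreal (c\<^sup>2) * (\<integral>\<^sup>+Y. ennreal ((norm (Y ** M Y ** C))\<^sup>2) \<partial>?P)"
    by (simp add: Liminf_const)
  finally show ?thesis unfolding split[OF \<open>M \<in> _\<close>] .
qed

text \<open>With \<open>N\<close> the shifted inverse and \<open>P\<close> the inverse of the Gram matrix, \<open>P = N + \<epsilon> *\<^sub>R (N ** P)\<close>. So the squared norm
  on the right exceeds that on the left by a square and the cross term, and only the sign of the latter matters.\<close>

lemma ridge_shrinks:
  fixes R :: "complex^'k^'k" and C :: "complex^'l^'l" and Y :: "complex^'l^'k"
  assumes R: "pos_def R" and Y: "invertible (ctranspose Y ** Y)" and e: "\<epsilon> > 0"
  defines "N \<equiv> matrix_inv (ridge R \<epsilon> Y)" and "P \<equiv> matrix_inv (ctranspose Y ** R ** Y)"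
  assumes cross: "0 \<le> (Y ** N ** C) \<bullet> (Y ** N ** P ** C)"
  shows "norm (Y ** N ** C) \<le> norm (Y ** P ** C)"
proof -
  have Q: "pos_def (ctranspose Y ** R ** Y)" by (rule pos_def_gram[OF Y R])
  note iP = matrix_inv[OF pos_def_invertible[OF Q], folded P_def]
  note iN = matrix_inv[OF pos_def_invertible[OF pos_def_ridge[OF R e, of Y]], folded N_def]
  have "ridge R \<epsilon> Y ** P = mat 1 + \<epsilon> *\<^sub>R P"
    unfolding ridge_def by (simp add: matrix_distribs iP)
  then have "N ** ridge R \<epsilon> Y ** P = N + \<epsilon> *\<^sub>R (N ** P)"
    unfolding matrix_mul_assoc[symmetric] by (simp add: matrix_distribs)
  then have "P = N + \<epsilon> *\<^sub>R (N ** P)" by (simp add: iN)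
  from arg_cong[OF this, of "\<lambda>B. Y ** B ** C"] have "Y ** P ** C = Y ** N ** C + \<epsilon> *\<^sub>R (Y ** N ** P ** C)"
    by (simp add: matrix_distribs matrix_mul_assoc)
  then have "(norm (Y ** P ** C))\<^sup>2 = (norm (Y ** N ** C))\<^sup>2 + 2 * \<epsilon> * ((Y ** N ** C) \<bullet> (Y ** N ** P ** C)) + \<epsilon>\<^sup>2 * (norm (Y ** N ** P ** C))\<^sup>2"
    using norm_sq_diff_scaleR[of "Y ** N ** C" "- \<epsilon>" "Y ** N ** P ** C"] by simp
  then have "(norm (Y ** N ** C))\<^sup>2 \<le> (norm (Y ** P ** C))\<^sup>2" using cross e by simp
  then show ?thesis by (rule power2_le_imp_le) simp
qed

section \<open>The risk of the Efron-Morris estimator at the identity covariance\<close>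

lemma AE_cwishartI: "(\<And>S. pos_def S \<Longrightarrow> P S) \<Longrightarrow> AE S in cwishart \<Sigma> n. P S"
  by (rule AE_mp[OF AE_cwishart_pos_def]) auto

text \<open>For the identity weight, \<open>N\<close> commutes with the Gram matrix, and the cross term is the squared norm of \<open>N ** C\<close>.\<close>

lemma ridge_shrinks_identity_weight:
  fixes Y :: "complex^'l^'k" and C :: "complex^'l^'l"
  assumes Y: "invertible (ctranspose Y ** Y)" and e: "\<epsilon> > 0"
  shows "norm (Y ** matrix_inv (ridge (mat 1) \<epsilon> Y) ** C) \<le> norm (Y ** matrix_inv (ctranspose Y ** mat 1 ** Y) ** C)"
proof (rule ridge_shrinks[OF pos_def_mat_1 Y e])
  let ?N = "matrix_inv (ridge (mat 1) \<epsilon> Y)" and ?P = "matrix_inv (ctranspose Y ** mat 1 ** Y)"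
  have h: "ctranspose ?N = ?N" by (intro pos_def_hermitian pos_def_matrix_inv pos_def_ridge pos_def_mat_1 e)
  have iP: "ctranspose Y ** Y ** ?P = mat 1" using matrix_inv(1)[OF Y] by simp
  have iN: "?N ** ridge (mat 1) \<epsilon> Y = mat 1" "ridge (mat 1) \<epsilon> Y ** ?N = mat 1"
    using matrix_inv[OF pos_def_invertible[OF pos_def_ridge[OF pos_def_mat_1 e]]] by blast+
  have W: "ctranspose Y ** Y = ridge (mat 1) \<epsilon> Y - \<epsilon> *\<^sub>R mat 1" by (simp add: ridge_def)
  have comm: "ctranspose Y ** Y ** ?N = ?N ** (ctranspose Y ** Y)"
    unfolding W by (simp add: matrix_distribs iN)
  have "ctranspose (Y ** ?N ** C) ** (Y ** ?N ** ?P ** C) = ctranspose C ** ?N ** (ctranspose Y ** Y ** ?N) ** ?P ** C"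
    by (simp add: ctranspose_mult h matrix_mul_assoc)
  also have "\<dots> = ctranspose C ** ?N ** ?N ** (ctranspose Y ** Y ** ?P) ** C"
    unfolding comm by (simp add: matrix_mul_assoc)
  also have "\<dots> = ctranspose (?N ** C) ** (?N ** C)"
    unfolding iP by (simp add: ctranspose_mult h matrix_mul_assoc)
  finally show "0 \<le> (Y ** ?N ** C) \<bullet> (Y ** ?N ** ?P ** C)"
    unfolding inner_matrix_trace[of "Y ** ?N ** C"] by (simp flip: inner_matrix_trace)
qed

text \<open>For \<open>C = mat 1\<close>, the cross term is a value of the quadratic form of the positive definite matrix \<open>P\<close>.\<close>

lemma ridge_shrinks_identity_factor:
  fixes Y :: "complex^'l^'k"
  assumes Y: "invertible (ctranspose Y ** Y)" and R: "pos_def R" and e: "\<epsilon> > 0"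
  shows "norm (Y ** matrix_inv (ridge R \<epsilon> Y) ** mat 1) \<le> norm (Y ** matrix_inv (ctranspose Y ** R ** Y) ** mat 1)"
proof (rule ridge_shrinks[OF R Y e])
  let ?B = "Y ** matrix_inv (ridge R \<epsilon> Y)" and ?P = "matrix_inv (ctranspose Y ** R ** Y)"
  have P: "pos_def ?P" by (intro pos_def_matrix_inv pos_def_gram Y R)
  have "?B \<bullet> (?B ** ?P) = ctranspose ?B \<bullet> (?P ** ctranspose ?B)"
    unfolding inner_matrix_trace ctranspose_ctranspose
    by (subst trace_mul_sym) (simp only: matrix_mul_assoc)
  then show "0 \<le> (Y ** matrix_inv (ridge R \<epsilon> Y) ** mat 1) \<bullet> (Y ** matrix_inv (ridge R \<epsilon> Y) ** ?P ** mat 1)"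
    using inner_pos_def_nonneg[OF P, of "ctranspose ?B"] by simp
qed

text \<open>The adjoint preserves Lebesgue measure, as it preserves the standard Gaussian.\<close>

lemma nn_integral_cnormal_ctranspose:
  fixes X :: "complex^'p^'m"
  assumes [measurable]: "f \<in> borel_measurable borel"
  shows "(\<integral>\<^sup>+Z. f Z \<partial>cnormal X (mat 1)) = (\<integral>\<^sup>+Y. f (ctranspose Y) \<partial>cnormal (ctranspose X) (mat 1))"
proof -
  let ?T = "ctranspose :: complex^'m^'p \<Rightarrow> complex^'p^'m"
  have bij: "bij ?T" by (rule bij_betw_byWitness[where f'=ctranspose]) auto
  have "jac ?T = 1"
  proof (rule jac_unique[OF linear_ctranspose bij, where f="\<lambda>z. ennreal (exp (- (1 * (norm z)\<^sup>2)))"])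
    show "(\<integral>\<^sup>+x. ennreal (exp (- (1 * (norm (?T x))\<^sup>2))) \<partial>lborel) = ennreal 1 * (\<integral>\<^sup>+z. ennreal (exp (- (1 * (norm (z :: complex^'p^'m))\<^sup>2))) \<partial>lborel)"
      using nn_integral_gauss[of 1, where 'a="complex^'m^'p", unfolded div_by_1 sqrt_pi_DIM]
        nn_integral_gauss[of 1, where 'a="complex^'p^'m", unfolded div_by_1 sqrt_pi_DIM]
      by (simp add: norm_ctranspose mult.commute)
    show "(\<integral>\<^sup>+z. ennreal (exp (- (1 * (norm (z :: complex^'p^'m))\<^sup>2))) \<partial>lborel) \<noteq> 0"
      "(\<integral>\<^sup>+z. ennreal (exp (- (1 * (norm (z :: complex^'p^'m))\<^sup>2))) \<partial>lborel) \<noteq> \<infinity>"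
      using nn_integral_gauss[of 1, where 'a="complex^'p^'m", unfolded div_by_1 sqrt_pi_DIM] by simp_all
  qed simp_all
  then have j: "(\<integral>\<^sup>+Y. h (?T Y) \<partial>lborel) = (\<integral>\<^sup>+Z. h Z \<partial>lborel)" if "h \<in> borel_measurable borel" for h
    using nn_integral_linear[OF linear_ctranspose bij that] by simp
  have n: "norm (ctranspose Y - X) = norm (Y - ctranspose X)" for Y
    using norm_ctranspose[of "Y - ctranspose X"] by (simp add: ctranspose_diff)
  show ?thesis
    using j[of "\<lambda>Z. ennreal (exp (- (norm (Z - X))\<^sup>2) / pi ^ (CARD('m) * CARD('p))) * f Z"]
    by (simp add: nn_integral_cnormal_1 n mult.commute[of "CARD('p)"])
qed

lemma loss_mat_1: "loss \<Xi> (mat 1) d = (norm (d - \<Xi>))\<^sup>2"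
  unfolding power2_norm_eq_inner inner_matrix_trace by (simp add: loss_def)

lemma measurable_loss [measurable (raw)]:
  assumes [measurable]: "f \<in> borel_measurable M"
  shows "(\<lambda>x. loss \<Xi> \<Sigma> (f x)) \<in> borel_measurable M"
  unfolding loss_def by measurable

lemma measurable_efron_morris [measurable (raw)]:
  fixes f :: "'b \<Rightarrow> complex^'p^'m"
  assumes [measurable]: "f \<in> borel_measurable M" "g \<in> borel_measurable M"
  shows "(\<lambda>x. efron_morris n (f x) (g x)) \<in> borel_measurable M"
  unfolding efron_morris_def Let_def
  by (cases "real CARD('p) < real CARD('m)") simp_all

text \<open>At \<open>c = \<delta> / \<mu>\<close> the gain linear in \<open>c\<close> is twice the quadratic loss. Finiteness of \<open>b\<close> allows the loss to be cancelled in the extended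
  reals.\<close>

lemma optimal_constant_bound:
  fixes r b :: ennreal
  assumes le: "r + ennreal (2 * c * \<delta>) * (ennreal \<nu> * b) \<le> ennreal d + ennreal (c\<^sup>2) * (ennreal (\<nu> * \<mu>) * b)"
    and c: "c * \<mu> = \<delta>" and nn: "c \<ge> 0" "\<mu> \<ge> 0" "\<nu> \<ge> 0" and b: "b < \<infinity>"
  shows "r \<le> ennreal d"
proof -
  obtain b' where b': "b = ennreal b'" "b' \<ge> 0" using b by (cases b rule: ennreal_cases) auto
  have d0: "\<delta> \<ge> 0" using c nn by auto
  have "ennreal (c\<^sup>2) * (ennreal (\<nu> * \<mu>) * b) = ennreal (c * \<delta> * \<nu> * b')"
    using nn b' by (simp add: ennreal_mult[symmetric] c[symmetric] power2_eq_square mult_ac)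
  moreover have "ennreal (2 * c * \<delta>) * (ennreal \<nu> * b) = ennreal (2 * (c * \<delta> * \<nu> * b'))"
    using nn b' d0 by (simp add: ennreal_mult[symmetric] mult_ac)
  ultimately have "r + ennreal (2 * (c * \<delta> * \<nu> * b')) \<le> ennreal d + ennreal (c * \<delta> * \<nu> * b')"
    using le by simp
  moreover have "0 \<le> c * \<delta> * \<nu> * b'" using nn b' d0 by simp
  then have "ennreal (c * \<delta> * \<nu> * b') \<le> ennreal (2 * (c * \<delta> * \<nu> * b'))" by (intro ennreal_leI) linarith
  ultimately have "r + ennreal (c * \<delta> * \<nu> * b') \<le> ennreal d + ennreal (c * \<delta> * \<nu> * b')"
    by (meson add_left_mono order_trans)
  then show ?thesis by (simp add: ennreal_add_left_cancel_le add.commute[of _ "ennreal (c * \<delta> * \<nu> * b')"])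
qed

lemma risk_mat_1:
  fixes \<Xi> :: "complex^'p^'m" and \<delta> :: "(complex^'p^'m) \<times> (complex^'p^'p) \<Rightarrow> complex^'p^'m"
  assumes n: "n > real CARD('p) - 1" and [measurable]: "\<delta> \<in> borel_measurable borel"
  shows "risk n \<delta> \<Xi> (mat 1) = (\<integral>\<^sup>+S. (\<integral>\<^sup>+Z. ennreal ((norm (\<delta> (Z, S) - \<Xi>))\<^sup>2) \<partial>cnormal \<Xi> (mat 1)) \<partial>cwishart (mat 1) n)"
proof -
  interpret P: prob_space "cnormal \<Xi> (mat 1)" by (rule prob_space_cnormal_1)
  interpret Q: prob_space "cwishart (mat 1 :: complex^'p^'p) n" by (rule prob_space_cwishart_1[OF n])
  interpret PQ: pair_prob_space "cnormal \<Xi> (mat 1)" "cwishart (mat 1 :: complex^'p^'p) n" ..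
  have [measurable]: "\<delta> \<in> borel_measurable (borel \<Otimes>\<^sub>M borel)" by (simp add: borel_prod)
  have s: "sets (cnormal \<Xi> (mat 1) \<Otimes>\<^sub>M cwishart (mat 1 :: complex^'p^'p) n) = sets (borel \<Otimes>\<^sub>M borel)"
    by (intro sets_pair_measure_cong) simp_all
  have "(\<lambda>zs. ennreal (loss \<Xi> (mat 1) (\<delta> zs))) \<in> borel_measurable (borel \<Otimes>\<^sub>M borel)" by measurable
  then have "(\<lambda>zs. ennreal (loss \<Xi> (mat 1) (\<delta> zs))) \<in> borel_measurable (cnormal \<Xi> (mat 1) \<Otimes>\<^sub>M cwishart (mat 1 :: complex^'p^'p) n)"
    using measurable_cong_sets[OF s refl] by blast
  from PQ.nn_integral_snd[OF this[unfolded case_prod_eta[symmetric, of "\<lambda>zs. ennreal (loss \<Xi> (mat 1) (\<delta> zs))"]]]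
  show ?thesis unfolding risk_def by (simp add: loss_mat_1 split_beta')
qed

text \<open>For fixed \<open>S\<close> the risk bound holds with the identity as weight and \<open>C = S\<close>; the average over \<open>S\<close> uses the moments of the
  full Wishart matrix, the Schur complement for the identity embedding.\<close>

lemma efron_morris_risk_tall:
  fixes \<Xi> :: "complex^'p^'m"
  assumes n: "n > real CARD('p)" and mp: "CARD('p) < CARD('m)"
  shows "risk n (\<lambda>(Z, S). efron_morris n Z S) \<Xi> (mat 1) \<le> ennreal (real (CARD('m) * CARD('p)))"
proof -
  let ?m = "real CARD('m)" and ?p = "real CARD('p)" and ?d = "real (CARD('m) * CARD('p))"
  let ?P = "cnormal \<Xi> (mat 1)" and ?Q = "cwishart (mat 1 :: complex^'p^'p) n"
  have n1: "n > ?p - 1" using n by simp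
  interpret P: prob_space ?P by (rule prob_space_cnormal_1)
  interpret Q: prob_space ?Q by (rule prob_space_cwishart_1[OF n1])
  interpret PQ: pair_prob_space ?P ?Q ..
  define c where "c = (?m - ?p) / (n + ?p)"
  have c: "c \<ge> 0" "c * (n + ?p) = ?m - ?p" using n mp by (simp_all add: c_def)
  let ?W = "\<lambda>Z :: complex^'p^'m. matrix_inv (ctranspose Z ** Z)"
  let ?A = "\<lambda>S. \<integral>\<^sup>+Z. ennreal (Re (trace (?W Z ** S))) \<partial>?P"
  let ?B = "\<lambda>S. \<integral>\<^sup>+Z. ennreal ((norm (Z ** ?W Z ** S))\<^sup>2) \<partial>?P"
  let ?r = "\<lambda>S. \<integral>\<^sup>+Z. ennreal ((norm (efron_morris n Z S - \<Xi>))\<^sup>2) \<partial>?P"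
  let ?b = "\<integral>\<^sup>+Z. ennreal (Re (trace (?W Z))) \<partial>?P"
  have em: "efron_morris n Z S = Z - c *\<^sub>R (Z ** ?W Z ** S)" for Z :: "complex^'p^'m" and S
    using mp by (simp add: efron_morris_def Let_def c_def matrix_distribs matrix_mul_assoc)
  have fixed: "?r S + ennreal (2 * c * (?m - ?p)) * ?A S \<le> ennreal ?d + ennreal (c\<^sup>2) * ?B S" if "pos_def S" for S
    using shrinkage_risk_bound[OF pos_def_mat_1 that c(1) mp ridge_shrinks_identity_weight, of \<Xi>] by (simp add: em)
  have [measurable]: "?A \<in> borel_measurable ?Q" "?B \<in> borel_measurable ?Q" "?r \<in> borel_measurable ?Q" by measurable
  have "(\<integral>\<^sup>+S. ?r S \<partial>?Q) + ennreal (2 * c * (?m - ?p)) * (\<integral>\<^sup>+S. ?A S \<partial>?Q)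
      = (\<integral>\<^sup>+S. ?r S + ennreal (2 * c * (?m - ?p)) * ?A S \<partial>?Q)"
    by (simp add: nn_integral_add nn_integral_cmult)
  also have "\<dots> \<le> (\<integral>\<^sup>+S. ennreal ?d + ennreal (c\<^sup>2) * ?B S \<partial>?Q)"
    by (rule nn_integral_mono_AE) (rule AE_cwishartI, rule fixed)
  also have "\<dots> = ennreal ?d + ennreal (c\<^sup>2) * (\<integral>\<^sup>+S. ?B S \<partial>?Q)"
    using Q.emeasure_space_1 by (simp add: nn_integral_add nn_integral_cmult)
  also have "(\<integral>\<^sup>+S. ?A S \<partial>?Q) = (\<integral>\<^sup>+Z. (\<integral>\<^sup>+S. ennreal (Re (trace (?W Z ** S))) \<partial>?Q) \<partial>?P)"
    by (rule PQ.Fubini') measurable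
  also have "\<dots> = (\<integral>\<^sup>+Z. ennreal n * ennreal (Re (trace (?W Z))) \<partial>?P)"
  proof (rule nn_integral_cong_AE)
    have "(\<integral>\<^sup>+S. ennreal (Re (trace (?W Z ** S))) \<partial>?Q) = ennreal n * ennreal (Re (trace (?W Z)))"
      if Z: "invertible (ctranspose Z ** Z)" for Z :: "complex^'p^'m"
    proof -
      have "pos_def (?W Z)" using pos_def_matrix_inv[OF pos_def_gram[OF Z pos_def_mat_1]] by simp
      note T = nn_integral_trace_block_schur(1)[OF n1 inj_on_id2 this]
      have "(\<integral>\<^sup>+S. ennreal (Re (trace (?W Z ** S))) \<partial>?Q) = (\<integral>\<^sup>+S. ennreal (Re (trace (?W Z ** block_schur (\<lambda>i. i) S))) \<partial>?Q)"
        by (rule nn_integral_cong_AE) (rule AE_cwishartI, simp add: block_schur_id)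
      then show ?thesis using T n by (simp add: ennreal_mult')
    qed
    note L = this
    show "AE Z in ?P. (\<integral>\<^sup>+S. ennreal (Re (trace (?W Z ** S))) \<partial>?Q) = ennreal n * ennreal (Re (trace (?W Z)))"
      using AE_cnormal_gram_invertible[OF mp] by eventually_elim (rule L)
  qed
  also have "\<dots> = ennreal n * ?b" by (rule nn_integral_cmult) measurable
  also have "(\<integral>\<^sup>+S. ?B S \<partial>?Q) = (\<integral>\<^sup>+Z. (\<integral>\<^sup>+S. ennreal ((norm (Z ** ?W Z ** S))\<^sup>2) \<partial>?Q) \<partial>?P)"
    by (rule PQ.Fubini') measurable
  also have "\<dots> = (\<integral>\<^sup>+Z. ennreal (n * (n + ?p)) * ennreal (Re (trace (?W Z))) \<partial>?P)"
  proof (rule nn_integral_cong_AE)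
    have "(\<integral>\<^sup>+S. ennreal ((norm (Z ** ?W Z ** S))\<^sup>2) \<partial>?Q) = ennreal (n * (n + ?p)) * ennreal (Re (trace (?W Z)))"
      if Z: "invertible (ctranspose Z ** Z)" for Z :: "complex^'p^'m"
    proof -
      have W: "pos_def (?W Z)" using pos_def_matrix_inv[OF pos_def_gram[OF Z pos_def_mat_1]] by simp
      note T = nn_integral_trace_block_schur(2)[OF n1 inj_on_id2 W]
      have sq: "(norm (Z ** ?W Z ** S))\<^sup>2 = Re (trace (?W Z ** (block_schur (\<lambda>i. i) S ** block_schur (\<lambda>i. i) S)))" if S: "pos_def S" for S
      proof -
        have "(norm (Z ** ?W Z ** S))\<^sup>2 = Re (trace (S ** ?W Z ** (ctranspose Z ** Z) ** ?W Z ** S))"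
          unfolding power2_norm_eq_inner inner_matrix_trace
          by (simp add: ctranspose_mult pos_def_hermitian[OF S] pos_def_hermitian[OF W] matrix_mul_assoc)
        also have "S ** ?W Z ** (ctranspose Z ** Z) ** ?W Z ** S = S ** (?W Z ** S)"
          unfolding matrix_mul_assoc[symmetric] using matrix_inv(2)[OF Z]
          by (metis matrix_mul_assoc matrix_mul_lid)
        also have "trace (S ** (?W Z ** S)) = trace (?W Z ** (S ** S))"
          by (subst trace_mul_sym) (simp add: matrix_mul_assoc)
        finally show ?thesis using S by (simp add: block_schur_id)
      qed
      have "(\<integral>\<^sup>+S. ennreal ((norm (Z ** ?W Z ** S))\<^sup>2) \<partial>?Q)
          = (\<integral>\<^sup>+S. ennreal (Re (trace (?W Z ** (block_schur (\<lambda>i. i) S ** block_schur (\<lambda>i. i) S)))) \<partial>?Q)"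
        by (rule nn_integral_cong_AE) (rule AE_cwishartI, simp add: sq)
      then show ?thesis using T n by (simp add: ennreal_mult')
    qed
    note L = this
    show "AE Z in ?P. (\<integral>\<^sup>+S. ennreal ((norm (Z ** ?W Z ** S))\<^sup>2) \<partial>?Q) = ennreal (n * (n + ?p)) * ennreal (Re (trace (?W Z)))"
      using AE_cnormal_gram_invertible[OF mp] by eventually_elim (rule L)
  qed
  also have "\<dots> = ennreal (n * (n + ?p)) * ?b" by (rule nn_integral_cmult) measurable
  finally have "(\<integral>\<^sup>+S. ?r S \<partial>?Q) \<le> ennreal ?d"
    using n c nn_integral_trace_gram_inv_finite[OF mp, of \<Xi>] by (intro optimal_constant_bound[where c=c and \<mu>="n + ?p" and \<nu>=n and b="?b" and \<delta>="?m - ?p"]) auto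
  moreover have "(\<lambda>(Z, S). efron_morris n Z S) \<in> borel_measurable (borel :: ((complex^'p^'m) \<times> (complex^'p^'p)) measure)"
    unfolding borel_prod[symmetric] split_beta' by measurable
  ultimately show ?thesis by (simp add: risk_mat_1[OF n1])
qed

lemma inj_exists: "CARD('m::finite) < CARD('p::finite) \<Longrightarrow> \<exists>e :: 'm \<Rightarrow> 'p. inj e"
  using inj_on_iff_card_le[of "UNIV :: 'm set" "UNIV :: 'p set"] card_le_inj[of "UNIV :: 'm set" "UNIV :: 'p set"] by auto

text \<open>For fixed \<open>S\<close> the risk bound is applied to the adjoint \<open>Y\<close> of \<open>Z\<close> with weight \<open>matrix_inv S\<close> and \<open>C = mat 1\<close>; the average
  over \<open>S\<close> uses the moments of the compression.\<close>

lemma efron_morris_risk_wide: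
  fixes \<Xi> :: "complex^'p^'m"
  assumes n: "n > real CARD('p)" and mp: "CARD('m) < CARD('p)"
  shows "risk n (\<lambda>(Z, S). efron_morris n Z S) \<Xi> (mat 1) \<le> ennreal (real (CARD('m) * CARD('p)))"
proof -
  let ?m = "real CARD('m)" and ?p = "real CARD('p)" and ?d = "real (CARD('m) * CARD('p))"
  let ?X = "ctranspose \<Xi>"
  let ?P = "cnormal ?X (mat 1)" and ?Q = "cwishart (mat 1 :: complex^'p^'p) n"
  have n1: "n > ?p - 1" using n by simp
  interpret P: prob_space ?P by (rule prob_space_cnormal_1)
  interpret Q: prob_space ?Q by (rule prob_space_cwishart_1[OF n1])
  interpret PQ: pair_prob_space ?P ?Q ..
  define c where "c = (?p - ?m) / (n + 2 * ?m - ?p)"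
  let ?\<nu> = "n - ?p + ?m"
  have den: "n + 2 * ?m - ?p > 0" using n by simp
  have "?\<nu> + ?m = n + 2 * ?m - ?p" by simp
  then have c: "c \<ge> 0" "c * (?\<nu> + ?m) = ?p - ?m" using den mp by (simp_all only: c_def) simp_all
  obtain e :: "'m \<Rightarrow> 'p" where e: "inj e" using inj_exists[OF mp] by blast
  let ?V = "\<lambda>Y S. matrix_inv (ctranspose Y ** matrix_inv S ** Y) :: complex^'m^'m"
  let ?W = "\<lambda>Y :: complex^'m^'p. matrix_inv (ctranspose Y ** Y)"
  let ?A = "\<lambda>S. \<integral>\<^sup>+Y. ennreal (Re (trace (?V Y S))) \<partial>?P"
  let ?B = "\<lambda>S. \<integral>\<^sup>+Y. ennreal ((norm (Y ** ?V Y S))\<^sup>2) \<partial>?P"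
  let ?r = "\<lambda>S. \<integral>\<^sup>+Y. ennreal ((norm (Y - c *\<^sub>R (Y ** ?V Y S) - ?X))\<^sup>2) \<partial>?P"
  let ?b = "\<integral>\<^sup>+Y. ennreal (Re (trace (?W Y))) \<partial>?P"
  have fixed: "?r S + ennreal (2 * c * (?p - ?m)) * ?A S \<le> ennreal ?d + ennreal (c\<^sup>2) * ?B S" if S: "pos_def S" for S
    using shrinkage_risk_bound[OF pos_def_matrix_inv[OF S] pos_def_mat_1 c(1) mp ridge_shrinks_identity_factor[OF _ pos_def_matrix_inv[OF S]], of ?X]
    by (simp add: mult.commute[of ?p])
  have Vm [measurable]: "(\<lambda>x. ?V (f x) (g x)) \<in> borel_measurable M"
    if [measurable]: "f \<in> borel_measurable M" "g \<in> borel_measurable M" for f g and M :: "'z measure" by measurable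
  have [measurable]: "?A \<in> borel_measurable ?Q" "?B \<in> borel_measurable ?Q" "?r \<in> borel_measurable ?Q" by measurable
  have "(\<integral>\<^sup>+S. ?r S \<partial>?Q) + ennreal (2 * c * (?p - ?m)) * (\<integral>\<^sup>+S. ?A S \<partial>?Q)
      = (\<integral>\<^sup>+S. ?r S + ennreal (2 * c * (?p - ?m)) * ?A S \<partial>?Q)"
    by (simp add: nn_integral_add nn_integral_cmult)
  also have "\<dots> \<le> (\<integral>\<^sup>+S. ennreal ?d + ennreal (c\<^sup>2) * ?B S \<partial>?Q)"
    by (rule nn_integral_mono_AE) (rule AE_cwishartI, rule fixed)
  also have "\<dots> = ennreal ?d + ennreal (c\<^sup>2) * (\<integral>\<^sup>+S. ?B S \<partial>?Q)"
    using Q.emeasure_space_1 by (simp add: nn_integral_add nn_integral_cmult)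
  also have "(\<integral>\<^sup>+S. ?A S \<partial>?Q) = (\<integral>\<^sup>+Y. (\<integral>\<^sup>+S. ennreal (Re (trace (?V Y S))) \<partial>?Q) \<partial>?P)"
    by (rule PQ.Fubini') measurable
  also have "\<dots> = (\<integral>\<^sup>+Y. ennreal ?\<nu> * ennreal (Re (trace (?W Y))) \<partial>?P)"
  proof (rule nn_integral_cong_AE)
    have "(\<integral>\<^sup>+S. ennreal (Re (trace (?V Y S))) \<partial>?Q) = ennreal ?\<nu> * ennreal (Re (trace (?W Y)))"
      if Y: "invertible (ctranspose Y ** Y)" for Y :: "complex^'m^'p"
    proof -
      have "pos_def (ctranspose Y ** ctranspose (ctranspose Y))" using pos_def_gram[OF Y pos_def_mat_1] by simp
      from nn_integral_cwishart_compression(1)[OF n1 e this] show ?thesis using n by (simp add: ennreal_mult')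
    qed
    note L = this
    show "AE Y in ?P. (\<integral>\<^sup>+S. ennreal (Re (trace (?V Y S))) \<partial>?Q) = ennreal ?\<nu> * ennreal (Re (trace (?W Y)))"
      using AE_cnormal_gram_invertible[OF mp] by eventually_elim (rule L)
  qed
  also have "\<dots> = ennreal ?\<nu> * ?b" by (rule nn_integral_cmult) measurable
  also have "(\<integral>\<^sup>+S. ?B S \<partial>?Q) = (\<integral>\<^sup>+Y. (\<integral>\<^sup>+S. ennreal ((norm (Y ** ?V Y S))\<^sup>2) \<partial>?Q) \<partial>?P)"
    by (rule PQ.Fubini') measurable
  also have "\<dots> = (\<integral>\<^sup>+Y. ennreal (?\<nu> * (?\<nu> + ?m)) * ennreal (Re (trace (?W Y))) \<partial>?P)"
  proof (rule nn_integral_cong_AE)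
    have "(\<integral>\<^sup>+S. ennreal ((norm (Y ** ?V Y S))\<^sup>2) \<partial>?Q) = ennreal (?\<nu> * (?\<nu> + ?m)) * ennreal (Re (trace (?W Y)))"
      if Y: "invertible (ctranspose Y ** Y)" for Y :: "complex^'m^'p"
    proof -
      have "pos_def (ctranspose Y ** ctranspose (ctranspose Y))" using pos_def_gram[OF Y pos_def_mat_1] by simp
      note T = nn_integral_cwishart_compression(2)[OF n1 e this]
      have sq: "(norm (Y ** ?V Y S))\<^sup>2 = Re (trace (?V Y S ** (ctranspose Y ** Y) ** ?V Y S))" if S: "pos_def S" for S
      proof -
        have "ctranspose (?V Y S) = ?V Y S"
          by (intro pos_def_hermitian pos_def_matrix_inv pos_def_gram Y S)
        then show ?thesis
          unfolding power2_norm_eq_inner inner_matrix_trace by (simp add: ctranspose_mult matrix_mul_assoc)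
      qed
      have "(\<integral>\<^sup>+S. ennreal ((norm (Y ** ?V Y S))\<^sup>2) \<partial>?Q)
          = (\<integral>\<^sup>+S. ennreal (Re (trace (?V Y S ** (ctranspose Y ** Y) ** ?V Y S))) \<partial>?Q)"
        by (rule nn_integral_cong_AE) (rule AE_cwishartI, simp add: sq)
      then show ?thesis using T n by (simp add: ennreal_mult')
    qed
    note L = this
    show "AE Y in ?P. (\<integral>\<^sup>+S. ennreal ((norm (Y ** ?V Y S))\<^sup>2) \<partial>?Q) = ennreal (?\<nu> * (?\<nu> + ?m)) * ennreal (Re (trace (?W Y)))"
      using AE_cnormal_gram_invertible[OF mp] by eventually_elim (rule L)
  qed
  also have "\<dots> = ennreal (?\<nu> * (?\<nu> + ?m)) * ?b" by (rule nn_integral_cmult) measurable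
  finally have le: "(\<integral>\<^sup>+S. ?r S \<partial>?Q) \<le> ennreal ?d"
    using n c nn_integral_trace_gram_inv_finite[OF mp, of ?X] by (intro optimal_constant_bound[where c=c and \<mu>="?\<nu> + ?m" and \<nu>="?\<nu>" and b="?b" and \<delta>="?p - ?m"]) auto
  have em: "norm (efron_morris n (ctranspose Y) S - \<Xi>) = norm (Y - c *\<^sub>R (Y ** ?V Y S) - ?X)"
    if Y: "invertible (ctranspose Y ** Y)" and S: "pos_def S" for Y :: "complex^'m^'p" and S
  proof -
    have h: "ctranspose (?V Y S) = ?V Y S"
      by (intro pos_def_hermitian pos_def_matrix_inv pos_def_gram Y S)
    have "efron_morris n (ctranspose Y) S = ctranspose Y - c *\<^sub>R (?V Y S ** ctranspose Y)"
      using mp by (simp add: efron_morris_def Let_def c_def matrix_distribs)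
    also have "\<dots> = ctranspose (Y - c *\<^sub>R (Y ** ?V Y S))"
      by (simp add: ctranspose_diff ctranspose_scaleR ctranspose_mult h)
    finally have "efron_morris n (ctranspose Y) S - \<Xi> = ctranspose (Y - c *\<^sub>R (Y ** ?V Y S) - ?X)"
      by (simp add: ctranspose_diff)
    then show ?thesis by (simp only: norm_ctranspose)
  qed
  have "(\<integral>\<^sup>+S. (\<integral>\<^sup>+Z. ennreal ((norm (efron_morris n Z S - \<Xi>))\<^sup>2) \<partial>cnormal \<Xi> (mat 1)) \<partial>?Q) = (\<integral>\<^sup>+S. ?r S \<partial>?Q)"
  proof (rule nn_integral_cong_AE)
    have "(\<integral>\<^sup>+Z. ennreal ((norm (efron_morris n Z S - \<Xi>))\<^sup>2) \<partial>cnormal \<Xi> (mat 1)) = ?r S" if S: "pos_def S" for S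
    proof -
      have "(\<integral>\<^sup>+Z. ennreal ((norm (efron_morris n Z S - \<Xi>))\<^sup>2) \<partial>cnormal \<Xi> (mat 1))
          = (\<integral>\<^sup>+Y. ennreal ((norm (efron_morris n (ctranspose Y) S - \<Xi>))\<^sup>2) \<partial>?P)"
        by (rule nn_integral_cnormal_ctranspose) measurable
      also have "\<dots> = ?r S"
        by (rule nn_integral_cong_AE) (rule AE_mp[OF AE_cnormal_gram_invertible[OF mp]], rule AE_I2, simp add: em S)
      finally show ?thesis .
    qed
    note L = this
    show "AE S in ?Q. (\<integral>\<^sup>+Z. ennreal ((norm (efron_morris n Z S - \<Xi>))\<^sup>2) \<partial>cnormal \<Xi> (mat 1)) = ?r S"
      using AE_cwishart_pos_def by eventually_elim (rule L)
  qed
  moreover have "(\<lambda>(Z, S). efron_morris n Z S) \<in> borel_measurable (borel :: ((complex^'p^'m) \<times> (complex^'p^'p)) measure)"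
    unfolding borel_prod[symmetric] split_beta' by measurable
  ultimately show ?thesis using le by (simp add: risk_mat_1[OF n1])
qed

section \<open>Equivariance\<close>

lemma nn_integral_cnormal_transform:
  fixes \<Sigma> A :: "complex^'p^'p" and \<Xi> :: "complex^'p^'m"
  assumes A: "A \<in> pivot_matrices" "A ** \<Sigma> ** ctranspose A = mat 1"
    and [measurable]: "f \<in> borel_measurable borel"
  shows "(\<integral>\<^sup>+Z. f (Z ** ctranspose A) \<partial>cnormal \<Xi> \<Sigma>) = (\<integral>\<^sup>+Z. f Z \<partial>cnormal (\<Xi> ** ctranspose A) (mat 1))"
proof -
  let ?d = "cmod (det A)" and ?c = "pi ^ (CARD('m) * CARD('p))" and ?X = "\<Xi> ** ctranspose A"
  note i = pivot_matrices_invertible[OF A(1)]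
  note inv = congruent_to_1_inv_det(1)[OF i A(2)] and det = congruent_to_1_inv_det(2)[OF i A(2)]
  have d: "?d > 0" using i by (simp add: invertible_det_nz)
  let ?g = "\<lambda>Z. ennreal (exp (- (norm (Z - ?X))\<^sup>2) / ?c) * f Z"
  have dens: "ennreal (exp (- Re (trace ((Z - \<Xi>) ** matrix_inv \<Sigma> ** ctranspose (Z - \<Xi>)))) / (?c * Re (det \<Sigma>) ^ CARD('m)))
      = ennreal (?d ^ (2 * CARD('m))) * ennreal (exp (- (norm (Z ** ctranspose A - ?X))\<^sup>2) / ?c)" for Z
  proof -
    have "(Z - \<Xi>) ** matrix_inv \<Sigma> ** ctranspose (Z - \<Xi>)
        = (Z ** ctranspose A - ?X) ** ctranspose (Z ** ctranspose A - ?X)"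
      unfolding inv by (simp add: ctranspose_diff ctranspose_mult matrix_distribs matrix_mul_assoc)
    then have t: "Re (trace ((Z - \<Xi>) ** matrix_inv \<Sigma> ** ctranspose (Z - \<Xi>))) = (norm (Z ** ctranspose A - ?X))\<^sup>2"
      by (simp only: norm_sq_trace)
    have "exp r / (?c * Re (det \<Sigma>) ^ CARD('m)) = ?d ^ (2 * CARD('m)) * (exp r / ?c)" for r
      unfolding det using d by (simp add: power_divide power_mult)
    then show ?thesis unfolding t by (simp only:) (rule ennreal_mult', simp)
  qed
  have "(\<integral>\<^sup>+Z. f (Z ** ctranspose A) \<partial>cnormal \<Xi> \<Sigma>)
      = (\<integral>\<^sup>+Z. ennreal (?d ^ (2 * CARD('m))) * ?g (Z ** ctranspose A) \<partial>lborel)"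
    unfolding cnormal_def dens by (subst nn_integral_density) (measurable, simp add: mult.assoc)
  also have "\<dots> = ennreal (?d ^ (2 * CARD('m))) * (\<integral>\<^sup>+Z. ?g (Z ** ctranspose A) \<partial>lborel)"
    by (rule nn_integral_cmult) measurable
  also have "(\<integral>\<^sup>+Z. ?g (Z ** ctranspose A) \<partial>lborel) = ennreal (1 / ?d ^ (2 * CARD('m))) * (\<integral>\<^sup>+Z. ?g Z \<partial>lborel)"
    unfolding jac_right_mult[OF A(1), symmetric]
    by (rule nn_integral_linear[OF linear_right_mult bij_right_mult[OF i], where f="?g"]) measurable
  also have "ennreal (?d ^ (2 * CARD('m))) * (ennreal (1 / ?d ^ (2 * CARD('m))) * (\<integral>\<^sup>+Z. ?g Z \<partial>lborel)) = (\<integral>\<^sup>+Z. ?g Z \<partial>lborel)"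
  proof -
    have "ennreal (?d ^ (2 * CARD('m))) * ennreal (1 / ?d ^ (2 * CARD('m))) = 1"
      using d by (subst ennreal_mult[symmetric]) simp_all
    then show ?thesis by (simp add: mult.assoc[symmetric])
  qed
  also have "\<dots> = (\<integral>\<^sup>+Z. f Z \<partial>cnormal ?X (mat 1))" by (simp add: nn_integral_cnormal_1)
  finally show ?thesis .
qed

lemma invertible_mult_iff:
  fixes A W :: "complex^'p^'p"
  assumes "invertible A"
  shows "invertible (A ** W ** ctranspose A) \<longleftrightarrow> invertible W"
  using assms by (simp add: invertible_det_nz det_mul det_ctranspose)

lemma AE_cnormal_gram_invertible_general:
  fixes \<Sigma> A :: "complex^'p^'p" and \<Xi> :: "complex^'p^'m"
  assumes A: "A \<in> pivot_matrices" "A ** \<Sigma> ** ctranspose A = mat 1" and mp: "CARD('p) < CARD('m)"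
  shows "AE Z in cnormal \<Xi> \<Sigma>. invertible (ctranspose Z ** Z)"
proof -
  let ?N = "{Z :: complex^'p^'m. \<not> invertible (ctranspose Z ** Z)}"
  have "?N = {Y \<in> space borel. det (ctranspose Y ** Y) = 0}" by (simp add: invertible_det_nz)
  also have "\<dots> \<in> sets borel" by measurable
  finally have N: "?N \<in> sets borel" .
  have "ctranspose (Z ** ctranspose A) ** (Z ** ctranspose A) = A ** (ctranspose Z ** Z) ** ctranspose A" for Z :: "complex^'p^'m"
    by (simp add: ctranspose_mult matrix_mul_assoc)
  then have e: "indicator ?N (Z ** ctranspose A) = (indicator ?N Z :: ennreal)" for Z
    using invertible_mult_iff[OF pivot_matrices_invertible[OF A(1)]] by (simp add: indicator_def)
  have "emeasure (cnormal \<Xi> \<Sigma>) ?N = (\<integral>\<^sup>+Z. indicator ?N (Z ** ctranspose A) \<partial>cnormal \<Xi> \<Sigma>)"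
    unfolding e using N by simp
  also have "\<dots> = (\<integral>\<^sup>+Z. indicator ?N Z \<partial>cnormal (\<Xi> ** ctranspose A) (mat 1))"
    using N by (intro nn_integral_cnormal_transform A) simp
  also have "\<dots> = (\<integral>\<^sup>+Z. 0 \<partial>cnormal (\<Xi> ** ctranspose A) (mat 1))"
    by (rule nn_integral_cong_AE) (rule AE_mp[OF AE_cnormal_gram_invertible[OF mp]], rule AE_I2, simp)
  finally show ?thesis using N by (intro AE_I[of _ _ ?N]) auto
qed

text \<open>The Gram matrices transform by congruence, so their inverses do by the inverse congruence, and the factors \<open>A\<close> cancel.\<close>

lemma efron_morris_equivariant:
  fixes Z :: "complex^'p^'m" and A S :: "complex^'p^'p"
  assumes A: "invertible A" and S: "invertible S" and Z: "CARD('p) < CARD('m) \<Longrightarrow> invertible (ctranspose Z ** Z)"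
  shows "efron_morris n (Z ** ctranspose A) (A ** S ** ctranspose A) = efron_morris n Z S ** ctranspose A"
proof (cases "CARD('p) < CARD('m)")
  case True
  let ?W = "ctranspose Z ** Z" and ?A' = "matrix_inv A"
  have W: "ctranspose (Z ** ctranspose A) ** (Z ** ctranspose A) = A ** ?W ** ctranspose A"
    by (simp add: ctranspose_mult matrix_mul_assoc)
  have "matrix_inv (A ** U ** ctranspose A) = ctranspose ?A' ** matrix_inv U ** ?A'" if "invertible U" for U
    using that A by (simp add: matrix_inv_mult invertible_mult invertible_ctranspose matrix_inv_ctranspose matrix_mul_assoc)
  note iW = this[OF Z[OF True]]
  have "Z ** ctranspose A ** ((ctranspose ?A' ** matrix_inv ?W ** ?A') ** (A ** S ** ctranspose A))
      = Z ** (ctranspose A ** ctranspose ?A') ** matrix_inv ?W ** (?A' ** A) ** S ** ctranspose A"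
    by (simp add: matrix_mul_assoc)
  also have "\<dots> = Z ** matrix_inv ?W ** S ** ctranspose A"
    by (simp add: matrix_inv[OF A] flip: ctranspose_mult)
  finally show ?thesis
    using True by (simp add: efron_morris_def Let_def W iW matrix_distribs) (simp add: matrix_mul_assoc)
next
  case False
  let ?A' = "matrix_inv A"
  have "matrix_inv (A ** S ** ctranspose A) = ctranspose ?A' ** matrix_inv S ** ?A'"
    using S A by (simp add: matrix_inv_mult invertible_mult invertible_ctranspose matrix_inv_ctranspose matrix_mul_assoc)
  then have "Z ** ctranspose A ** matrix_inv (A ** S ** ctranspose A) ** ctranspose (Z ** ctranspose A)
      = Z ** (ctranspose A ** ctranspose ?A') ** matrix_inv S ** (?A' ** A) ** ctranspose Z"
    by (simp add: ctranspose_mult matrix_mul_assoc)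
  also have "\<dots> = Z ** matrix_inv S ** ctranspose Z"
    by (simp add: matrix_inv[OF A] flip: ctranspose_mult)
  finally show ?thesis
    using False by (simp add: efron_morris_def Let_def matrix_mul_assoc)
qed

lemma loss_equivariant:
  fixes \<Xi> :: "complex^'p^'m" and \<Sigma> A :: "complex^'p^'p"
  assumes i: "invertible A" and A: "A ** \<Sigma> ** ctranspose A = mat 1"
  shows "loss \<Xi> \<Sigma> d = loss (\<Xi> ** ctranspose A) (mat 1) (d ** ctranspose A)"
proof -
  have "loss \<Xi> \<Sigma> d = Re (trace (ctranspose A ** (A ** ctranspose (d - \<Xi>) ** (d - \<Xi>))))"
    unfolding loss_def congruent_to_1_inv_det(1)[OF i A] by (simp add: matrix_mul_assoc)
  also have "\<dots> = Re (trace (ctranspose (d ** ctranspose A - \<Xi> ** ctranspose A) ** (d ** ctranspose A - \<Xi> ** ctranspose A)))"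
    by (subst trace_mul_sym) (simp add: ctranspose_diff ctranspose_mult matrix_distribs matrix_mul_assoc)
  finally show ?thesis by (simp add: loss_def)
qed

lemma risk_eq_iterated:
  fixes \<Xi> :: "complex^'p^'m" and \<delta> :: "(complex^'p^'m) \<times> (complex^'p^'p) \<Rightarrow> complex^'p^'m"
  assumes "sigma_finite_measure (cwishart \<Sigma> n)" and [measurable]: "\<delta> \<in> borel_measurable borel"
  shows "risk n \<delta> \<Xi> \<Sigma> = (\<integral>\<^sup>+Z. (\<integral>\<^sup>+S. ennreal (loss \<Xi> \<Sigma> (\<delta> (Z, S))) \<partial>cwishart \<Sigma> n) \<partial>cnormal \<Xi> \<Sigma>)"
proof -
  interpret sigma_finite_measure "cwishart \<Sigma> n" by fact
  have [measurable]: "\<delta> \<in> borel_measurable (borel \<Otimes>\<^sub>M borel)" by (simp add: borel_prod)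
  have s: "sets (cnormal \<Xi> \<Sigma> \<Otimes>\<^sub>M cwishart \<Sigma> n) = sets (borel \<Otimes>\<^sub>M borel)"
    by (intro sets_pair_measure_cong) simp_all
  have "(\<lambda>zs. ennreal (loss \<Xi> \<Sigma> (\<delta> zs))) \<in> borel_measurable (borel \<Otimes>\<^sub>M borel)" by measurable
  then have "(\<lambda>zs. ennreal (loss \<Xi> \<Sigma> (\<delta> zs))) \<in> borel_measurable (cnormal \<Xi> \<Sigma> \<Otimes>\<^sub>M cwishart \<Sigma> n)"
    using measurable_cong_sets[OF s refl] by blast
  from nn_integral_fst[OF this] show ?thesis unfolding risk_def by simp
qed

lemma measurable_efron_morris_pair:
  "(\<lambda>(Z, S). efron_morris n Z S) \<in> borel_measurable (borel :: ((complex^'p^'m) \<times> (complex^'p^'p)) measure)"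
  unfolding borel_prod[symmetric] split_beta' by measurable

text \<open>Change variables in both integrals; equivariance is needed only where the inverses exist, which is almost everywhere.\<close>

lemma risk_efron_morris_reduce:
  fixes \<Xi> :: "complex^'p^'m" and \<Sigma> A :: "complex^'p^'p"
  assumes n: "n > real CARD('p) - 1" and A: "A \<in> pivot_matrices" "A ** \<Sigma> ** ctranspose A = mat 1"
  shows "risk n (\<lambda>(Z, S). efron_morris n Z S) \<Xi> \<Sigma> = risk n (\<lambda>(Z, S). efron_morris n Z S) (\<Xi> ** ctranspose A) (mat 1)"
proof -
  note i = pivot_matrices_invertible[OF A(1)]
  let ?X = "\<Xi> ** ctranspose A" and ?em = "efron_morris n :: complex^'p^'m \<Rightarrow> _"
  interpret Q1: prob_space "cwishart (mat 1 :: complex^'p^'p) n" by (rule prob_space_cwishart_1[OF n])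
  have "(\<integral>\<^sup>+s. 1 \<partial>cwishart \<Sigma> n) = (\<integral>\<^sup>+s. 1 \<partial>cwishart (mat 1 :: complex^'p^'p) n)"
    by (rule nn_integral_cwishart_transform[OF n A, where f="\<lambda>_. 1"]) simp
  then have "emeasure (cwishart \<Sigma> n) (space (cwishart \<Sigma> n)) = 1" using Q1.emeasure_space_1 by simp
  then interpret Q: prob_space "cwishart \<Sigma> n" by (rule prob_spaceI)
  let ?g = "\<lambda>Z S. ennreal (loss ?X (mat 1) (?em Z S))"
  have "risk n (\<lambda>(Z, S). ?em Z S) \<Xi> \<Sigma> = (\<integral>\<^sup>+Z. (\<integral>\<^sup>+S. ennreal (loss \<Xi> \<Sigma> (?em Z S)) \<partial>cwishart \<Sigma> n) \<partial>cnormal \<Xi> \<Sigma>)"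
    using risk_eq_iterated[OF Q.sigma_finite_measure_axioms measurable_efron_morris_pair] by simp
  also have "\<dots> = (\<integral>\<^sup>+Z. (\<integral>\<^sup>+S. ?g (Z ** ctranspose A) (A ** S ** ctranspose A) \<partial>cwishart \<Sigma> n) \<partial>cnormal \<Xi> \<Sigma>)"
  proof (rule nn_integral_cong_AE)
    have L: "(\<integral>\<^sup>+S. ennreal (loss \<Xi> \<Sigma> (?em Z S)) \<partial>cwishart \<Sigma> n) = (\<integral>\<^sup>+S. ?g (Z ** ctranspose A) (A ** S ** ctranspose A) \<partial>cwishart \<Sigma> n)"
      if Z: "CARD('p) < CARD('m) \<Longrightarrow> invertible (ctranspose Z ** Z)" for Z :: "complex^'p^'m"
    proof (rule nn_integral_cong_AE, rule AE_cwishartI)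
      fix S :: "complex^'p^'p" assume S: "pos_def S"
      show "ennreal (loss \<Xi> \<Sigma> (?em Z S)) = ?g (Z ** ctranspose A) (A ** S ** ctranspose A)"
      proof -
        have "?em (Z ** ctranspose A) (A ** S ** ctranspose A) = ?em Z S ** ctranspose A"
          by (rule efron_morris_equivariant[OF i pos_def_invertible[OF S]]) (rule Z)
        then show ?thesis by (simp only: loss_equivariant[OF i A(2)])
      qed
    qed
    have "AE Z in cnormal \<Xi> \<Sigma>. CARD('p) < CARD('m) \<longrightarrow> invertible (ctranspose Z ** Z)"
      using AE_cnormal_gram_invertible_general[OF A, of \<Xi>] by (cases "CARD('p) < CARD('m)") simp_all
    then show "AE Z in cnormal \<Xi> \<Sigma>. (\<integral>\<^sup>+S. ennreal (loss \<Xi> \<Sigma> (?em Z S)) \<partial>cwishart \<Sigma> n)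
        = (\<integral>\<^sup>+S. ?g (Z ** ctranspose A) (A ** S ** ctranspose A) \<partial>cwishart \<Sigma> n)"
      by eventually_elim (rule L, simp)
  qed
  also have "\<dots> = (\<integral>\<^sup>+Z. (\<integral>\<^sup>+S. ?g (Z ** ctranspose A) S \<partial>cwishart (mat 1) n) \<partial>cnormal \<Xi> \<Sigma>)"
  proof (rule nn_integral_cong)
    fix Z :: "complex^'p^'m"
    show "(\<integral>\<^sup>+S. ?g (Z ** ctranspose A) (A ** S ** ctranspose A) \<partial>cwishart \<Sigma> n) = (\<integral>\<^sup>+S. ?g (Z ** ctranspose A) S \<partial>cwishart (mat 1) n)"
      by (rule nn_integral_cwishart_transform[OF n A, where f="\<lambda>S. ?g (Z ** ctranspose A) S"]) measurable
  qed
  also have "\<dots> = (\<integral>\<^sup>+Z. (\<integral>\<^sup>+S. ?g Z S \<partial>cwishart (mat 1) n) \<partial>cnormal ?X (mat 1))"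
    by (rule nn_integral_cnormal_transform[OF A, where f="\<lambda>Z. \<integral>\<^sup>+S. ?g Z S \<partial>cwishart (mat 1) n"]) measurable
  also have "\<dots> = risk n (\<lambda>(Z, S). ?em Z S) ?X (mat 1)"
    using risk_eq_iterated[OF Q1.sigma_finite_measure_axioms measurable_efron_morris_pair, where \<Xi>="?X"] by simp
  finally show ?thesis .
qed

lemma sup_risk_efron_morris:
  assumes "CARD('m::finite) \<noteq> CARD('p::finite)" and n: "n > real CARD('p)"
  shows "sup_risk n (\<lambda>(Z :: complex^'p^'m, S :: complex^'p^'p). efron_morris n Z S) \<le> ennreal (real (CARD('m) * CARD('p)))"
  unfolding sup_risk_def
proof (intro SUP_least, clarify)
  fix \<Xi> :: "complex^'p^'m" and \<Sigma> :: "complex^'p^'p" assume "pos_def \<Sigma>"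
  then obtain A where A: "A \<in> pivot_matrices" "A ** \<Sigma> ** ctranspose A = mat 1" by (rule pos_def_reduce)
  have "n > real CARD('p) - 1" using n by simp
  note reduce = risk_efron_morris_reduce[OF this A, of \<Xi>]
  consider "CARD('p) < CARD('m)" | "CARD('m) < CARD('p)" using assms(1) by linarith
  then show "risk n (\<lambda>(Z, S). efron_morris n Z S) \<Xi> \<Sigma> \<le> ennreal (real (CARD('m) * CARD('p)))"
  proof cases
    case 1
    then show ?thesis unfolding reduce by (rule efron_morris_risk_tall[OF n])
  next
    case 2
    then show ?thesis unfolding reduce by (rule efron_morris_risk_wide[OF n])
  qed
qed

section \<open>The minimax lower bound\<close>

text \<open>Completing the square in the exponent, the posterior is a Gaussian, and the posterior risk of any value \<open>d\<close> is at least the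
  posterior variance: average the loss over the reflection at the posterior mean.\<close>

lemma posterior_risk_lower_bound:
  fixes d z :: "'a::euclidean_space"
  assumes l: "\<kappa> > 0"
  shows "ennreal (real DIM('a) / (2 * (1 + \<kappa>)) * sqrt (pi / (1 + \<kappa>)) ^ DIM('a) * exp (- (\<kappa> / (1 + \<kappa>)) * (norm z)\<^sup>2))
    \<le> (\<integral>\<^sup>+x. ennreal ((norm (d - x))\<^sup>2 * exp (- (norm (z - x))\<^sup>2 - \<kappa> * (norm x)\<^sup>2)) \<partial>lborel)"
proof -
  let ?a = "1 + \<kappa>"
  define v where "v = d - (1 / ?a) *\<^sub>R z"
  let ?k = "exp (- (\<kappa> / ?a) * (norm z)\<^sup>2)"
  let ?g = "\<lambda>x :: 'a. exp (- ?a * (norm x)\<^sup>2)"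
  have a: "?a > 0" using l by simp
  have sq: "(norm (z - (x + (1 / ?a) *\<^sub>R z)))\<^sup>2 + \<kappa> * (norm (x + (1 / ?a) *\<^sub>R z))\<^sup>2 = ?a * (norm x)\<^sup>2 + (\<kappa> / ?a) * (norm z)\<^sup>2" for x
  proof -
    have 1: "z - (x + (1 / ?a) *\<^sub>R z) = (\<kappa> / ?a) *\<^sub>R z - 1 *\<^sub>R x"
    proof -
      have "1 - 1 / ?a = \<kappa> / ?a" using a by (simp add: field_simps)
      from arg_cong[OF this, of "\<lambda>c. c *\<^sub>R z"] show ?thesis by (simp add: scaleR_diff_left)
    qed
    have 2: "x + (1 / ?a) *\<^sub>R z = (1 / ?a) *\<^sub>R z - (-1) *\<^sub>R x" by simp
    have "(\<kappa> / ?a)\<^sup>2 + \<kappa> * (1 / ?a)\<^sup>2 = \<kappa> * ?a / (?a * ?a)"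
      by (simp add: power2_eq_square add_divide_distrib distrib_left)
    also have "\<dots> = \<kappa> / ?a" using a by simp
    finally have "(\<kappa> / ?a)\<^sup>2 + \<kappa> * (1 / ?a)\<^sup>2 = \<kappa> / ?a" .
    moreover have "(\<kappa> / ?a)\<^sup>2 * N + \<kappa> * ((1 / ?a)\<^sup>2 * N) = ((\<kappa> / ?a)\<^sup>2 + \<kappa> * (1 / ?a)\<^sup>2) * N" for N by (simp add: algebra_simps)
    ultimately have N: "(\<kappa> / ?a)\<^sup>2 * N + \<kappa> * ((1 / ?a)\<^sup>2 * N) = (\<kappa> / ?a) * N" for N by simp
    have "(norm (z - (x + (1 / ?a) *\<^sub>R z)))\<^sup>2 + \<kappa> * (norm (x + (1 / ?a) *\<^sub>R z))\<^sup>2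
        = ((\<kappa> / ?a)\<^sup>2 * (norm z)\<^sup>2 + \<kappa> * ((1 / ?a)\<^sup>2 * (norm z)\<^sup>2)) + ?a * (norm x)\<^sup>2
          + (2 * \<kappa> * ((1 / ?a) * (z \<bullet> x)) - 2 * ((\<kappa> / ?a) * (z \<bullet> x)))"
      unfolding 1 unfolding 2 norm_sq_diff_scaleR by (simp add: power_mult_distrib power_divide algebra_simps)
    then show ?thesis unfolding N by simp
  qed
  have e: "(norm (d - (x + (1 / ?a) *\<^sub>R z)))\<^sup>2 * exp (- (norm (z - (x + (1 / ?a) *\<^sub>R z)))\<^sup>2 - \<kappa> * (norm (x + (1 / ?a) *\<^sub>R z))\<^sup>2)
      = ?k * ((norm (v - x))\<^sup>2 * ?g x)" for x
  proof -
    have "- (norm (z - (x + (1 / ?a) *\<^sub>R z)))\<^sup>2 - \<kappa> * (norm (x + (1 / ?a) *\<^sub>R z))\<^sup>2 = - (\<kappa> / ?a) * (norm z)\<^sup>2 + - ?a * (norm x)\<^sup>2"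
      using sq[of x] by linarith
    moreover have "d - (x + (1 / ?a) *\<^sub>R z) = v - x" by (simp add: v_def)
    ultimately show ?thesis by (simp only: exp_add mult_ac)
  qed
  let ?I = "\<integral>\<^sup>+x. ennreal ((norm (v - x))\<^sup>2 * ?g x) \<partial>lborel"
  have "(\<integral>\<^sup>+x. ennreal ((norm (d - x))\<^sup>2 * exp (- (norm (z - x))\<^sup>2 - \<kappa> * (norm x)\<^sup>2)) \<partial>lborel)
      = (\<integral>\<^sup>+x. ennreal (?k * ((norm (v - x))\<^sup>2 * ?g x)) \<partial>lborel)"
    unfolding e[symmetric]
    by (rule nn_integral_translate[where h="\<lambda>x. ennreal ((norm (d - x))\<^sup>2 * exp (- (norm (z - x))\<^sup>2 - \<kappa> * (norm x)\<^sup>2))", symmetric]) measurable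
  also have "\<dots> = ennreal ?k * ?I"
    by (subst nn_integral_cmult[symmetric]) (simp_all add: ennreal_mult')
  finally have eq: "(\<integral>\<^sup>+x. ennreal ((norm (d - x))\<^sup>2 * exp (- (norm (z - x))\<^sup>2 - \<kappa> * (norm x)\<^sup>2)) \<partial>lborel) = ennreal ?k * ?I" .
  have refl: "?I = (\<integral>\<^sup>+x. ennreal ((norm (v + x))\<^sup>2 * ?g x) \<partial>lborel)"
  proof -
    have lin: "linear (uminus :: 'a \<Rightarrow> 'a)" by (rule linearI) simp_all
    have "(\<integral>\<^sup>+x. ennreal ((norm (v - (- x)))\<^sup>2 * ?g (- x)) \<partial>lborel) = ennreal (jac (uminus :: 'a \<Rightarrow> 'a)) * ?I"
      by (rule nn_integral_linear[OF lin bij_uminus, where f="\<lambda>x. ennreal ((norm (v - x))\<^sup>2 * ?g x)"]) measurable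
    moreover have "jac (uminus :: 'a \<Rightarrow> 'a) = 1" by (rule jac_involution[OF lin]) simp
    ultimately show ?thesis by simp
  qed
  have "2 * (\<integral>\<^sup>+x. ennreal ((norm x)\<^sup>2 * ?g x) \<partial>lborel) = (\<integral>\<^sup>+x. 2 * ennreal ((norm x)\<^sup>2 * ?g x) \<partial>(lborel :: 'a measure))"
    by (subst nn_integral_cmult) measurable
  also have "\<dots> \<le> (\<integral>\<^sup>+x. ennreal ((norm (v - x))\<^sup>2 * ?g x) + ennreal ((norm (v + x))\<^sup>2 * ?g x) \<partial>lborel)"
  proof (rule nn_integral_mono)
    fix x
    have "2 * (norm x)\<^sup>2 \<le> (norm (v - x))\<^sup>2 + (norm (v + x))\<^sup>2"
      using norm_sq_diff_scaleR[of v 1 x] norm_sq_diff_scaleR[of v "-1" x] by simp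
    then have "2 * ((norm x)\<^sup>2 * ?g x) \<le> (norm (v - x))\<^sup>2 * ?g x + (norm (v + x))\<^sup>2 * ?g x"
      using mult_right_mono[of "2 * (norm x)\<^sup>2" "(norm (v - x))\<^sup>2 + (norm (v + x))\<^sup>2" "?g x"] by (simp add: distrib_right mult.assoc)
    then have "ennreal (2 * ((norm x)\<^sup>2 * ?g x)) \<le> ennreal ((norm (v - x))\<^sup>2 * ?g x + (norm (v + x))\<^sup>2 * ?g x)" by (rule ennreal_leI)
    then show "2 * ennreal ((norm x)\<^sup>2 * ?g x) \<le> ennreal ((norm (v - x))\<^sup>2 * ?g x) + ennreal ((norm (v + x))\<^sup>2 * ?g x)"
      by (subst ennreal_plus[symmetric]) (simp_all add: ennreal_mult'[of 2, symmetric] flip: ennreal_numeral)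
  qed
  also have "\<dots> = 2 * ?I"
    unfolding mult_2 by (subst (2) refl) (rule nn_integral_add; measurable)
  finally have "(\<integral>\<^sup>+x. ennreal ((norm x)\<^sup>2 * ?g x) \<partial>lborel) \<le> ?I" by (simp add: ennreal_mult_le_mult_iff)
  then have "ennreal ?k * ennreal (real DIM('a) / (2 * ?a) * sqrt (pi / ?a) ^ DIM('a)) \<le> ennreal ?k * ?I"
    unfolding nn_integral_gauss_norm_sq[OF a] by (rule mult_left_mono) simp
  then show ?thesis unfolding eq by (simp add: ennreal_mult'[symmetric] mult.commute)
qed

text \<open>The supremum risk is at least the average of the risk over a centred Gaussian prior for \<open>\<Xi>\<close> at \<open>\<Sigma> = mat 1\<close>. Exchanging
  the integrals puts the posterior risk inside, which is bounded for each \<open>(Z, S)\<close> separately.\<close>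

lemma sup_risk_lower_bound:
  fixes \<delta> :: "(complex^'p^'m) \<times> (complex^'p^'p) \<Rightarrow> complex^'p^'m"
  assumes n: "n > real CARD('p) - 1" and \<delta>: "\<delta> \<in> borel_measurable borel" and l: "\<kappa> > 0"
  shows "ennreal (real (CARD('m) * CARD('p)) / (1 + \<kappa>)) \<le> sup_risk n \<delta>"
proof -
  let ?D = "CARD('m) * CARD('p)" and ?a = "1 + \<kappa>"
  let ?Q = "cwishart (mat 1 :: complex^'p^'p) n"
  interpret Q: prob_space ?Q by (rule prob_space_cwishart_1[OF n])
  interpret LQ: pair_sigma_finite "lborel :: (complex^'p^'m) measure" ?Q ..
  have [measurable]: "\<delta> \<in> borel_measurable (borel \<Otimes>\<^sub>M borel)" using \<delta> by (simp add: borel_prod)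
  define prior where "prior x = ennreal ((\<kappa> / pi) ^ ?D * exp (- \<kappa> * (norm x)\<^sup>2))" for x :: "complex^'p^'m"
  have [measurable]: "prior \<in> borel_measurable borel" unfolding prior_def by measurable
  have sD: "sqrt r ^ DIM(complex^'p^'m) = r ^ ?D" if "r \<ge> 0" for r
    unfolding DIM_complex_matrix power_mult using that by simp
  have prior1: "(\<integral>\<^sup>+x. prior x \<partial>lborel) = 1"
  proof -
    have "(\<integral>\<^sup>+x. prior x \<partial>lborel) = ennreal ((\<kappa> / pi) ^ ?D) * (\<integral>\<^sup>+x. ennreal (exp (- \<kappa> * (norm x)\<^sup>2)) \<partial>(lborel :: (complex^'p^'m) measure))"
      unfolding prior_def using l by (subst nn_integral_cmult[symmetric]) (simp_all add: ennreal_mult')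
    also have "\<dots> = ennreal ((\<kappa> / pi) ^ ?D * (pi / \<kappa>) ^ ?D)"
      unfolding nn_integral_gauss[OF l] using l by (subst sD) (simp_all add: ennreal_mult')
    also have "(\<kappa> / pi) ^ ?D * (pi / \<kappa>) ^ ?D = 1" using l by (simp flip: power_mult_distrib)
    finally show ?thesis by simp
  qed
  let ?w = "\<lambda>x z. ennreal (exp (- (norm (z - x))\<^sup>2) / pi ^ ?D)"
  let ?h = "\<lambda>x S z. prior x * (?w x z * ennreal ((norm (\<delta> (z, S) - x))\<^sup>2))"
  define K where "K = (\<kappa> / pi) ^ ?D / pi ^ ?D * (real ?D / ?a * (pi / ?a) ^ ?D)"
  have K: "K \<ge> 0" using l by (simp add: K_def)
  have risk: "prior x * risk n \<delta> x (mat 1) = (\<integral>\<^sup>+S. (\<integral>\<^sup>+z. ?h x S z \<partial>lborel) \<partial>?Q)" for x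
    unfolding risk_mat_1[OF n \<delta>] by (simp add: nn_integral_cnormal_1 nn_integral_cmult)
  have inner: "ennreal K * ennreal (exp (- (\<kappa> / ?a) * (norm z)\<^sup>2)) \<le> (\<integral>\<^sup>+x. ?h x S z \<partial>lborel)" for S z
  proof -
    have "?h x S z = ennreal ((\<kappa> / pi) ^ ?D / pi ^ ?D) * ennreal ((norm (\<delta> (z, S) - x))\<^sup>2 * exp (- (norm (z - x))\<^sup>2 - \<kappa> * (norm x)\<^sup>2))" for x
    proof -
      have "exp (- (norm (z - x))\<^sup>2 - \<kappa> * (norm x)\<^sup>2) = exp (- (norm (z - x))\<^sup>2) * exp (- \<kappa> * (norm x)\<^sup>2)" by (simp flip: exp_add)
      then show ?thesis unfolding prior_def using l by (simp add: ennreal_mult'[symmetric] mult_ac)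
    qed
    then have h: "(\<integral>\<^sup>+x. ?h x S z \<partial>lborel) = ennreal ((\<kappa> / pi) ^ ?D / pi ^ ?D)
        * (\<integral>\<^sup>+x. ennreal ((norm (\<delta> (z, S) - x))\<^sup>2 * exp (- (norm (z - x))\<^sup>2 - \<kappa> * (norm x)\<^sup>2)) \<partial>lborel)"
      by (simp add: nn_integral_cmult)
    have dim: "real DIM(complex^'p^'m) / (2 * ?a) = real ?D / ?a"
      unfolding DIM_complex_matrix using l by (simp add: field_simps)
    have sq: "sqrt (pi / ?a) ^ DIM(complex^'p^'m) = (pi / ?a) ^ ?D" using l by (intro sD) simp
    have "ennreal K * ennreal E = ennreal ((\<kappa> / pi) ^ ?D / pi ^ ?D) * ennreal (real ?D / ?a * (pi / ?a) ^ ?D * E)" if "E \<ge> 0" for E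
      using that l by (simp add: K_def ennreal_mult'[symmetric] mult_ac)
    then show ?thesis
      unfolding h using mult_left_mono[OF posterior_risk_lower_bound[OF l, of z "\<delta> (z, S)", unfolded dim sq]] by simp
  qed
  have "ennreal (real ?D / ?a) = (\<integral>\<^sup>+z. ennreal K * ennreal (exp (- (\<kappa> / ?a) * (norm z)\<^sup>2)) \<partial>(lborel :: (complex^'p^'m) measure))"
  proof -
    have "\<kappa> / ?a > 0" using l by simp
    note g = nn_integral_gauss[OF this, where 'a="complex^'p^'m"]
    have "(\<integral>\<^sup>+z. ennreal K * ennreal (exp (- (\<kappa> / ?a) * (norm z)\<^sup>2)) \<partial>(lborel :: (complex^'p^'m) measure))
        = ennreal K * ennreal (sqrt (pi / (\<kappa> / ?a)) ^ DIM(complex^'p^'m))"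
      by (subst nn_integral_cmult) (measurable, simp only: g)
    also have "sqrt (pi / (\<kappa> / ?a)) ^ DIM(complex^'p^'m) = (pi / (\<kappa> / ?a)) ^ ?D" using l by (intro sD) simp
    also have "ennreal K * ennreal ((pi / (\<kappa> / ?a)) ^ ?D) = ennreal (K * (pi / (\<kappa> / ?a)) ^ ?D)" using K by (rule ennreal_mult'[symmetric])
    also have "K * (pi / (\<kappa> / ?a)) ^ ?D = real ?D / ?a"
    proof -
      have one: "(\<kappa> / pi) / pi * (pi / a) * (pi / (\<kappa> / a)) = 1" if "a > 0" for a :: real
        using l that by (simp add: field_simps)
      have "(\<kappa> / pi) ^ ?D / pi ^ ?D * (pi / ?a) ^ ?D * (pi / (\<kappa> / ?a)) ^ ?D = ((\<kappa> / pi) / pi * (pi / ?a) * (pi / (\<kappa> / ?a))) ^ ?D"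
        by (simp only: power_mult_distrib power_divide)
      moreover from one[of ?a] have "(\<kappa> / pi) / pi * (pi / ?a) * (pi / (\<kappa> / ?a)) = 1" using l by simp
      ultimately have unit: "(\<kappa> / pi) ^ ?D / pi ^ ?D * (pi / ?a) ^ ?D * (pi / (\<kappa> / ?a)) ^ ?D = 1" by (simp only: power_one)
      have "K * (pi / (\<kappa> / ?a)) ^ ?D = real ?D / ?a * ((\<kappa> / pi) ^ ?D / pi ^ ?D * (pi / ?a) ^ ?D * (pi / (\<kappa> / ?a)) ^ ?D)"
        unfolding K_def by (simp only: mult_ac)
      then show ?thesis unfolding unit by (simp only: mult_1_right)
    qed
    finally show ?thesis ..
  qed
  also have "\<dots> = (\<integral>\<^sup>+S. (\<integral>\<^sup>+z. ennreal K * ennreal (exp (- (\<kappa> / ?a) * (norm z)\<^sup>2)) \<partial>(lborel :: (complex^'p^'m) measure)) \<partial>?Q)"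
    using Q.emeasure_space_1 by simp
  also have "\<dots> \<le> (\<integral>\<^sup>+S. (\<integral>\<^sup>+z. (\<integral>\<^sup>+x. ?h x S z \<partial>lborel) \<partial>lborel) \<partial>?Q)"
    by (intro nn_integral_mono inner)
  also have "\<dots> = (\<integral>\<^sup>+S. (\<integral>\<^sup>+x. (\<integral>\<^sup>+z. ?h x S z \<partial>lborel) \<partial>lborel) \<partial>?Q)"
    by (intro nn_integral_cong lborel_pair.Fubini') measurable
  also have "\<dots> = (\<integral>\<^sup>+x. (\<integral>\<^sup>+S. (\<integral>\<^sup>+z. ?h x S z \<partial>lborel) \<partial>?Q) \<partial>lborel)"
    by (rule LQ.Fubini') measurable
  also have "\<dots> = (\<integral>\<^sup>+x. prior x * risk n \<delta> x (mat 1) \<partial>lborel)" unfolding risk ..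
  also have "\<dots> \<le> (\<integral>\<^sup>+x. prior x * sup_risk n \<delta> \<partial>lborel)"
  proof (intro nn_integral_mono mult_left_mono)
    fix x show "risk n \<delta> x (mat 1) \<le> sup_risk n \<delta>"
      unfolding sup_risk_def by (rule SUP_upper2[of "(x, mat 1)"]) simp_all
  qed simp
  also have "\<dots> = sup_risk n \<delta>" by (simp add: nn_integral_multc prior1)
  finally show ?thesis .
qed

theorem corollary1:
  fixes n :: real
  assumes "CARD('m::finite) \<noteq> CARD('p::finite)"
    and "n > real CARD('p)"
  shows "minimax n (\<lambda>(Z :: complex^'p^'m, S :: complex^'p^'p). efron_morris n Z S)"
proof -
  let ?em = "\<lambda>(Z :: complex^'p^'m, S :: complex^'p^'p). efron_morris n Z S" and ?d = "real (CARD('m) * CARD('p))"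
  have em: "?em \<in> estimators" unfolding estimators_def by (rule measurable_efron_morris_pair)
  have n1: "n > real CARD('p) - 1" using assms(2) by simp
  have lower: "ennreal ?d \<le> sup_risk n \<delta>" if "\<delta> \<in> estimators" for \<delta> :: "(complex^'p^'m) \<times> (complex^'p^'p) \<Rightarrow> complex^'p^'m"
  proof -
    have lim: "((\<lambda>\<kappa>. ennreal (?d / (1 + \<kappa>))) \<longlongrightarrow> ennreal (?d / (1 + 0))) (at_right 0)"
      by (intro tendsto_ennrealI tendsto_intros) simp
    have "ennreal (?d / (1 + 0)) \<le> sup_risk n \<delta>"
      using that n1 by (intro tendsto_upperbound[OF lim]) (auto intro!: eventually_at_rightI[of 0 1] sup_risk_lower_bound simp: estimators_def simp del: of_nat_mult)
    then show ?thesis by simp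
  qed
  have "sup_risk n ?em \<le> ennreal ?d" by (rule sup_risk_efron_morris[OF assms])
  also have "\<dots> \<le> (INF \<delta>'\<in>estimators. sup_risk n (\<delta>' :: (complex^'p^'m) \<times> (complex^'p^'p) \<Rightarrow> complex^'p^'m))"
    by (rule INF_greatest) (rule lower)
  finally have "sup_risk n ?em \<le> (INF \<delta>'\<in>estimators. sup_risk n (\<delta>' :: (complex^'p^'m) \<times> (complex^'p^'p) \<Rightarrow> complex^'p^'m))" .
  moreover have "(INF \<delta>'\<in>estimators. sup_risk n (\<delta>' :: (complex^'p^'m) \<times> (complex^'p^'p) \<Rightarrow> complex^'p^'m)) \<le> sup_risk n ?em"
    by (rule INF_lower[OF em])
  ultimately show ?thesis unfolding minimax_def using em by (auto intro: antisym)
qed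

end
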